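(* For integers $n,k$, let $a_{n,k}$ be the number of permutations $\sigma\in S_n$ whose longest increasing subsequence has length exactly $k$. The bivariate sequence $a_{n,k}$ is D-finite inside the region $n/2\le k\le n$; that is, there exists a D-finite array $(c_{n,k})_{n,k\ge 0}$ such that $c_{n,k}=a_{n,k}$ for all integers $n\ge 1$ and $k$ with $n/2\le k\le n$.
   Context: $S_n$ is the symmetric group on $\{1,\dots,n\}$, and $a_{n,k}:=\#\{\sigma\in S_n\mid \mathrm{LIS}(\sigma)=k\}$, where $\mathrm{LIS}(\sigma)$ is the length of the longest increasing subsequence of $\sigma$. An array $(c_{n,k})_{n,k\ge0}$ of numbers is called D-finite if there exist $r,s\geq 0$ and polynomials $p_0,\dots,p_r$ in two variables, not all zero, and polynomials $q_0,\dots,q_s$ in two variables, not all zero, such that for all $n,k\ge 0$ $$p_0(n,k)c_{n,k}+p_1(n,k)c_{n+1,k}+\cdots+p_r(n,k)c_{n+r,k}=0$$ and $$q_0(n,k)c_{n,k}+q_1(n,k)c_{n,k+1}+\cdots+q_s(n,k)c_{n,k+s}=0.$$ An array is called D-finite inside a region $R$ if there exists a D-finite array that coincides with it inside $R$. *)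

theory Defs
  imports Complex_Main "HOL-Computational_Algebra.Polynomial" "HOL-Combinatorics.Permutations"
begin

definition LIS :: "nat \<Rightarrow> (nat \<Rightarrow> nat) \<Rightarrow> nat" where
  "LIS n \<sigma> = Max {card I | I. I \<subseteq> {1..n} \<and> strict_mono_on I \<sigma>}"

definition lis_count :: "nat \<Rightarrow> nat \<Rightarrow> nat" where
  "lis_count n k = card {\<sigma>. \<sigma> permutes {1..n} \<and> LIS n \<sigma> = k}"

text \<open>A polynomial in two variables is an element of \<open>'a[x][y]\<close>: the inner
  polynomials are in \<open>x\<close>, the outer variable is \<open>y\<close>.\<close>

definition poly_xy :: "'a::comm_ring_1 poly poly \<Rightarrow> 'a \<Rightarrow> 'a \<Rightarrow> 'a" where
  "poly_xy p x y = poly (poly p [:y:]) x"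

definition D_finite :: "(nat \<Rightarrow> nat \<Rightarrow> 'a::field_char_0) \<Rightarrow> bool" where
  "D_finite c \<longleftrightarrow>
     (\<exists>(r::nat) (p :: nat \<Rightarrow> 'a poly poly).
        (\<exists>i\<le>r. p i \<noteq> 0) \<and>
        (\<forall>n k. (\<Sum>i\<le>r. poly_xy (p i) (of_nat n) (of_nat k) * c (n + i) k) = 0)) \<and>
     (\<exists>(s::nat) (q :: nat \<Rightarrow> 'a poly poly).
        (\<exists>j\<le>s. q j \<noteq> 0) \<and>
        (\<forall>n k. (\<Sum>j\<le>s. poly_xy (q j) (of_nat n) (of_nat k) * c n (k + j)) = 0))"

definition D_finite_inside :: "(nat \<times> nat) set \<Rightarrow> (nat \<Rightarrow> nat \<Rightarrow> 'a::field_char_0) \<Rightarrow> bool" where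
  "D_finite_inside R a \<longleftrightarrow>
     (\<exists>c :: nat \<Rightarrow> nat \<Rightarrow> 'a. D_finite c \<and> (\<forall>(n, k)\<in>R. c n k = a n k))"

end

theory Submission
  imports Defs "Jordan_Normal_Form.Determinant"
begin

text \<open>Fix \<open>n\<close>, put \<open>N = {1..n}\<close> and write \<open>k = n - m\<close>. In the region of the theorem \<open>2 * m \<le> n\<close>. The
idea is to read the number of permutations with a long increasing subsequence as the dimension of a
space of functions, to compute that dimension as the trace of an explicit projection, and to observe
that the resulting single sum of hypergeometric terms makes sense, and is D-finite, for all \<open>n\<close>, \<open>k\<close>.

Say that a function on the permutations of \<open>N\<close> has degree at most \<open>m\<close> if it is a linear combination
of indicators of the events "the values at certain \<open>m\<close> points are prescribed". Every permutation
\<open>s\<close> gives a function. If \<open>s\<close> has an increasing subsequence of length \<open>k\<close>, take the indicator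
of all permutations that agree with \<open>s\<close> off one such subsequence: it has degree at most \<open>m\<close>, and \<open>s\<close>
is the lexicographically least permutation in its support, because the free values are filled in
increasingly. Otherwise cut the positions into fewer than \<open>k\<close> blocks according to the length of the
longest increasing subsequence that ends there; \<open>s\<close> decreases on each block. The signed sum over all
rearrangements of \<open>s\<close> inside the blocks is orthogonal to all functions of degree at most \<open>m\<close>, since
among any \<open>k\<close> positions two lie in the same block and a transposition cancels, and now \<open>s\<close> is
the lexicographically greatest element of the support. Orthogonality and the two triangular shapes
make these functions a basis, so the number of permutations with an increasing
subsequence of length \<open>k\<close> is the trace of the orthogonal projection onto the functions of degree at
most \<open>m\<close> (\<open>card_eq_stratum_dim\<close>, \<open>card_LIS_ge\<close>).

The projection is built one stratum at a time, a stratum being the functions of degree at most \<open>m\<close>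
that are orthogonal to those of degree at most \<open>m - 1\<close>. For such a function, its sums over
the cosets "the \<open>m\<close> points \<open>l\<close> go to the \<open>m\<close> values \<open>k\<close>" are harmonic in \<open>l\<close> and in
\<open>k\<close>: they add up to zero whenever one coordinate runs through all values that the others leave free.
Harmonicity lets one trade coordinates outside a set for coordinates inside it at the price of a
sign (\<open>harmonic_swap\<close>). By this rule every computation in the stratum collapses to
convolutions in the group algebra of the symmetric group on \<open>m\<close> letters, where two explicit
elements, \<open>overlap\<close> and \<open>harm_char\<close>, turn out to be inverse to each other up to a scalar
(\<open>overlap_harm_char\<close>); the inequality \<open>2 * m \<le> n\<close> keeps the differences in their coefficients from
being truncated. The inverse supplies the kernel
of the projection (\<open>coset_sum_stratum_op\<close>, \<open>degree_op_degree_le\<close>), and its trace gives the number of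
permutations whose longest increasing subsequence has length exactly \<open>k\<close> as
\<open>(\<Sum>t. harm_char t ^ 2) / fact m\<close> (\<open>lis_count_stratum_dim\<close>).

Expanding the square, collecting subsets by their sizes and applying Vandermonde's identity turns
this into the sum over \<open>s = k..n\<close> of
\<open>(- 1) ^ (s - k) * ((2 * s - 1) choose (s - k)) * fact n ^ 2 / (fact s ^ 2 * fact (n - s))\<close>
(\<open>stratum_dim_closed_form\<close>). In this sum \<open>n\<close> occurs, apart from the factor \<open>fact n ^ 2\<close>, only
in \<open>1 / fact (n - s)\<close>, and \<open>k\<close> only in the signed binomial coefficient. Multiplication of the
summand by \<open>s\<close> can therefore be expressed by shifts in \<open>n\<close> alone as well as by shifts in
\<open>k\<close> alone, and the first-order recurrence of the summand in \<open>s\<close> becomes a recurrence of the sum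
in \<open>n\<close> and one in \<open>k\<close>.\<close>

\<comment> \<open>Below, \<open>inv\<close> is the inverse of a function, not of a group element.\<close>
no_notation m_inv (\<open>(\<open>open_block notation=\<open>prefix inv\<close>\<close>inv\<index> _)\<close> [81] 80)

section \<open>Sums over injections and the harmonic swap rule\<close>

text \<open>Injections are extensional, so that an injection is determined by its values on the index
set and sums over all injections between finite sets are finite.\<close>

definition injs :: "'i set \<Rightarrow> 'a set \<Rightarrow> ('i \<Rightarrow> 'a) set" where
  "injs J B = {f \<in> J \<rightarrow>\<^sub>E B. inj_on f J}"

lemma finite_injs [simp]: "finite J \<Longrightarrow> finite B \<Longrightarrow> finite (injs J B)"
  unfolding injs_def by (simp add: finite_PiE)

lemma injs_empty [simp]: "injs {} B = {\<lambda>x. undefined}"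
  unfolding injs_def by auto

lemma injsD:
  assumes "f \<in> injs J B"
  shows "inj_on f J" "f ` J \<subseteq> B" "f \<in> extensional J"
  using assms by (auto simp: injs_def PiE_def)

lemma injs_eqI:
  assumes "f \<in> extensional J" "g \<in> extensional J" "\<And>x. x \<in> J \<Longrightarrow> f x = g x"
  shows "f = g"
  using assms by (meson extensionalityI)

lemma injs_insert:
  assumes "x \<notin> J"
  shows "injs (insert x J) B = (\<lambda>(v, g). g(x := v)) ` (SIGMA v:B. injs J (B - {v}))"
  using extensional_funcset_extend_domain_inj_on_eq[OF assms, of B]
  unfolding injs_def by (auto simp: Sigma_def image_def Bex_def; blast)

text \<open>The two ways to enumerate injections on one more index, choosing the new value first or
last, are both needed: the swap rule plays them against each other.\<close>

lemma sum_injs_insert: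
  fixes X :: "('i \<Rightarrow> 'a) \<Rightarrow> 'c::comm_monoid_add"
  assumes "x \<notin> J" "finite J" "finite B"
  shows "sum X (injs (insert x J) B) = (\<Sum>v\<in>B. \<Sum>f\<in>injs J (B - {v}). X (f(x := v)))"
proof -
  have inj: "inj_on (\<lambda>(v, g). g(x := v)) (SIGMA v:B. injs J (B - {v}))"
    using extensional_funcset_extend_domain_inj_onI[OF assms(1), of B]
    by (rule inj_on_subset) (auto simp: injs_def)
  show ?thesis
    unfolding injs_insert[OF assms(1)] sum.reindex[OF inj]
    using assms by (subst sum.Sigma) (auto simp: case_prod_unfold)
qed

lemma sum_injs_insert':
  fixes X :: "('i \<Rightarrow> 'a) \<Rightarrow> 'c::comm_monoid_add"
  assumes "x \<notin> J" "finite J" "finite B"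
  shows "sum X (injs (insert x J) B) = (\<Sum>f\<in>injs J B. \<Sum>v\<in>B - f ` J. X (f(x := v)))"
proof -
  have "(\<Sum>v\<in>B. \<Sum>f\<in>injs J (B - {v}). X (f(x := v)))
      = (\<Sum>(v, f)\<in>(SIGMA v:B. injs J (B - {v})). X (f(x := v)))"
    using assms by (subst sum.Sigma) auto
  also have "\<dots> = (\<Sum>(f, v)\<in>(SIGMA f:injs J B. B - f ` J). X (f(x := v)))"
    by (rule sum.reindex_bij_witness[where i = prod.swap and j = prod.swap])
       (auto simp: injs_def PiE_def Pi_def)
  also have "\<dots> = (\<Sum>f\<in>injs J B. \<Sum>v\<in>B - f ` J. X (f(x := v)))"
    using assms by (subst sum.Sigma) auto
  finally show ?thesis using sum_injs_insert[OF assms, of X] by simp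
qed

text \<open>A harmonic function is orthogonal to everything that depends on fewer than all coordinates:
once all coordinates but one are fixed, the values at the remaining admissible points cancel.\<close>

definition harmonic :: "'i set \<Rightarrow> 'a set \<Rightarrow> (('i \<Rightarrow> 'a) \<Rightarrow> real) \<Rightarrow> bool" where
  "harmonic J B \<Psi> \<longleftrightarrow>
     (\<forall>x\<in>J. \<forall>f\<in>injs (J - {x}) B. (\<Sum>v\<in>B - f ` (J - {x}). \<Psi> (f(x := v))) = 0)"

lemma harmonic_override:
  assumes h: "harmonic I B \<Psi>" and K: "K \<subseteq> I" and g: "inj_on g K" "g ` K \<subseteq> B"
  shows "harmonic (I - K) (B - g ` K) (\<lambda>f. \<Psi> (override_on f g K))"
  unfolding harmonic_def
proof (intro ballI)
  fix x f assume x: "x \<in> I - K" and f: "f \<in> injs (I - K - {x}) (B - g ` K)"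
  let ?f = "override_on f g K"
  have mem: "?f \<in> injs (I - {x}) B"
    unfolding injs_def
  proof (intro CollectI conjI)
    show "?f \<in> (I - {x}) \<rightarrow>\<^sub>E B"
      using f g(2) K x by (auto simp: injs_def PiE_def Pi_def extensional_def override_on_def)
    have fi: "inj_on f (I - K - {x})" "\<And>z. z \<in> I - K - {x} \<Longrightarrow> f z \<notin> g ` K"
      using f by (auto simp: injs_def)
    show "inj_on ?f (I - {x})"
    proof (rule inj_onI)
      fix y z assume "y \<in> I - {x}" "z \<in> I - {x}" "?f y = ?f z"
      then show "y = z"
        using inj_onD[OF fi(1), of y z] inj_onD[OF g(1), of y z] fi(2)[of y] fi(2)[of z] imageI[of y K g] imageI[of z K g]
        by (cases "y \<in> K"; cases "z \<in> K") (auto simp: override_on_def)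
    qed
  qed
  have im: "?f ` (I - {x}) = f ` (I - K - {x}) \<union> g ` K"
    using K x by (auto simp: override_on_def image_def)
  have upd: "override_on (f(x := v)) g K = ?f(x := v)" for v
    using x by (auto simp: override_on_def fun_eq_iff)
  have "(\<Sum>v\<in>B - ?f ` (I - {x}). \<Psi> (?f(x := v))) = 0"
    using h mem x unfolding harmonic_def by blast
  moreover have "B - g ` K - f ` (I - K - {x}) = B - ?f ` (I - {x})"
    unfolding im by blast
  ultimately show "(\<Sum>v\<in>B - g ` K - f ` (I - K - {x}). \<Psi> (override_on (f(x := v)) g K)) = 0"
    unfolding upd by simp
qed

text \<open>For one coordinate the rule is the definition of harmonicity. For several, the last
coordinate is moved from outside \<open>Q\<close> to inside, which costs a sign and removes one point from both
\<open>B\<close> and \<open>Q\<close> for the others.\<close>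

lemma harmonic_swap:
  assumes "finite J" "finite B" "harmonic J B \<Psi>" "Q \<subseteq> B"
  shows "(\<Sum>f\<in>injs J (B - Q). \<Psi> f) = (- 1) ^ card J * (\<Sum>f\<in>injs J Q. \<Psi> f)"
  using assms
proof (induction J arbitrary: B Q \<Psi> rule: finite_induct)
  case empty
  then show ?case by simp
next
  case (insert x J)
  have finQ: "finite Q" using insert.prems finite_subset by blast
  \<comment> \<open>With the other coordinates fixed outside \<open>Q\<close>, the free values are those of \<open>Q\<close> and the unused ones outside.\<close>
  have inner: "(\<Sum>v\<in>(B - Q) - f ` J. \<Psi> (f(x := v))) = - (\<Sum>v\<in>Q. \<Psi> (f(x := v)))"
    if f: "f \<in> injs J (B - Q)" for f
  proof -
    have fB: "f \<in> injs J B" using f by (auto simp: injs_def PiE_def Pi_def)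
    have "(\<Sum>v\<in>B - f ` J. \<Psi> (f(x := v))) = 0"
      using insert.prems(2) fB insert.hyps(2) unfolding harmonic_def
      by (metis Diff_insert_absorb insertI1)
    moreover have "B - f ` J = ((B - Q) - f ` J) \<union> Q"
      using injsD(2)[OF f] insert.prems(3) by blast
    moreover have "((B - Q) - f ` J) \<inter> Q = {}" by blast
    ultimately show ?thesis
      using finQ insert.prems(1) sum.union_disjoint[of "(B - Q) - f ` J" Q "\<lambda>v. \<Psi> (f(x := v))"]
      by simp
  qed
  have har: "harmonic J (B - {v}) (\<lambda>f. \<Psi> (f(x := v)))" if v: "v \<in> B" for v
  proof -
    have "harmonic (insert x J - {x}) (B - (\<lambda>_. v) ` {x}) (\<lambda>f. \<Psi> (override_on f (\<lambda>_. v) {x}))"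
      by (rule harmonic_override[OF insert.prems(2)]) (use v in auto)
    moreover have "override_on f (\<lambda>_. v) {x} = f(x := v)" for f
      by (auto simp: override_on_def fun_eq_iff)
    ultimately show ?thesis using insert.hyps(2) by simp
  qed
  have "(\<Sum>f\<in>injs (insert x J) (B - Q). \<Psi> f) = (\<Sum>f\<in>injs J (B - Q). \<Sum>v\<in>(B - Q) - f ` J. \<Psi> (f(x := v)))"
    using insert.hyps insert.prems by (subst sum_injs_insert') auto
  also have "\<dots> = (\<Sum>f\<in>injs J (B - Q). - (\<Sum>v\<in>Q. \<Psi> (f(x := v))))"
    by (rule sum.cong[OF refl inner])
  also have "\<dots> = - (\<Sum>v\<in>Q. \<Sum>f\<in>injs J (B - Q). \<Psi> (f(x := v)))"
    unfolding sum_negf by (subst sum.swap) simp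
  also have "\<dots> = - (\<Sum>v\<in>Q. (- 1) ^ card J * (\<Sum>f\<in>injs J (Q - {v}). \<Psi> (f(x := v))))"
  proof -
    have "(\<Sum>f\<in>injs J (B - Q). \<Psi> (f(x := v))) = (- 1) ^ card J * (\<Sum>f\<in>injs J (Q - {v}). \<Psi> (f(x := v)))"
      if v: "v \<in> Q" for v
    proof -
      have e: "B - {v} - (Q - {v}) = B - Q" using v by blast
      show ?thesis
        using insert.IH[of "B - {v}" "\<lambda>f. \<Psi> (f(x := v))" "Q - {v}"] har[of v] v insert.prems
        unfolding e by (metis Diff_mono finite_Diff insert_subset mk_disjoint_insert subset_insertI subset_refl)
    qed
    then show ?thesis by simp
  qed
  also have "\<dots> = (- 1) ^ card (insert x J) * (\<Sum>v\<in>Q. \<Sum>f\<in>injs J (Q - {v}). \<Psi> (f(x := v)))"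
    using insert.hyps by (simp add: sum_distrib_left sum_negf)
  also have "\<dots> = (- 1) ^ card (insert x J) * (\<Sum>f\<in>injs (insert x J) Q. \<Psi> f)"
    using insert.hyps finQ by (simp add: sum_injs_insert)
  finally show ?case .
qed

lemma sum_injs_override:
  fixes X :: "('i \<Rightarrow> 'a) \<Rightarrow> 'c::comm_monoid_add"
  assumes K: "K \<subseteq> I" and g: "inj_on g K" "g ` K \<subseteq> B" and D: "D \<subseteq> B" "D \<inter> g ` K = {}"
  shows "(\<Sum>f | f \<in> injs I B \<and> (\<forall>x\<in>K. f x = g x) \<and> (\<forall>x\<in>I - K. f x \<in> D). X f)
       = (\<Sum>f\<in>injs (I - K) D. X (override_on f g K))"
proof (rule sum.reindex_bij_witness[where j = "\<lambda>f. restrict f (I - K)" and i = "\<lambda>f. override_on f g K"], goal_cases)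
  case (1 a)
  then show ?case
    by (intro injs_eqI[where J = I]) (use K in \<open>auto simp: injs_def PiE_def override_on_def extensional_def\<close>)
next
  case (2 a)
  then show ?case by (auto simp: injs_def PiE_def inj_on_def)
next
  case (3 b)
  then show ?case
    by (intro injs_eqI[where J = "I - K"]) (auto simp: injs_def PiE_def override_on_def extensional_def)
next
  case (4 b)
  have "override_on b g K \<in> injs I B"
    unfolding injs_def
  proof (intro CollectI conjI)
    show "override_on b g K \<in> I \<rightarrow>\<^sub>E B"
      using 4 K g D by (auto simp: injs_def PiE_def Pi_def extensional_def override_on_def)
    show "inj_on (override_on b g K) I"
    proof (rule inj_onI)
      fix x y assume xy: "x \<in> I" "y \<in> I" "override_on b g K x = override_on b g K y"
      have b: "inj_on b (I - K)" "\<And>z. z \<in> I - K \<Longrightarrow> b z \<in> D" using 4 by (auto simp: injs_def)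
      show "x = y"
        using xy b(2)[of x] b(2)[of y] D(2) imageI[of x K g] imageI[of y K g] inj_onD[OF b(1), of x y] inj_onD[OF g(1), of x y]
        by (cases "x \<in> K"; cases "y \<in> K") (auto simp: override_on_def)
    qed
  qed
  then show ?case using 4 by (auto simp: injs_def override_on_def PiE_def Pi_def)
next
  case (5 a)
  then have "override_on (restrict a (I - K)) g K = a"
    by (intro injs_eqI[where J = I]) (use K in \<open>auto simp: injs_def PiE_def override_on_def extensional_def\<close>)
  then show ?case by simp
qed

lemma sum_injs_agree_on:
  fixes X :: "('i \<Rightarrow> 'a) \<Rightarrow> 'c::comm_monoid_add"
  assumes K: "K \<subseteq> I" and g: "inj_on g K" "g ` K \<subseteq> C"
  shows "(\<Sum>f | f \<in> injs I C \<and> (\<forall>x\<in>K. f x = g x). X f)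
       = (\<Sum>f\<in>injs (I - K) (C - g ` K). X (override_on f g K))"
proof -
  have "f x \<in> C - g ` K" if f: "f \<in> injs I C" "\<forall>x\<in>K. f x = g x" "x \<in> I - K" for f x
  proof -
    have "f x \<noteq> g y" if y: "y \<in> K" for y
    proof
      assume "f x = g y"
      then have "f x = f y" using f(2) y by simp
      then show False using inj_onD[OF injsD(1)[OF f(1)], of x y] K y f(3) by auto
    qed
    then show ?thesis using injsD(2)[OF f(1)] f(3) by auto
  qed
  then have "{f. f \<in> injs I C \<and> (\<forall>x\<in>K. f x = g x)}
      = {f. f \<in> injs I C \<and> (\<forall>x\<in>K. f x = g x) \<and> (\<forall>x\<in>I - K. f x \<in> C - g ` K)}"
    by blast
  moreover have "(\<Sum>f | f \<in> injs I C \<and> (\<forall>x\<in>K. f x = g x) \<and> (\<forall>x\<in>I - K. f x \<in> C - g ` K). X f)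
       = (\<Sum>f\<in>injs (I - K) (C - g ` K). X (override_on f g K))"
    by (rule sum_injs_override[OF K g]) auto
  ultimately show ?thesis by simp
qed

text \<open>Group the injections by the set \<open>K\<close> of indices whose value lies in \<open>C\<close>, where they must agree
with \<open>g\<close>; the remaining coordinates range outside \<open>C\<close>, and the swap rule moves all of them inside.\<close>

lemma sum_injs_agree:
  assumes fin: "finite I" "finite B" and h: "harmonic I B \<Psi>" and C: "C \<subseteq> B" and g: "g \<in> injs I C"
  shows "(\<Sum>f | f \<in> injs I B \<and> (\<forall>x\<in>I. f x = g x \<or> f x \<notin> C). d (card {x\<in>I. f x \<notin> C}) * \<Psi> f)
       = (\<Sum>K\<in>Pow I. d (card (I - K)) * ((- 1) ^ card (I - K) * (\<Sum>f | f \<in> injs I C \<and> (\<forall>x\<in>K. f x = g x). \<Psi> f)))"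
    (is "sum ?G ?S = _")
proof -
  have gi: "inj_on g I" "g ` I \<subseteq> C" using injsD[OF g] by auto
  have finS: "finite ?S" by (rule finite_subset[OF _ finite_injs[OF fin]]) auto
  let ?k = "\<lambda>f. {x\<in>I. f x \<in> C}"
  have "sum ?G ?S = (\<Sum>K\<in>Pow I. sum ?G {f \<in> ?S. ?k f = K})"
    by (rule sum.group[symmetric]) (use finS fin in auto)
  also have "\<dots> = (\<Sum>K\<in>Pow I. d (card (I - K)) * ((- 1) ^ card (I - K) * (\<Sum>f | f \<in> injs I C \<and> (\<forall>x\<in>K. f x = g x). \<Psi> f)))"
  proof (rule sum.cong[OF refl])
    fix K assume "K \<in> Pow I"
    then have K: "K \<subseteq> I" by simp
    have gK: "inj_on g K" "g ` K \<subseteq> C" using gi K by (auto intro: inj_on_subset)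
    have set1: "{f \<in> ?S. ?k f = K} = {f. f \<in> injs I B \<and> (\<forall>x\<in>K. f x = g x) \<and> (\<forall>x\<in>I - K. f x \<in> B - C)}"
    proof (intro equalityI subsetI)
      fix f assume "f \<in> {f \<in> ?S. ?k f = K}"
      then show "f \<in> {f. f \<in> injs I B \<and> (\<forall>x\<in>K. f x = g x) \<and> (\<forall>x\<in>I - K. f x \<in> B - C)}"
        by (auto dest: injsD(2))
    next
      fix f assume f: "f \<in> {f. f \<in> injs I B \<and> (\<forall>x\<in>K. f x = g x) \<and> (\<forall>x\<in>I - K. f x \<in> B - C)}"
      then have "?k f = K" using K gK(2) by auto
      then show "f \<in> {f \<in> ?S. ?k f = K}" using f by auto
    qed
    have "sum ?G {f \<in> ?S. ?k f = K} = (\<Sum>f | f \<in> injs I B \<and> (\<forall>x\<in>K. f x = g x) \<and> (\<forall>x\<in>I - K. f x \<in> B - C). d (card (I - K)) * \<Psi> f)"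
      unfolding set1
    proof (rule sum.cong[OF refl])
      fix f assume f: "f \<in> {f. f \<in> injs I B \<and> (\<forall>x\<in>K. f x = g x) \<and> (\<forall>x\<in>I - K. f x \<in> B - C)}"
      then have "{x\<in>I. f x \<notin> C} = I - K" using K gK(2) by auto
      then show "?G f = d (card (I - K)) * \<Psi> f" by simp
    qed
    also have "\<dots> = d (card (I - K)) * (\<Sum>f | f \<in> injs I B \<and> (\<forall>x\<in>K. f x = g x) \<and> (\<forall>x\<in>I - K. f x \<in> B - C). \<Psi> f)"
      by (simp add: sum_distrib_left)
    also have "(\<Sum>f | f \<in> injs I B \<and> (\<forall>x\<in>K. f x = g x) \<and> (\<forall>x\<in>I - K. f x \<in> B - C). \<Psi> f)
        = (\<Sum>f\<in>injs (I - K) (B - C). \<Psi> (override_on f g K))"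
      by (rule sum_injs_override) (use K gK C in auto)
    also have "\<dots> = (- 1) ^ card (I - K) * (\<Sum>f\<in>injs (I - K) (C - g ` K). \<Psi> (override_on f g K))"
    proof -
      have e: "B - g ` K - (C - g ` K) = B - C" using gK(2) C by blast
      have "harmonic (I - K) (B - g ` K) (\<lambda>f. \<Psi> (override_on f g K))"
        by (rule harmonic_override[OF h K gK(1)]) (use gK(2) C in blast)
      from harmonic_swap[OF _ _ this, of "C - g ` K"] show ?thesis
        unfolding e using fin C by (simp add: Diff_mono)
    qed
    also have "(\<Sum>f\<in>injs (I - K) (C - g ` K). \<Psi> (override_on f g K))
        = (\<Sum>f | f \<in> injs I C \<and> (\<forall>x\<in>K. f x = g x). \<Psi> f)"
      by (rule sum_injs_agree_on[OF K gK, symmetric])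
    finally show "sum ?G {f \<in> ?S. ?k f = K} = d (card (I - K)) * ((- 1) ^ card (I - K) * (\<Sum>f | f \<in> injs I C \<and> (\<forall>x\<in>K. f x = g x). \<Psi> f))" .
  qed
  finally show ?thesis .
qed

lemma compose_in_injs:
  assumes "g \<in> injs I B" "p permutes I"
  shows "compose I g p \<in> injs I B"
  using assms inj_on_subset[OF permutes_inj[OF assms(2)], of I] permutes_in_image[OF assms(2)]
  by (auto simp: injs_def compose_def PiE_def Pi_def inj_on_def)

lemma compose_perm_injs:
  assumes l: "l \<in> injs I N" and s: "s permutes N"
  shows "compose I s l \<in> injs I N"
  using injsD[OF l] permutes_in_image[OF s] inj_onD[OF permutes_inj_on[OF s, of UNIV]]
  by (auto simp: injs_def compose_def inj_on_def)

text \<open>Injections into the image of \<open>g\<close> are the rearrangements of \<open>g\<close>.\<close>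

lemma sum_injs_permutes:
  fixes X :: "('i \<Rightarrow> 'a) \<Rightarrow> 'c::comm_monoid_add"
  assumes fin: "finite I" and g: "g \<in> injs I B" and C: "C = g ` I"
  shows "(\<Sum>f | f \<in> injs I C \<and> Q f. X f) = (\<Sum>p | p permutes I \<and> Q (compose I g p). X (compose I g p))"
proof (rule sum.reindex_bij_witness[where i = "\<lambda>p. compose I g p" and j = "\<lambda>f. restrict_id (inv_into I g \<circ> f) I"], goal_cases)
  case (1 f)
  then have f: "f \<in> injs I C" by simp
  have "g (inv_into I g (f x)) = f x" if "x \<in> I" for x
    using injsD(2)[OF f] that C by (intro f_inv_into_f) auto
  then show ?case
    by (intro injs_eqI[where J = I]) (use injsD(3)[OF f] in \<open>auto simp: compose_def\<close>)
next
  case (2 f)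
  then have f: "f \<in> injs I C" by simp
  have inj: "inj_on (inv_into I g \<circ> f) I"
    using injsD(1,2)[OF f] C by (intro comp_inj_on inj_on_inv_into) auto
  have sub: "(inv_into I g \<circ> f) ` I \<subseteq> I"
    using injsD(2)[OF f] C by (auto intro!: inv_into_into)
  have "bij_betw (inv_into I g \<circ> f) I I"
    using inj sub fin endo_inj_surj[OF fin sub inj] by (simp add: bij_betw_def)
  then have p: "restrict_id (inv_into I g \<circ> f) I permutes I"
    by (rule permutes_restrict_id)
  have "g (inv_into I g (f x)) = f x" if "x \<in> I" for x
    using injsD(2)[OF f] that C by (intro f_inv_into_f) auto
  then have "compose I g (restrict_id (inv_into I g \<circ> f) I) = f"
    by (intro injs_eqI[where J = I]) (use injsD(3)[OF f] in \<open>auto simp: compose_def\<close>)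
  then show ?case using p 2 by simp
next
  case (3 p)
  then have p: "p permutes I" by simp
  show ?case
  proof
    fix x show "restrict_id (inv_into I g \<circ> compose I g p) I x = p x"
      using p permutes_in_image[OF p, of x] permutes_not_in[OF p, of x] injsD(1)[OF g]
      by (cases "x \<in> I") (auto simp: compose_def)
  qed
next
  case (4 p)
  have "compose I g p \<in> injs I C"
    by (rule compose_in_injs) (use 4 g C in \<open>auto simp: injs_def\<close>)
  then show ?case using 4 by simp
next
  case (5 f)
  then have f: "f \<in> injs I C" by simp
  have "g (inv_into I g (f x)) = f x" if "x \<in> I" for x
    using injsD(2)[OF f] that C by (intro f_inv_into_f) auto
  then have "compose I g (restrict_id (inv_into I g \<circ> f) I) = f"
    by (intro injs_eqI[where J = I]) (use injsD(3)[OF f] in \<open>auto simp: compose_def\<close>)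
  then show ?case by simp
qed

section \<open>Sums over cosets of permutations\<close>

lemma permutes_extend:
  assumes "finite N" "D \<subseteq> N" "inj_on h D" "h ` D \<subseteq> N"
  obtains s where "s permutes N" "\<And>x. x \<in> D \<Longrightarrow> s x = h x"
proof -
  have "card (N - D) = card (N - h ` D)"
    using assms by (simp add: card_Diff_subset card_image finite_subset)
  then obtain g where g: "bij_betw g (N - D) (N - h ` D)"
    using assms(1) finite_same_card_bij[of "N - D" "N - h ` D"] by auto
  have hD: "bij_betw h D (h ` D)" using assms(3) by (simp add: bij_betw_def)
  have "bij_betw (\<lambda>x. if x \<in> D then h x else g x) (D \<union> (N - D)) (h ` D \<union> (N - h ` D))"
    by (rule bij_betw_disjoint_Un[OF hD g]) auto
  moreover have "D \<union> (N - D) = N" "h ` D \<union> (N - h ` D) = N" using assms by auto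
  ultimately have "bij_betw (\<lambda>x. if x \<in> D then h x else g x) N N" by simp
  from permutes_restrict_id[OF this] show thesis
    by (rule that) (use assms(2) in auto)
qed

lemma card_permutes_prescribed:
  assumes "finite N" "D \<subseteq> N" "inj_on h D" "h ` D \<subseteq> N"
  shows "card {s. s permutes N \<and> (\<forall>x\<in>D. s x = h x)} = fact (card N - card D)"
proof -
  obtain t where t: "t permutes N" "\<And>x. x \<in> D \<Longrightarrow> t x = h x"
    using permutes_extend[OF assms] by blast
  have "bij_betw (\<lambda>p. t \<circ> p) {p. p permutes (N - D)} {s. s permutes N \<and> (\<forall>x\<in>D. s x = h x)}"
  proof (rule bij_betw_byWitness[where f' = "\<lambda>s. inv t \<circ> s"])
    show "\<forall>p\<in>{p. p permutes N - D}. inv t \<circ> (t \<circ> p) = p"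
      using permutes_inv_o(2)[OF t(1)] by (simp add: comp_assoc[symmetric])
    show "\<forall>s\<in>{s. s permutes N \<and> (\<forall>x\<in>D. s x = h x)}. t \<circ> (inv t \<circ> s) = s"
      using permutes_inv_o(1)[OF t(1)] by (simp add: comp_assoc[symmetric])
    show "(\<lambda>p. t \<circ> p) ` {p. p permutes N - D} \<subseteq> {s. s permutes N \<and> (\<forall>x\<in>D. s x = h x)}"
    proof clarify
      fix p assume p: "p permutes N - D"
      have "p permutes N" using permutes_subset[OF p] by simp
      then show "t \<circ> p permutes N \<and> (\<forall>x\<in>D. (t \<circ> p) x = h x)"
        using permutes_compose[OF _ t(1)] permutes_not_in[OF p] t(2) by auto
    qed
    show "(\<lambda>s. inv t \<circ> s) ` {s. s permutes N \<and> (\<forall>x\<in>D. s x = h x)} \<subseteq> {p. p permutes N - D}"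
    proof clarify
      fix s assume s: "s permutes N" "\<forall>x\<in>D. s x = h x"
      have "inv t \<circ> s permutes N" using permutes_compose[OF s(1) permutes_inv[OF t(1)]] .
      moreover have "(inv t \<circ> s) x = x" if "x \<in> D" for x
        using s(2) t(2)[OF that] that permutes_inv_eq[OF t(1)] by simp
      ultimately show "inv t \<circ> s permutes N - D"
        by (rule permutes_superset) auto
    qed
  qed
  then have "card {s. s permutes N \<and> (\<forall>x\<in>D. s x = h x)} = card {p. p permutes (N - D)}"
    by (simp add: bij_betw_same_card)
  also have "\<dots> = fact (card (N - D))"
    by (rule card_permutations) (use assms in auto)
  also have "card (N - D) = card N - card D"
    using assms by (meson card_Diff_subset finite_subset)
  finally show ?thesis .
qed

text \<open>If a permutation sends \<open>l\<close> to \<open>k\<close>, its value at a point \<open>i x\<close> that happens to be one of the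
points \<open>l\<close> is forced; this is that forced value.\<close>

lemma pull_through_coset:
  assumes l: "l \<in> injs I N" and k: "k \<in> injs I N" and i: "i \<in> injs M N"
  shows "inj_on (\<lambda>x. k (inv_into I l (i x))) {x\<in>M. i x \<in> l ` I}"
    and "(\<lambda>x. k (inv_into I l (i x))) ` {x\<in>M. i x \<in> l ` I} \<subseteq> k ` I"
proof -
  show "inj_on (\<lambda>x. k (inv_into I l (i x))) {x\<in>M. i x \<in> l ` I}"
  proof (rule inj_onI)
    fix x y assume xy: "x \<in> {x\<in>M. i x \<in> l ` I}" "y \<in> {x\<in>M. i x \<in> l ` I}"
      "k (inv_into I l (i x)) = k (inv_into I l (i y))"
    then have "inv_into I l (i x) = inv_into I l (i y)"
      by (intro inj_onD[OF injsD(1)[OF k]]) (auto intro: inv_into_into)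
    then have "i x = i y" using xy by (auto dest: inv_into_injective)
    then show "x = y" using inj_onD[OF injsD(1)[OF i]] xy by blast
  qed
qed (auto intro: inv_into_into)

text \<open>Along a coset, the values at the points \<open>i\<close> are forced where \<open>i\<close> meets \<open>l\<close> and are otherwise
arbitrary outside the image of \<open>k\<close>. Every admissible choice is taken by equally many permutations.\<close>

lemma sum_permutes_coset:
  fixes X :: "('i \<Rightarrow> 'a) \<Rightarrow> real"
  assumes fin: "finite N" "finite M" "finite I"
    and l: "l \<in> injs I N" and k: "k \<in> injs I N" and i: "i \<in> injs M N"
  defines "K \<equiv> {x\<in>M. i x \<in> l ` I}" and "g \<equiv> \<lambda>x. k (inv_into I l (i x))"
  shows "(\<Sum>s | s permutes N \<and> (\<forall>x\<in>I. s (l x) = k x). X (compose M s i))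
       = fact (card N - card I - card (M - K)) * (\<Sum>f\<in>injs (M - K) (N - k ` I). X (override_on f g K))"
proof -
  let ?S = "{s. s permutes N \<and> (\<forall>x\<in>I. s (l x) = k x)}"
  let ?T = "{f. f \<in> injs M N \<and> (\<forall>x\<in>K. f x = g x) \<and> (\<forall>x\<in>M - K. f x \<in> N - k ` I)}"
  have KM: "K \<subseteq> M" unfolding K_def by auto
  note li = injsD[OF l] and ki = injsD[OF k] and ii = injsD[OF i]
  have ll: "inv_into I l (l x) = x" if "x \<in> I" for x using li(1) that by simp
  have lK: "l (inv_into I l (i x)) = i x" "inv_into I l (i x) \<in> I" if "x \<in> K" for x
    using that unfolding K_def by (auto intro: f_inv_into_f inv_into_into)
  have gK: "inj_on g K" "g ` K \<subseteq> k ` I"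
    unfolding g_def K_def by (rule pull_through_coset[OF l k i])+
  have finS: "finite ?S" using finite_permutations[OF fin(1)] by (rule rev_finite_subset) auto
  have finT: "finite ?T" by (rule finite_subset[OF _ finite_injs[OF fin(2,1)]]) auto
  have maps: "(\<lambda>s. compose M s i) ` ?S \<subseteq> ?T"
  proof (clarify, intro conjI ballI)
    fix s assume s: "s permutes N" "\<forall>x\<in>I. s (l x) = k x"
    show "compose M s i \<in> injs M N"
      by (rule compose_perm_injs[OF i s(1)])
    show "compose M s i x = g x" if "x \<in> K" for x
      using s(2) lK[OF that] that KM by (auto simp: compose_def g_def)
    show "compose M s i x \<in> N - k ` I" if x: "x \<in> M - K" for x
    proof -
      have "s (i x) \<in> N" using ii(2) x permutes_in_image[OF s(1)] by auto
      moreover have "s (i x) \<noteq> k z" if "z \<in> I" for z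
      proof
        assume "s (i x) = k z"
        then have "s (i x) = s (l z)" using s(2) that by simp
        then have "i x = l z" using permutes_inj[OF s(1)] by (simp add: inj_eq)
        then show False using x that unfolding K_def by auto
      qed
      ultimately show ?thesis using x by (auto simp: compose_def)
    qed
  qed
  define D where "D = l ` I \<union> i ` M"
  have DN: "D \<subseteq> N" using li(2) ii(2) unfolding D_def by auto
  have cardD: "card D = card I + card (M - K)"
  proof -
    have "D = l ` I \<union> i ` (M - K)" unfolding D_def K_def by auto
    moreover have "i x \<notin> l ` I" if "x \<in> M - K" for x using that unfolding K_def by auto
    then have "l ` I \<inter> i ` (M - K) = {}" unfolding disjoint_iff by (metis imageE)
    ultimately have "card D = card (l ` I) + card (i ` (M - K))"
      using fin by (simp add: card_Un_disjoint)
    then show ?thesis using li(1) ii(1) by (simp add: card_image inj_on_subset)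
  qed
  have fibre: "card {s \<in> ?S. compose M s i = f} = fact (card N - card I - card (M - K))" if f: "f \<in> ?T" for f
  proof -
    define h where "h y = (if y \<in> l ` I then k (inv_into I l y) else f (inv_into M i y))" for y
    have fi: "inj_on f M" "f ` M \<subseteq> N" "f \<in> extensional M" using f injsD[of f M N] by auto
    have hl: "h (l x) = k x" if "x \<in> I" for x using that ll by (simp add: h_def)
    have hi: "h (i x) = f x" if "x \<in> M" for x
    proof (cases "x \<in> K")
      case True then show ?thesis using f unfolding h_def g_def K_def by auto
    next
      case False
      then have "i x \<notin> l ` I" using that unfolding K_def by auto
      then show ?thesis using ii(1) that by (simp add: h_def)
    qed
    have hD: "h ` D \<subseteq> N" using hl hi ki(2) fi(2) unfolding D_def by auto
    have D': "\<exists>x\<in>M - K. y = i x" if "y \<in> D" "y \<notin> l ` I" for y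
      using that unfolding D_def K_def by auto
    have injh: "inj_on h D"
    proof (rule inj_onI)
      fix y z assume yz: "y \<in> D" "z \<in> D" "h y = h z"
      consider (a) x x' where "x \<in> I" "y = l x" "x' \<in> I" "z = l x'"
        | (b) x x' where "x \<in> I" "y = l x" "x' \<in> M - K" "z = i x'"
        | (c) x x' where "x' \<in> I" "z = l x'" "x \<in> M - K" "y = i x"
        | (d) x x' where "x \<in> M" "y = i x" "x' \<in> M" "z = i x'"
        using D'[of y] D'[of z] yz by (cases "y \<in> l ` I"; cases "z \<in> l ` I") auto
      then show "y = z"
      proof cases
        case a
        then show ?thesis using hl yz(3) inj_onD[OF ki(1), of x x'] by simp
      next
        case b
        then have "k x = f x'" using hl hi yz(3) by simp
        moreover have "f x' \<notin> k ` I" using f b by auto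
        ultimately show ?thesis using b imageI[of x I k] by auto
      next
        case c
        then have "k x' = f x" using hl hi yz(3) by simp
        moreover have "f x \<notin> k ` I" using f c by auto
        ultimately show ?thesis using c imageI[of x' I k] by auto
      next
        case d
        then show ?thesis using hi yz(3) inj_onD[OF fi(1), of x x'] by simp
      qed
    qed
    have "{s \<in> ?S. compose M s i = f} = {s. s permutes N \<and> (\<forall>y\<in>D. s y = h y)}"
    proof (intro equalityI subsetI)
      fix s assume s: "s \<in> {s \<in> ?S. compose M s i = f}"
      have "s (i x) = f x" if "x \<in> M" for x using s that by (auto simp: compose_def)
      then show "s \<in> {s. s permutes N \<and> (\<forall>y\<in>D. s y = h y)}" using s hl hi unfolding D_def by auto
    next
      fix s assume s: "s \<in> {s. s permutes N \<and> (\<forall>y\<in>D. s y = h y)}"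
      have "compose M s i = f"
        by (rule injs_eqI[where J = M]) (use s hi fi(3) in \<open>auto simp: compose_def D_def\<close>)
      then show "s \<in> {s \<in> ?S. compose M s i = f}" using s hl unfolding D_def by auto
    qed
    then have "card {s \<in> ?S. compose M s i = f} = fact (card N - card D)"
      using card_permutes_prescribed[OF fin(1) DN injh hD] by simp
    then show ?thesis unfolding cardD by (simp add: diff_diff_left)
  qed
  have "(\<Sum>s\<in>?S. X (compose M s i)) = (\<Sum>f\<in>?T. \<Sum>s | s \<in> ?S \<and> compose M s i = f. X (compose M s i))"
    by (rule sum.group[OF finS finT maps, symmetric])
  also have "\<dots> = (\<Sum>f\<in>?T. fact (card N - card I - card (M - K)) * X f)"
  proof (rule sum.cong[OF refl])
    fix f assume f: "f \<in> ?T"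
    have "(\<Sum>s | s \<in> ?S \<and> compose M s i = f. X (compose M s i)) = (\<Sum>s | s \<in> ?S \<and> compose M s i = f. X f)"
      by (rule sum.cong) auto
    also have "\<dots> = of_nat (card {s \<in> ?S. compose M s i = f}) * X f" by simp
    also have "\<dots> = fact (card N - card I - card (M - K)) * X f" unfolding fibre[OF f] by simp
    finally show "(\<Sum>s | s \<in> ?S \<and> compose M s i = f. X (compose M s i)) = \<dots>" .
  qed
  also have "\<dots> = fact (card N - card I - card (M - K)) * sum X ?T" by (simp add: sum_distrib_left)
  also have "sum X ?T = (\<Sum>f\<in>injs (M - K) (N - k ` I). X (override_on f g K))"
    by (rule sum_injs_override) (use KM gK ki(2) in auto)
  finally show ?thesis .
qed

lemma sum_permutes_coset_harmonic:
  fixes X :: "('i \<Rightarrow> 'a) \<Rightarrow> real"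
  assumes fin: "finite N" "finite M" "finite I"
    and l: "l \<in> injs I N" and k: "k \<in> injs I N" and i: "i \<in> injs M N" and X: "harmonic M N X"
  defines "K \<equiv> {x\<in>M. i x \<in> l ` I}" and "g \<equiv> \<lambda>x. k (inv_into I l (i x))"
  shows "(\<Sum>s | s permutes N \<and> (\<forall>x\<in>I. s (l x) = k x). X (compose M s i))
       = fact (card N - card I - card (M - K)) * ((- 1) ^ card (M - K) *
           (\<Sum>f\<in>injs (M - K) (k ` I - g ` K). X (override_on f g K)))"
    and "inj_on g K" "g ` K \<subseteq> k ` I"
proof -
  note ki = injsD[OF k]
  have KM: "K \<subseteq> M" unfolding K_def by auto
  show gK: "inj_on g K" and gK2: "g ` K \<subseteq> k ` I"
    unfolding g_def K_def by (rule pull_through_coset[OF l k i])+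
  have e: "N - g ` K - (k ` I - g ` K) = N - k ` I" using gK2 by blast
  have "harmonic (M - K) (N - g ` K) (\<lambda>f. X (override_on f g K))"
    by (rule harmonic_override[OF X KM gK]) (use gK2 ki(2) in blast)
  from harmonic_swap[OF _ _ this, of "k ` I - g ` K"]
  have "(\<Sum>f\<in>injs (M - K) (N - k ` I). X (override_on f g K))
      = (- 1) ^ card (M - K) * (\<Sum>f\<in>injs (M - K) (k ` I - g ` K). X (override_on f g K))"
    unfolding e using fin ki(2) by (simp add: Diff_mono)
  then show "(\<Sum>s | s permutes N \<and> (\<forall>x\<in>I. s (l x) = k x). X (compose M s i))
       = fact (card N - card I - card (M - K)) * ((- 1) ^ card (M - K) *
           (\<Sum>f\<in>injs (M - K) (k ` I - g ` K). X (override_on f g K)))"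
    using sum_permutes_coset[OF fin l k i, of X] unfolding K_def g_def by simp
qed

text \<open>After the swap the free coordinates would have to fit injectively into the unused values of
\<open>k\<close>, of which there are too few. This is the source of all orthogonality to lower degrees.\<close>

lemma sum_permutes_coset_small:
  fixes X :: "('i \<Rightarrow> 'a) \<Rightarrow> real"
  assumes fin: "finite N" "finite M" "finite I" and lt: "card I < card M"
    and l: "l \<in> injs I N" and k: "k \<in> injs I N" and i: "i \<in> injs M N" and X: "harmonic M N X"
  shows "(\<Sum>s | s permutes N \<and> (\<forall>x\<in>I. s (l x) = k x). X (compose M s i)) = 0"
proof -
  define K where "K = {x\<in>M. i x \<in> l ` I}"
  define g where "g = (\<lambda>x. k (inv_into I l (i x)))"
  note * = sum_permutes_coset_harmonic[OF fin l k i X, folded K_def g_def]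
  have finK: "finite K" "K \<subseteq> M" using fin unfolding K_def by auto
  have "card (k ` I - g ` K) = card I - card K"
    using *(2,3) injsD(1)[OF k] fin finK by (simp add: card_Diff_subset card_image)
  moreover have "card (M - K) = card M - card K" using finK by (simp add: card_Diff_subset)
  moreover have "card K \<le> card I"
    using card_mono[OF finite_imageI[OF fin(3)] *(3)] card_image[OF *(2)] card_image[OF injsD(1)[OF k]]
    by simp
  ultimately have "card (k ` I - g ` K) < card (M - K)" using lt by linarith
  then have "f \<notin> injs (M - K) (k ` I - g ` K)" for f
    using fin card_inj_on_le[of f "M - K" "k ` I - g ` K"] injsD(1,2)[of f "M - K" "k ` I - g ` K"]
    by (meson finite_Diff finite_imageI leD)
  then have "injs (M - K) (k ` I - g ` K) = {}" by blast
  then show ?thesis using *(1) by simp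
qed

lemma sum_permutes_coset_equal:
  fixes X :: "('i \<Rightarrow> 'a) \<Rightarrow> real"
  assumes fin: "finite N" "finite M"
    and l: "l \<in> injs M N" and k: "k \<in> injs M N" and i: "i \<in> injs M N" and X: "harmonic M N X"
  defines "j \<equiv> card {x\<in>M. i x \<notin> l ` M}"
  shows "(\<Sum>s | s permutes N \<and> (\<forall>x\<in>M. s (l x) = k x). X (compose M s i))
       = fact (card N - card M - j) * ((- 1) ^ j *
           (\<Sum>p | p permutes M \<and> (\<forall>x\<in>M. i x = l (p x) \<or> i x \<notin> l ` M). X (compose M k p)))"
proof -
  define K where "K = {x\<in>M. i x \<in> l ` M}"
  define g where "g = (\<lambda>x. k (inv_into M l (i x)))"
  note * = sum_permutes_coset_harmonic[OF fin fin(2) l k i X, folded K_def g_def]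
  have KM: "K \<subseteq> M" unfolding K_def by auto
  have MK: "M - K = {x\<in>M. i x \<notin> l ` M}" unfolding K_def by auto
  have cond: "(\<forall>x\<in>K. compose M k p x = g x) \<longleftrightarrow> (\<forall>x\<in>M. i x = l (p x) \<or> i x \<notin> l ` M)"
    if p: "p permutes M" for p
  proof -
    have "compose M k p x = g x \<longleftrightarrow> i x = l (p x)" if x: "x \<in> K" for x
    proof -
      have xM: "x \<in> M" "p x \<in> M" using x KM permutes_in_image[OF p] by auto
      have z: "l (inv_into M l (i x)) = i x" "inv_into M l (i x) \<in> M"
        using x unfolding K_def by (auto intro: f_inv_into_f inv_into_into)
      have "compose M k p x = g x \<longleftrightarrow> p x = inv_into M l (i x)"
        using xM z inj_on_eq_iff[OF injsD(1)[OF k]] by (simp add: compose_def g_def)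
      also have "\<dots> \<longleftrightarrow> l (p x) = i x"
        using xM z inj_on_eq_iff[OF injsD(1)[OF l], of "p x" "inv_into M l (i x)"] by simp
      finally show ?thesis by auto
    qed
    then show ?thesis unfolding K_def by auto
  qed
  have "(\<Sum>f\<in>injs (M - K) (k ` M - g ` K). X (override_on f g K))
      = (\<Sum>f | f \<in> injs M (k ` M) \<and> (\<forall>x\<in>K. f x = g x). X f)"
    by (rule sum_injs_agree_on[OF KM *(2,3), symmetric])
  also have "\<dots> = (\<Sum>p | p permutes M \<and> (\<forall>x\<in>K. compose M k p x = g x). X (compose M k p))"
    by (rule sum_injs_permutes[OF fin(2) k refl])
  also have "\<dots> = (\<Sum>p | p permutes M \<and> (\<forall>x\<in>M. i x = l (p x) \<or> i x \<notin> l ` M). X (compose M k p))"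
    by (rule sum.cong) (use cond in auto)
  finally have e: "(\<Sum>f\<in>injs (M - K) (k ` M - g ` K). X (override_on f g K)) = \<dots>" .
  have "card (M - K) = j" unfolding MK j_def ..
  then show ?thesis using *(1) unfolding e by (simp only:)
qed

section \<open>Functions of bounded degree and their orthogonal complement\<close>

text \<open>Cosets of pointwise stabilisers are described by two injections from a common index set, which
treats domain and range symmetrically.\<close>

definition coset_sum :: "'a set \<Rightarrow> (('a \<Rightarrow> 'a) \<Rightarrow> real) \<Rightarrow> 'i set \<Rightarrow> ('i \<Rightarrow> 'a) \<Rightarrow> ('i \<Rightarrow> 'a) \<Rightarrow> real" where
  "coset_sum N f I l k = (\<Sum>s | s permutes N \<and> (\<forall>x\<in>I. s (l x) = k x). f s)"

lemma coset_sum_sum_domain: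
  assumes N: "finite N" and x: "x \<in> I" and k: "k \<in> injs I N" and l: "l \<in> injs (I - {x}) N"
  shows "(\<Sum>v\<in>N - l ` (I - {x}). coset_sum N f I (l(x := v)) k) = coset_sum N f (I - {x}) l k"
proof -
  let ?S = "{s. s permutes N \<and> (\<forall>y\<in>I - {x}. s (l y) = k y)}"
  have fin: "finite ?S" using finite_permutations[OF N] by (rule rev_finite_subset) auto
  have maps: "(\<lambda>s. inv s (k x)) ` ?S \<subseteq> N - l ` (I - {x})"
  proof clarify
    fix s assume s: "s permutes N" "\<forall>y\<in>I - {x}. s (l y) = k y"
    have "inv s (k x) \<in> N"
      using permutes_in_image[OF permutes_inv[OF s(1)]] injsD(2)[OF k] x by auto
    moreover have "inv s (k x) \<noteq> l y" if "y \<in> I - {x}" for y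
    proof
      assume "inv s (k x) = l y"
      then have "k x = k y" using permutes_inv_eq[OF s(1)] s(2) that by simp
      then show False using inj_onD[OF injsD(1)[OF k], of x y] x that by auto
    qed
    ultimately show "inv s (k x) \<in> N - l ` (I - {x})" by auto
  qed
  have fib: "{s \<in> ?S. inv s (k x) = v} = {s. s permutes N \<and> (\<forall>y\<in>I. s ((l(x := v)) y) = k y)}" for v
    using x by (auto simp: permutes_inv_eq permutes_inverses)
  have "(\<Sum>v\<in>N - l ` (I - {x}). coset_sum N f I (l(x := v)) k)
      = (\<Sum>v\<in>N - l ` (I - {x}). \<Sum>s | s \<in> ?S \<and> inv s (k x) = v. f s)"
    unfolding coset_sum_def fib[symmetric] by simp
  also have "\<dots> = sum f ?S" by (rule sum.group[OF fin _ maps]) (use N in auto)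
  finally show ?thesis by (simp add: coset_sum_def)
qed

lemma coset_sum_sum_range:
  assumes N: "finite N" and x: "x \<in> I" and l: "l \<in> injs I N" and k: "k \<in> injs (I - {x}) N"
  shows "(\<Sum>v\<in>N - k ` (I - {x}). coset_sum N f I l (k(x := v))) = coset_sum N f (I - {x}) l k"
proof -
  let ?S = "{s. s permutes N \<and> (\<forall>y\<in>I - {x}. s (l y) = k y)}"
  have fin: "finite ?S" using finite_permutations[OF N] by (rule rev_finite_subset) auto
  have maps: "(\<lambda>s. s (l x)) ` ?S \<subseteq> N - k ` (I - {x})"
  proof clarify
    fix s assume s: "s permutes N" "\<forall>y\<in>I - {x}. s (l y) = k y"
    have "s (l x) \<in> N"
      using permutes_in_image[OF s(1)] injsD(2)[OF l] x by auto
    moreover have "s (l x) \<noteq> k y" if "y \<in> I - {x}" for y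
    proof
      assume "s (l x) = k y"
      then have "l x = l y" using s(2) that permutes_inj[OF s(1)] by (metis injD)
      then show False using inj_onD[OF injsD(1)[OF l], of x y] x that by auto
    qed
    ultimately show "s (l x) \<in> N - k ` (I - {x})" by auto
  qed
  have fib: "{s \<in> ?S. s (l x) = v} = {s. s permutes N \<and> (\<forall>y\<in>I. s (l y) = (k(x := v)) y)}" for v
    using x by auto
  have "(\<Sum>v\<in>N - k ` (I - {x}). coset_sum N f I l (k(x := v)))
      = (\<Sum>v\<in>N - k ` (I - {x}). \<Sum>s | s \<in> ?S \<and> s (l x) = v. f s)"
    unfolding coset_sum_def fib[symmetric] by simp
  also have "\<dots> = sum f ?S" by (rule sum.group[OF fin _ maps]) (use N in auto)
  finally show ?thesis by (simp add: coset_sum_def)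
qed

definition orth_degree :: "'a set \<Rightarrow> nat \<Rightarrow> (('a \<Rightarrow> 'a) \<Rightarrow> real) \<Rightarrow> bool" where
  "orth_degree N m f \<longleftrightarrow> (\<forall>(I::nat set) l k. finite I \<longrightarrow> card I = m \<longrightarrow> l \<in> injs I N \<longrightarrow> k \<in> injs I N \<longrightarrow> coset_sum N f I l k = 0)"

text \<open>The coefficient may depend on the \<open>m\<close> chosen points and on their images, so these functions are
the span of the indicators of all cosets that prescribe \<open>m\<close> values.\<close>

definition degree_le :: "'a set \<Rightarrow> nat \<Rightarrow> (('a \<Rightarrow> 'a) \<Rightarrow> real) \<Rightarrow> bool" where
  "degree_le N m f \<longleftrightarrow> (\<exists>c. \<forall>s. s permutes N \<longrightarrow> f s = (\<Sum>l\<in>injs {..<m} N. c l (compose {..<m} s l)))"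

lemma degree_leI:
  assumes "\<And>s. s permutes N \<Longrightarrow> f s = (\<Sum>l\<in>injs {..<m} N. c l (compose {..<m} s l))"
  shows "degree_le N m f"
  using assms unfolding degree_le_def by blast

lemma degree_le_diff:
  assumes "degree_le N m f" "degree_le N m g"
  shows "degree_le N m (\<lambda>s. f s - g s)"
proof -
  obtain c where c: "\<And>s. s permutes N \<Longrightarrow> f s = (\<Sum>l\<in>injs {..<m} N. c l (compose {..<m} s l))"
    using assms(1) unfolding degree_le_def by blast
  obtain d where d: "\<And>s. s permutes N \<Longrightarrow> g s = (\<Sum>l\<in>injs {..<m} N. d l (compose {..<m} s l))"
    using assms(2) unfolding degree_le_def by blast
  show ?thesis
    by (rule degree_leI[where c = "\<lambda>l k. c l k - d l k"]) (simp add: c d sum_subtractf)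
qed

lemma degree_le_add:
  assumes "degree_le N m f" "degree_le N m g"
  shows "degree_le N m (\<lambda>s. f s + g s)"
proof -
  obtain c where c: "\<And>s. s permutes N \<Longrightarrow> f s = (\<Sum>l\<in>injs {..<m} N. c l (compose {..<m} s l))"
    using assms(1) unfolding degree_le_def by blast
  obtain d where d: "\<And>s. s permutes N \<Longrightarrow> g s = (\<Sum>l\<in>injs {..<m} N. d l (compose {..<m} s l))"
    using assms(2) unfolding degree_le_def by blast
  show ?thesis
    by (rule degree_leI[where c = "\<lambda>l k. c l k + d l k"]) (simp add: c d sum.distrib)
qed

text \<open>Each choice of \<open>m\<close> points extends to \<open>m + 1\<close> points in equally many ways, so the coefficients can
be averaged over the extensions.\<close>

lemma degree_le_Suc:
  assumes N: "finite N" and m: "m < card N" and f: "degree_le N m f"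
  shows "degree_le N (Suc m) f"
proof -
  obtain c where c: "\<And>s. s permutes N \<Longrightarrow> f s = (\<Sum>l\<in>injs {..<m} N. c l (compose {..<m} s l))"
    using f unfolding degree_le_def by blast
  let ?c = "\<lambda>l k. c (restrict l {..<m}) (restrict k {..<m}) / real (card N - m)"
  show ?thesis
  proof (rule degree_leI[where c = ?c])
    fix s assume s: "s permutes N"
    have "(\<Sum>l\<in>injs {..<Suc m} N. ?c l (compose {..<Suc m} s l))
        = (\<Sum>l\<in>injs (insert m {..<m}) N. ?c l (compose {..<Suc m} s l))"
      by (simp add: lessThan_Suc)
    also have "\<dots> = (\<Sum>l\<in>injs {..<m} N. \<Sum>v\<in>N - l ` {..<m}. ?c (l(m := v)) (compose {..<Suc m} s (l(m := v))))"
      by (rule sum_injs_insert') (use N in auto)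
    also have "\<dots> = (\<Sum>l\<in>injs {..<m} N. c l (compose {..<m} s l))"
    proof (rule sum.cong[OF refl])
      fix l assume l: "l \<in> injs {..<m} N"
      have r: "restrict (l(m := v)) {..<m} = l" for v
        by (rule injs_eqI[where J = "{..<m}"]) (use injsD(3)[OF l] in auto)
      have r': "restrict (compose {..<Suc m} s (l(m := v))) {..<m} = compose {..<m} s l" for v
        by (rule injs_eqI[where J = "{..<m}"]) (auto simp: compose_def)
      have "card (N - l ` {..<m}) = card N - m"
        using injsD(1,2)[OF l] N by (simp add: card_Diff_subset card_image)
      then show "(\<Sum>v\<in>N - l ` {..<m}. ?c (l(m := v)) (compose {..<Suc m} s (l(m := v)))) = c l (compose {..<m} s l)"
        unfolding r r' using m by simp
    qed
    finally show "f s = (\<Sum>l\<in>injs {..<Suc m} N. ?c l (compose {..<Suc m} s l))"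
      using c[OF s] by simp
  qed
qed

text \<open>A coset that prescribes \<open>m\<close> values is a disjoint union of cosets that prescribe one more.\<close>

lemma orth_degree_pred:
  assumes N: "finite N" and m: "m < card N" and f: "orth_degree N (Suc m) f"
  shows "orth_degree N m f"
  unfolding orth_degree_def
proof (intro allI impI)
  fix I :: "nat set" and l k
  assume I: "finite I" "card I = m" and l: "l \<in> injs I N" and k: "k \<in> injs I N"
  obtain x where x: "x \<notin> I" using I(1) ex_new_if_finite[OF infinite_UNIV_nat] by blast
  have "card (k ` I) < card N" using I m by (simp add: card_image injsD(1)[OF k])
  then obtain w where w: "w \<in> N" "w \<notin> k ` I"
    by (metis I(1) card_mono finite_imageI leD subsetI)
  have k': "k(x := w) \<in> injs (insert x I) N"
    unfolding injs_insert[OF x] using w injsD[OF k] k by (auto simp: injs_def image_iff intro!: bexI[of _ w])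
  have e: "insert x I - {x} = I" using x by blast
  have "coset_sum N f I l k = coset_sum N f I l (k(x := w))"
    unfolding coset_sum_def by (rule sum.cong) (use x in auto)
  also have "\<dots> = (\<Sum>v\<in>N - l ` I. coset_sum N f (insert x I) (l(x := v)) (k(x := w)))"
    using coset_sum_sum_domain[OF N _ k', of x l f] l unfolding e by simp
  also have "\<dots> = 0"
  proof (rule sum.neutral, rule ballI)
    fix v assume "v \<in> N - l ` I"
    then have "l(x := v) \<in> injs (insert x I) N"
      unfolding injs_insert[OF x] using l by (auto simp: injs_def image_iff intro!: bexI[of _ v])
    then show "coset_sum N f (insert x I) (l(x := v)) (k(x := w)) = 0"
      using f k' I x unfolding orth_degree_def by simp
  qed
  finally show "coset_sum N f I l k = 0" .
qed

lemma orth_degree_mono: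
  assumes N: "finite N" and f: "orth_degree N m' f" and m: "m \<le> m'" "m' \<le> card N"
  shows "orth_degree N m f"
  using m(1)
proof (induction m rule: inc_induct)
  case base
  show ?case by (rule f)
next
  case (step k)
  then have "k < card N" using m(2) by simp
  then show ?case using orth_degree_pred[OF N] step by blast
qed

lemma inner_degree_le_coset_sum:
  assumes N: "finite N" and f: "degree_le N m f"
    and g: "\<And>l k. l \<in> injs {..<m} N \<Longrightarrow> k \<in> injs {..<m} N \<Longrightarrow> coset_sum N g {..<m} l k = 0"
  shows "(\<Sum>s | s permutes N. f s * g s) = 0"
proof -
  obtain c where c: "\<And>s. s permutes N \<Longrightarrow> f s = (\<Sum>l\<in>injs {..<m} N. c l (compose {..<m} s l))"
    using f unfolding degree_le_def by blast
  let ?P = "{s. s permutes N}"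
  have finP: "finite ?P" by (rule finite_permutations[OF N])
  have "(\<Sum>s\<in>?P. f s * g s) = (\<Sum>s\<in>?P. \<Sum>l\<in>injs {..<m} N. c l (compose {..<m} s l) * g s)"
    by (rule sum.cong) (auto simp: c sum_distrib_right)
  also have "\<dots> = (\<Sum>l\<in>injs {..<m} N. \<Sum>s\<in>?P. c l (compose {..<m} s l) * g s)"
    by (rule sum.swap)
  also have "\<dots> = 0"
  proof (rule sum.neutral, rule ballI)
    fix l assume l: "l \<in> injs {..<m} N"
    have "compose {..<m} s l \<in> injs {..<m} N" if "s permutes N" for s
      by (rule compose_perm_injs[OF l that])
    then have "(\<Sum>s\<in>?P. c l (compose {..<m} s l) * g s)
        = (\<Sum>k\<in>injs {..<m} N. \<Sum>s | s \<in> ?P \<and> compose {..<m} s l = k. c l (compose {..<m} s l) * g s)"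
      by (intro sum.group[symmetric] finP) (use N in auto)
    also have "\<dots> = (\<Sum>k\<in>injs {..<m} N. c l k * coset_sum N g {..<m} l k)"
    proof (rule sum.cong[OF refl])
      fix k assume k: "k \<in> injs {..<m} N"
      have "{s. s \<in> ?P \<and> compose {..<m} s l = k} = {s. s permutes N \<and> (\<forall>x\<in>{..<m}. s (l x) = k x)}"
        using injs_eqI[OF _ injsD(3)[OF k]] by (force simp: compose_def)
      then show "(\<Sum>s | s \<in> ?P \<and> compose {..<m} s l = k. c l (compose {..<m} s l) * g s) = c l k * coset_sum N g {..<m} l k"
        unfolding coset_sum_def sum_distrib_left by (intro sum.cong) auto
    qed
    also have "\<dots> = 0" using g[OF l] by simp
    finally show "(\<Sum>s\<in>?P. c l (compose {..<m} s l) * g s) = 0" .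
  qed
  finally show ?thesis .
qed

text \<open>Letting one point run freely turns a sum over a coset prescribing \<open>m\<close> values into
a sum over a coset prescribing \<open>m - 1\<close> values, and these vanish. For \<open>m = 0\<close> there is no coordinate
to run.\<close>

lemma harmonic_coset_sum:
  assumes N: "finite N" and f: "m = 0 \<or> orth_degree N (m - 1) f"
  shows "k \<in> injs {..<m} N \<Longrightarrow> harmonic {..<m} N (\<lambda>l. coset_sum N f {..<m} l k)"
    and "l \<in> injs {..<m} N \<Longrightarrow> harmonic {..<m} N (\<lambda>k. coset_sum N f {..<m} l k)"
proof -
  have zero: "coset_sum N f ({..<m} - {x}) l k = 0"
    if "x < m" "l \<in> injs ({..<m} - {x}) N" "k \<in> injs ({..<m} - {x}) N" for l k x
    using f that unfolding orth_degree_def by auto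
  have res: "coset_sum N f ({..<m} - {x}) l (restrict k ({..<m} - {x})) = coset_sum N f ({..<m} - {x}) l k"
    "coset_sum N f ({..<m} - {x}) (restrict l ({..<m} - {x})) k = coset_sum N f ({..<m} - {x}) l k" for l k x
    unfolding coset_sum_def by (auto intro!: sum.cong)
  have resin: "restrict k ({..<m} - {x}) \<in> injs ({..<m} - {x}) N" if "k \<in> injs {..<m} N" for k x
    using that by (auto simp: injs_def inj_on_def PiE_def Pi_def)
  show "harmonic {..<m} N (\<lambda>l. coset_sum N f {..<m} l k)" if k: "k \<in> injs {..<m} N"
    unfolding harmonic_def
  proof (intro ballI)
    fix x l assume x: "x \<in> {..<m}" and l: "l \<in> injs ({..<m} - {x}) N"
    show "(\<Sum>v\<in>N - l ` ({..<m} - {x}). coset_sum N f {..<m} (l(x := v)) k) = 0"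
      unfolding coset_sum_sum_domain[OF N x k l]
      using zero[OF _ l resin[OF k]] x unfolding res by simp
  qed
  show "harmonic {..<m} N (\<lambda>k. coset_sum N f {..<m} l k)" if l: "l \<in> injs {..<m} N"
    unfolding harmonic_def
  proof (intro ballI)
    fix x k assume x: "x \<in> {..<m}" and k: "k \<in> injs ({..<m} - {x}) N"
    show "(\<Sum>v\<in>N - k ` ({..<m} - {x}). coset_sum N f {..<m} l (k(x := v))) = 0"
      unfolding coset_sum_sum_range[OF N x l k]
      using zero[OF _ resin[OF l] k] x unfolding res by simp
  qed
qed

section \<open>A kernel operator on the functions of a given degree\<close>

text \<open>Up to the sign this is the reciprocal of the number of injections of \<open>j\<close> indices into the points
that a given injection of \<open>m\<close> indices leaves unused.\<close>

definition swap_wt :: "'a set \<Rightarrow> nat \<Rightarrow> nat \<Rightarrow> real" where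
  "swap_wt N m j = (- 1) ^ j * (fact (card N - m - j) / fact (card N - m))"

text \<open>The values of \<open>a\<close> prescribe this function of \<open>l'\<close> on the rearrangements of \<open>l\<close>; the weight
extends it to a harmonic function on all injections (\<open>harmonic_harm_kernel\<close>).\<close>

definition harm_kernel :: "'a set \<Rightarrow> nat \<Rightarrow> ((nat \<Rightarrow> nat) \<Rightarrow> real) \<Rightarrow> (nat \<Rightarrow> 'a) \<Rightarrow> (nat \<Rightarrow> 'a) \<Rightarrow> real" where
  "harm_kernel N m a l l' =
     (\<Sum>p | p permutes {..<m} \<and> (\<forall>x\<in>{..<m}. l' x = l (p x) \<or> l' x \<notin> l ` {..<m}).
        a p * swap_wt N m (card {x\<in>{..<m}. l' x \<notin> l ` {..<m}}))"

text \<open>A kernel that depends only on \<open>inv t \<circ> s\<close>, so that the operator commutes with left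
translations.\<close>

definition stratum_kernel :: "'a set \<Rightarrow> nat \<Rightarrow> ((nat \<Rightarrow> nat) \<Rightarrow> real) \<Rightarrow> ('a \<Rightarrow> 'a) \<Rightarrow> ('a \<Rightarrow> 'a) \<Rightarrow> real" where
  "stratum_kernel N m a t s = (\<Sum>l\<in>injs {..<m} N. harm_kernel N m a l (compose {..<m} (inv t \<circ> s) l))"

definition stratum_op :: "'a set \<Rightarrow> nat \<Rightarrow> ((nat \<Rightarrow> nat) \<Rightarrow> real) \<Rightarrow> (('a \<Rightarrow> 'a) \<Rightarrow> real) \<Rightarrow> ('a \<Rightarrow> 'a) \<Rightarrow> real" where
  "stratum_op N m a f s = (\<Sum>t | t permutes N. stratum_kernel N m a t s * f t)"

lemma swap_wt_Suc:
  assumes "j < card N - m"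
  shows "swap_wt N m j + real (card N - m - j) * swap_wt N m (Suc j) = 0"
proof -
  obtain q where q: "card N - m - j = Suc q" using assms by (metis Suc_pred' zero_less_diff)
  then have q': "card N - m - Suc j = q" by simp
  show ?thesis unfolding swap_wt_def q q' by (simp add: field_simps)
qed

text \<open>For each \<open>p\<close> at most one value of the running coordinate lies in the image of \<open>l\<close>
and is compatible with \<open>p\<close>, and all values outside that image are compatible. Their contributions
cancel by \<open>swap_wt_Suc\<close>.\<close>

lemma harmonic_harm_kernel:
  assumes N: "finite N" and m: "2 * m \<le> card N" and l: "l \<in> injs {..<m} N"
  shows "harmonic {..<m} N (harm_kernel N m a l)"
  unfolding harmonic_def
proof (intro ballI)
  let ?M = "{..<m}"
  fix x f assume x: "x \<in> ?M" and f: "f \<in> injs (?M - {x}) N"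
  let ?f = "\<lambda>v. f(x := v)" and ?F = "f ` (?M - {x})"
  define j where "j = card {y\<in>?M - {x}. f y \<notin> l ` ?M}"
  have "card {y\<in>?M - {x}. f y \<notin> l ` ?M} \<le> card (?M - {x})" by (rule card_mono) auto
  then have jm: "j < m" unfolding j_def using x by auto
  have cnt: "card {y\<in>?M. ?f v y \<notin> l ` ?M} = (if v \<in> l ` ?M then j else Suc j)" for v
  proof (cases "v \<in> l ` ?M")
    case True
    then have "{y\<in>?M. ?f v y \<notin> l ` ?M} = {y\<in>?M - {x}. f y \<notin> l ` ?M}" by auto
    then show ?thesis using True by (simp add: j_def)
  next
    case False
    then have "{y\<in>?M. ?f v y \<notin> l ` ?M} = insert x {y\<in>?M - {x}. f y \<notin> l ` ?M}" using x by auto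
    then show ?thesis using False by (simp add: j_def)
  qed
  let ?c = "\<lambda>p g. \<forall>y\<in>?M. g y = l (p y) \<or> g y \<notin> l ` ?M"
  have one: "(\<Sum>v\<in>N - ?F. if ?c p (?f v) then swap_wt N m (card {y\<in>?M. ?f v y \<notin> l ` ?M}) else 0) = 0"
    if p: "p permutes ?M" for p
  proof (cases "\<forall>y\<in>?M - {x}. f y = l (p y) \<or> f y \<notin> l ` ?M")
    case False
    then obtain y where y: "y \<in> ?M - {x}" "f y \<noteq> l (p y)" "f y \<in> l ` ?M" by auto
    have "\<not> ?c p (?f v)" for v
    proof
      assume "?c p (?f v)"
      from this[rule_format, of y] show False using y by auto
    qed
    then show ?thesis by (simp only: if_False sum.neutral_const)
  next
    case True
    then have c: "?c p (?f v) \<longleftrightarrow> v = l (p x) \<or> v \<notin> l ` ?M" for v using x by auto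
    have px: "p x \<in> ?M" using permutes_in_image[OF p] x by simp
    \<comment> \<open>The compatible value inside the image of \<open>l\<close> is still free, since \<open>p\<close> is injective.\<close>
    have lpx: "l (p x) \<in> N - ?F"
    proof -
      have "l (p x) \<noteq> f y" if y: "y \<in> ?M - {x}" for y
      proof
        assume e: "l (p x) = f y"
        then have "f y = l (p y)" using True y px by (metis imageI)
        then have "p x = p y" using e inj_onD[OF injsD(1)[OF l], of "p x" "p y"] px y permutes_in_image[OF p, of y] by simp
        then show False using permutes_inj[OF p] y by (auto dest: injD)
      qed
      then show ?thesis using injsD(2)[OF l] px by auto
    qed
    have "(\<Sum>v\<in>N - ?F. if ?c p (?f v) then swap_wt N m (card {y\<in>?M. ?f v y \<notin> l ` ?M}) else 0)
        = (\<Sum>v\<in>insert (l (p x)) (N - ?F - l ` ?M). if v \<in> l ` ?M then swap_wt N m j else swap_wt N m (Suc j))"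
      unfolding c cnt by (rule sum.mono_neutral_cong_right) (use N lpx px in auto)
    also have "\<dots> = swap_wt N m j + (\<Sum>v\<in>N - ?F - l ` ?M. swap_wt N m (Suc j))"
      using N px by (subst sum.insert) (auto intro!: sum.cong)
    also have "(\<Sum>v\<in>N - ?F - l ` ?M. swap_wt N m (Suc j)) = real (card N - m - j) * swap_wt N m (Suc j)"
    proof -
      have e: "N - ?F - l ` ?M = N - l ` ?M - f ` {y\<in>?M - {x}. f y \<notin> l ` ?M}" by auto
      have "card (f ` {y\<in>?M - {x}. f y \<notin> l ` ?M}) = j"
        unfolding j_def using injsD(1)[OF f] by (intro card_image) (auto simp: inj_on_def)
      moreover have "card (N - l ` ?M) = card N - m"
        using injsD(1,2)[OF l] N by (simp add: card_Diff_subset card_image)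
      moreover have "f ` {y\<in>?M - {x}. f y \<notin> l ` ?M} \<subseteq> N - l ` ?M" using injsD(2)[OF f] by auto
      ultimately have "card (N - ?F - l ` ?M) = card N - m - j"
        unfolding e using N by (subst card_Diff_subset) auto
      then show ?thesis by simp
    qed
    also have "swap_wt N m j + real (card N - m - j) * swap_wt N m (Suc j) = 0"
      by (rule swap_wt_Suc) (use jm m in linarith)
    finally show ?thesis .
  qed
  have "(\<Sum>v\<in>N - ?F. harm_kernel N m a l (?f v))
      = (\<Sum>v\<in>N - ?F. \<Sum>p | p permutes ?M. a p * (if ?c p (?f v) then swap_wt N m (card {y\<in>?M. ?f v y \<notin> l ` ?M}) else 0))"
    unfolding harm_kernel_def
    by (intro sum.cong refl sum.mono_neutral_cong_left) (auto simp: finite_permutations)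
  also have "\<dots> = (\<Sum>p | p permutes ?M. a p * (\<Sum>v\<in>N - ?F. if ?c p (?f v) then swap_wt N m (card {y\<in>?M. ?f v y \<notin> l ` ?M}) else 0))"
    by (subst sum.swap) (simp add: sum_distrib_left)
  also have "\<dots> = 0" using one by simp
  finally show "(\<Sum>v\<in>N - ?F. harm_kernel N m a l (?f v)) = 0" .
qed

lemma harmonic_perm:
  assumes N: "finite N" and h: "harmonic I N X" and t: "t permutes N"
  shows "harmonic I N (\<lambda>l. X (compose I t l))"
  unfolding harmonic_def
proof (intro ballI)
  fix x f assume x: "x \<in> I" and f: "f \<in> injs (I - {x}) N"
  let ?g = "compose (I - {x}) t f"
  have g: "?g \<in> injs (I - {x}) N" by (rule compose_perm_injs[OF f t])
  have e: "compose I t (f(x := v)) = ?g(x := t v)" for v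
    using x by (auto simp: compose_def fun_eq_iff)
  have im: "?g ` (I - {x}) = t ` f ` (I - {x})" by (auto simp: compose_def)
  have "(\<Sum>v\<in>N - f ` (I - {x}). X (compose I t (f(x := v)))) = (\<Sum>w\<in>t ` (N - f ` (I - {x})). X (?g(x := w)))"
    unfolding e using permutes_inj_on[OF t] by (subst sum.reindex) auto
  also have "t ` (N - f ` (I - {x})) = N - ?g ` (I - {x})"
    unfolding im using permutes_image[OF t] permutes_inj[OF t] by (simp add: image_set_diff)
  also have "(\<Sum>w\<in>N - ?g ` (I - {x}). X (?g(x := w))) = 0"
    using h x g unfolding harmonic_def by blast
  finally show "(\<Sum>v\<in>N - f ` (I - {x}). X (compose I t (f(x := v)))) = 0" .
qed

lemma stratum_op_alt:
  assumes N: "finite N" and s: "s permutes N"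
  shows "stratum_op N m a f s = (\<Sum>l\<in>injs {..<m} N. \<Sum>l'\<in>injs {..<m} N.
           harm_kernel N m a l l' * coset_sum N f {..<m} l' (compose {..<m} s l))"
proof -
  let ?P = "{t. t permutes N}" and ?I = "injs {..<m} N" and ?M = "{..<m}"
  have "stratum_op N m a f s = (\<Sum>t\<in>?P. \<Sum>l\<in>?I. harm_kernel N m a l (compose ?M (inv t \<circ> s) l) * f t)"
    unfolding stratum_op_def stratum_kernel_def by (simp add: sum_distrib_right)
  also have "\<dots> = (\<Sum>l\<in>?I. \<Sum>t\<in>?P. harm_kernel N m a l (compose ?M (inv t \<circ> s) l) * f t)"
    by (rule sum.swap)
  also have "\<dots> = (\<Sum>l\<in>?I. \<Sum>l'\<in>?I. harm_kernel N m a l l' * coset_sum N f ?M l' (compose ?M s l))"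
  proof (rule sum.cong[OF refl])
    fix l assume l: "l \<in> ?I"
    have "compose ?M (inv t \<circ> s) l \<in> ?I" if "t permutes N" for t
      by (rule compose_perm_injs[OF l permutes_compose[OF s permutes_inv[OF that]]])
    then have "(\<Sum>t\<in>?P. harm_kernel N m a l (compose ?M (inv t \<circ> s) l) * f t)
        = (\<Sum>l'\<in>?I. \<Sum>t | t \<in> ?P \<and> compose ?M (inv t \<circ> s) l = l'. harm_kernel N m a l (compose ?M (inv t \<circ> s) l) * f t)"
      by (intro sum.group[symmetric] finite_permutations N) (use N in auto)
    also have "\<dots> = (\<Sum>l'\<in>?I. harm_kernel N m a l l' * coset_sum N f ?M l' (compose ?M s l))"
    proof (rule sum.cong[OF refl])
      fix l' assume l': "l' \<in> ?I"
      have "compose ?M (inv t \<circ> s) l = l' \<longleftrightarrow> (\<forall>x\<in>?M. t (l' x) = compose ?M s l x)" if t: "t permutes N" for t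
      proof -
        have "compose ?M (inv t \<circ> s) l = l' \<longleftrightarrow> (\<forall>x\<in>?M. inv t (s (l x)) = l' x)"
          using injs_eqI[OF _ injsD(3)[OF l'], of "compose ?M (inv t \<circ> s) l"] by (auto simp: compose_def)
        then show ?thesis using permutes_inv_eq[OF t] by (auto simp: compose_def)
      qed
      then have "{t. t \<in> ?P \<and> compose ?M (inv t \<circ> s) l = l'} = {t. t permutes N \<and> (\<forall>x\<in>?M. t (l' x) = compose ?M s l x)}"
        by blast
      then show "(\<Sum>t | t \<in> ?P \<and> compose ?M (inv t \<circ> s) l = l'. harm_kernel N m a l (compose ?M (inv t \<circ> s) l) * f t)
          = harm_kernel N m a l l' * coset_sum N f ?M l' (compose ?M s l)"
        unfolding coset_sum_def sum_distrib_left by (intro sum.cong) auto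
    qed
    finally show "(\<Sum>t\<in>?P. harm_kernel N m a l (compose ?M (inv t \<circ> s) l) * f t)
        = (\<Sum>l'\<in>?I. harm_kernel N m a l l' * coset_sum N f ?M l' (compose ?M s l))" .
  qed
  finally show ?thesis .
qed

lemma degree_le_stratum_op:
  assumes N: "finite N"
  shows "degree_le N m (stratum_op N m a f)"
  by (rule degree_leI[where c = "\<lambda>l k. \<Sum>l'\<in>injs {..<m} N. harm_kernel N m a l l' * coset_sum N f {..<m} l' k"])
     (rule stratum_op_alt[OF N])

text \<open>The kernel is harmonic in the image of the second permutation, so its sums over cosets that
prescribe fewer than \<open>m\<close> values vanish.\<close>

lemma orth_degree_stratum_op:
  assumes N: "finite N" and m: "2 * m \<le> card N" and q: "q < m"
  shows "orth_degree N q (stratum_op N m a f)"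
  unfolding orth_degree_def
proof (intro allI impI)
  fix I :: "nat set" and l k
  assume I: "finite I" "card I = q" and l: "l \<in> injs I N" and k: "k \<in> injs I N"
  let ?S = "{s. s permutes N \<and> (\<forall>x\<in>I. s (l x) = k x)}" and ?M = "{..<m}"
  have "coset_sum N (stratum_op N m a f) I l k = (\<Sum>t | t permutes N. \<Sum>s\<in>?S. \<Sum>i\<in>injs ?M N. harm_kernel N m a i (compose ?M (inv t \<circ> s) i) * f t)"
    unfolding coset_sum_def stratum_op_def stratum_kernel_def by (subst sum.swap) (simp add: sum_distrib_right)
  also have "\<dots> = 0"
  proof (rule sum.neutral, rule ballI)
    fix t assume t: "t \<in> {t. t permutes N}"
    have "(\<Sum>s\<in>?S. \<Sum>i\<in>injs ?M N. harm_kernel N m a i (compose ?M (inv t \<circ> s) i) * f t)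
        = (\<Sum>i\<in>injs ?M N. (\<Sum>s\<in>?S. harm_kernel N m a i (compose ?M (inv t) (compose ?M s i))) * f t)"
    proof -
      have e: "compose ?M (inv t \<circ> s) i = compose ?M (inv t) (compose ?M s i)" for s :: "'a \<Rightarrow> 'a" and i :: "nat \<Rightarrow> 'a"
        by (auto simp: compose_def fun_eq_iff)
      show ?thesis unfolding e by (subst sum.swap) (simp only: sum_distrib_right)
    qed
    also have "\<dots> = 0"
    proof (intro sum.neutral ballI)
      fix i assume i: "i \<in> injs ?M N"
      have t': "inv t permutes N" using t permutes_inv by blast
      have "(\<Sum>s\<in>?S. harm_kernel N m a i (compose ?M (inv t) (compose ?M s i))) = 0"
        by (rule sum_permutes_coset_small[OF N _ I(1) _ l k i harmonic_perm[OF N harmonic_harm_kernel[OF N m i] t']])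
           (use I q in auto)
      then show "(\<Sum>s\<in>?S. harm_kernel N m a i (compose ?M (inv t) (compose ?M s i))) * f t = 0" by simp
    qed
    finally show "(\<Sum>s\<in>?S. \<Sum>i\<in>injs ?M N. harm_kernel N m a i (compose ?M (inv t \<circ> s) i) * f t) = 0" .
  qed
  finally show "coset_sum N (stratum_op N m a f) I l k = 0" .
qed

lemma card_not_in_image_sym:
  fixes m :: nat
  assumes l: "l \<in> injs {..<m} N" and l': "l' \<in> injs {..<m} N"
  shows "card {x\<in>{..<m}. l' x \<notin> l ` {..<m}} = card {x\<in>{..<m}. l x \<notin> l' ` {..<m}}"
proof -
  let ?M = "{..<m}"
  have *: "card {x\<in>?M. u x \<notin> v ` ?M} = m - card (u ` ?M \<inter> v ` ?M)" if u: "inj_on u ?M" for u v :: "nat \<Rightarrow> 'b"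
  proof -
    have "u ` ?M \<inter> v ` ?M = u ` {x\<in>?M. u x \<in> v ` ?M}" by auto
    then have "card (u ` ?M \<inter> v ` ?M) = card {x\<in>?M. u x \<in> v ` ?M}"
      using u by (simp add: card_image inj_on_def)
    moreover have "{x\<in>?M. u x \<notin> v ` ?M} = ?M - {x\<in>?M. u x \<in> v ` ?M}" by auto
    moreover have "card (?M - {x\<in>?M. u x \<in> v ` ?M}) = card ?M - card {x\<in>?M. u x \<in> v ` ?M}"
      by (rule card_Diff_subset) (auto intro: finite_subset[of _ ?M])
    ultimately show ?thesis by simp
  qed
  show ?thesis using *[OF injsD(1)[OF l], of l'] *[OF injsD(1)[OF l'], of l] by (simp add: Int_commute)
qed

text \<open>If \<open>l'\<close> agrees with \<open>l \<circ> p\<close> where it meets the image of \<open>l\<close>, then \<open>l\<close> agrees with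
\<open>l' \<circ> inv p\<close> where it meets the image of \<open>l'\<close>.\<close>

lemma harm_kernel_sym:
  assumes l: "l \<in> injs {..<m} N" and l': "l' \<in> injs {..<m} N"
    and a: "\<And>p. p permutes {..<m} \<Longrightarrow> a (inv p) = a p"
  shows "harm_kernel N m a l l' = harm_kernel N m a l' l"
proof -
  let ?M = "{..<m}"
  have imp: "\<forall>x\<in>?M. u x = v (inv p x) \<or> u x \<notin> v ` ?M"
    if p: "p permutes ?M" and u: "inj_on u ?M" and c: "\<forall>x\<in>?M. v x = u (p x) \<or> v x \<notin> u ` ?M"
    for u v :: "nat \<Rightarrow> 'b" and p
  proof (intro ballI disjCI)
    fix x assume x: "x \<in> ?M" and "\<not> u x \<notin> v ` ?M"
    then obtain y where y: "y \<in> ?M" "u x = v y" by auto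
    then have "v y = u (p y)" using c x by (metis imageI)
    then have "x = p y" using y x u permutes_in_image[OF p, of y] by (auto dest: inj_onD)
    then show "u x = v (inv p x)" using y permutes_inverses(2)[OF p] by simp
  qed
  have "harm_kernel N m a l l' = (\<Sum>p | p permutes ?M \<and> (\<forall>x\<in>?M. l x = l' (p x) \<or> l x \<notin> l' ` ?M).
        a p * swap_wt N m (card {x\<in>?M. l x \<notin> l' ` ?M}))"
    unfolding harm_kernel_def card_not_in_image_sym[OF l l']
  proof (rule sum.reindex_bij_witness[where i = inv and j = inv], goal_cases)
    case (1 p) then show ?case by (auto simp: permutes_inv_inv)
  next
    case (2 p) then show ?case using imp[of p l l'] injsD(1)[OF l] permutes_inv by auto
  next
    case (3 p) then show ?case by (auto simp: permutes_inv_inv)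
  next
    case (4 p) then show ?case using imp[of p l' l] injsD(1)[OF l'] permutes_inv by auto
  next
    case (5 p) then show ?case using a by simp
  qed
  then show ?thesis unfolding harm_kernel_def .
qed

lemma stratum_kernel_sym:
  assumes a: "\<And>p. p permutes {..<m} \<Longrightarrow> a (inv p) = a p" and s: "s permutes N" and t: "t permutes N"
  shows "stratum_kernel N m a t s = stratum_kernel N m a s t"
proof -
  let ?M = "{..<m}" and ?r = "inv t \<circ> s" and ?q = "inv s \<circ> t"
  have r: "?r permutes N" using permutes_compose[OF s permutes_inv[OF t]] .
  have q: "?q permutes N" using permutes_compose[OF t permutes_inv[OF s]] .
  have rq: "?r (?q x) = x" "?q (?r x) = x" for x
    using permutes_inverses[OF s] permutes_inverses[OF t] by simp_all
  have c: "compose ?M ?r (compose ?M ?q l) = l" "compose ?M ?q (compose ?M ?r l) = l" if "l \<in> injs ?M N" for l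
    using rq injsD(3)[OF that] by (intro injs_eqI[where J = ?M]; simp add: compose_def)+
  have "stratum_kernel N m a t s = (\<Sum>l\<in>injs ?M N. harm_kernel N m a (compose ?M ?q l) l)"
    unfolding stratum_kernel_def
  proof (rule sum.reindex_bij_witness[where i = "compose ?M ?q" and j = "compose ?M ?r"], goal_cases)
    case (1 l) then show ?case using c by simp
  next
    case (2 l) then show ?case using compose_perm_injs[OF _ r] by blast
  next
    case (3 l) then show ?case using c by simp
  next
    case (4 l) then show ?case using compose_perm_injs[OF _ q] by blast
  next
    case (5 l) then show ?case using c by simp
  qed
  also have "\<dots> = stratum_kernel N m a s t"
    unfolding stratum_kernel_def by (intro sum.cong refl harm_kernel_sym compose_perm_injs[OF _ q] a)
  finally show ?thesis .
qed

lemma stratum_op_adjoint: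
  assumes a: "\<And>p. p permutes {..<m} \<Longrightarrow> a (inv p) = a p"
  shows "(\<Sum>s | s permutes N. f s * stratum_op N m a g s) = (\<Sum>s | s permutes N. stratum_op N m a f s * g s)"
proof -
  have "(\<Sum>s | s permutes N. f s * stratum_op N m a g s) = (\<Sum>s | s permutes N. \<Sum>t | t permutes N. f s * (stratum_kernel N m a t s * g t))"
    unfolding stratum_op_def by (simp add: sum_distrib_left)
  also have "\<dots> = (\<Sum>t | t permutes N. \<Sum>s | s permutes N. f s * (stratum_kernel N m a t s * g t))"
    by (rule sum.swap)
  also have "\<dots> = (\<Sum>t | t permutes N. \<Sum>s | s permutes N. stratum_kernel N m a s t * f s * g t)"
  proof (intro sum.cong refl)
    fix s t assume "s \<in> {s. s permutes N}" "t \<in> {t. t permutes N}"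
    then have "stratum_kernel N m a t s = stratum_kernel N m a s t" by (intro stratum_kernel_sym a) auto
    then show "f s * (stratum_kernel N m a t s * g t) = stratum_kernel N m a s t * f s * g t" by simp
  qed
  also have "\<dots> = (\<Sum>s | s permutes N. stratum_op N m a f s * g s)"
    unfolding stratum_op_def by (simp add: sum_distrib_right)
  finally show ?thesis .
qed

lemma orth_degreeD:
  assumes "orth_degree N m f" "l \<in> injs {..<m} N" "k \<in> injs {..<m} N"
  shows "coset_sum N f {..<m} l k = 0"
  using assms unfolding orth_degree_def by simp

text \<open>The operator is self-adjoint and its range is orthogonal to lower degrees, so it kills them.\<close>

lemma stratum_op_degree_le_zero:
  assumes N: "finite N" and m: "2 * m \<le> card N" and q: "q < m" and f: "degree_le N q f"
    and a: "\<And>p. p permutes {..<m} \<Longrightarrow> a (inv p) = a p" and s: "s permutes N"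
  shows "stratum_op N m a f s = 0"
proof -
  let ?g = "stratum_op N m a f"
  have "(\<Sum>s | s permutes N. ?g s * ?g s) = (\<Sum>s | s permutes N. f s * stratum_op N m a ?g s)"
    using stratum_op_adjoint[of m a f N ?g] a by simp
  also have "\<dots> = 0"
    by (rule inner_degree_le_coset_sum[OF N f]) (rule orth_degreeD[OF orth_degree_stratum_op[OF N m q]])
  finally have "\<forall>s\<in>{s. s permutes N}. ?g s * ?g s = 0"
    by (subst (asm) sum_nonneg_eq_0_iff) (use finite_permutations[OF N] in auto)
  then show ?thesis using s by simp
qed

lemma stratum_op_orth_degree_zero:
  assumes N: "finite N" and f: "orth_degree N m f" and s: "s permutes N"
  shows "stratum_op N m a f s = 0"
  unfolding stratum_op_alt[OF N s]
  by (intro sum.neutral ballI) (simp add: orth_degreeD[OF f] compose_perm_injs[OF _ s])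

section \<open>Signed factorisations of a permutation\<close>

abbreviation hit :: "(nat \<Rightarrow> nat) \<Rightarrow> (nat \<Rightarrow> nat) \<Rightarrow> (nat \<Rightarrow> nat) \<Rightarrow> real" where
  "hit e f r \<equiv> (if f = e then of_int (sign r) else 0)"

text \<open>The signed number of ways to write \<open>e\<close> as a product of a permutation of \<open>U\<close> and one of \<open>V\<close>:
the coefficient of \<open>e\<close> in the row symmetriser of \<open>U\<close> times the column antisymmetriser of \<open>V\<close>.\<close>

definition signed_fact :: "nat set \<Rightarrow> nat set \<Rightarrow> (nat \<Rightarrow> nat) \<Rightarrow> real" where
  "signed_fact U V e = (\<Sum>p | p permutes U. \<Sum>r | r permutes V. hit e (p \<circ> r) r)"

lemma sign_transpose_comp:
  assumes "finite V" "r permutes V" "a \<noteq> b"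
  shows "sign (transpose a b \<circ> r) = - sign r"
  using sign_compose[OF permutation_swap_id permutes_imp_permutation[OF assms(1,2)], of a b] assms(3)
  by (simp add: sign_swap_id)

text \<open>A transposition inside the intersection can be moved from one factor to the
other, which reverses the sign.\<close>

lemma signed_fact_overlap:
  fixes a b :: nat
  assumes fin: "finite U" "finite V" and ab: "a \<in> U" "a \<in> V" "b \<in> U" "b \<in> V" "a \<noteq> b"
  shows "signed_fact U V e = 0"
proof -
  let ?t = "transpose a b"
  have tU: "?t permutes U" and tV: "?t permutes V" using ab by (auto intro: permutes_swap_id)
  have "signed_fact U V e = (\<Sum>p | p permutes U. \<Sum>r | r permutes V. hit e (p \<circ> ?t \<circ> r) r)"
    unfolding signed_fact_def by (subst sum_permutations_compose_right[OF tU]) simp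
  also have "\<dots> = (\<Sum>p | p permutes U. \<Sum>r | r permutes V. hit e (p \<circ> ?t \<circ> (?t \<circ> r)) (?t \<circ> r))"
    by (subst setum_permutations_compose_left[OF tV]) simp
  also have "\<dots> = (\<Sum>p | p permutes U. \<Sum>r | r permutes V. - hit e (p \<circ> r) r)"
  proof (intro sum.cong refl)
    fix p r :: "nat \<Rightarrow> nat" assume "r \<in> {r. r permutes V}"
    then have r: "r permutes V" by simp
    have e: "p \<circ> ?t \<circ> (?t \<circ> r) = p \<circ> r" by (auto simp: fun_eq_iff)
    show "hit e (p \<circ> ?t \<circ> (?t \<circ> r)) (?t \<circ> r) = - hit e (p \<circ> r) r"
      unfolding e sign_transpose_comp[OF fin(2) r ab(5)] by simp
  qed
  also have "\<dots> = - signed_fact U V e" unfolding signed_fact_def by (simp add: sum_negf)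
  finally show ?thesis by simp
qed

text \<open>A permutation of \<open>insert x V\<close> is a permutation of \<open>V\<close>, possibly composed with a transposition
that involves \<open>x\<close>.\<close>

lemma signed_fact_insert_right:
  assumes fin: "finite V" and x: "x \<notin> V"
  shows "signed_fact U (insert x V) e = signed_fact U V e -
    (\<Sum>b\<in>V. \<Sum>p | p permutes U. \<Sum>r | r permutes V. hit e (p \<circ> transpose x b \<circ> r) r)"
proof -
  have "signed_fact U (insert x V) e = (\<Sum>p | p permutes U. \<Sum>b\<in>insert x V. \<Sum>r | r permutes V.
      hit e (p \<circ> (transpose x b \<circ> r)) (transpose x b \<circ> r))"
    unfolding signed_fact_def by (subst sum_over_permutations_insert[OF fin x]) simp
  also have "\<dots> = (\<Sum>p | p permutes U. (\<Sum>r | r permutes V. hit e (p \<circ> r) r) +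
      (\<Sum>b\<in>V. \<Sum>r | r permutes V. - hit e (p \<circ> transpose x b \<circ> r) r))"
  proof (rule sum.cong[OF refl])
    fix p
    have "(\<Sum>b\<in>V. \<Sum>r | r permutes V. hit e (p \<circ> (transpose x b \<circ> r)) (transpose x b \<circ> r))
      = (\<Sum>b\<in>V. \<Sum>r | r permutes V. - hit e (p \<circ> transpose x b \<circ> r) r)"
    proof (intro sum.cong refl)
      fix b r assume b: "b \<in> V" and "r \<in> {r. r permutes V}"
      then have r: "r permutes V" by simp
      have "x \<noteq> b" using b x by auto
      from sign_transpose_comp[OF fin r this] have "sign (transpose x b \<circ> r) = - sign r" .
      then show "hit e (p \<circ> (transpose x b \<circ> r)) (transpose x b \<circ> r)
        = - hit e (p \<circ> transpose x b \<circ> r) r"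
        by (simp add: comp_assoc)
    qed
    then show "(\<Sum>b\<in>insert x V. \<Sum>r | r permutes V. hit e (p \<circ> (transpose x b \<circ> r)) (transpose x b \<circ> r))
      = (\<Sum>r | r permutes V. hit e (p \<circ> r) r) +
      (\<Sum>b\<in>V. \<Sum>r | r permutes V. - hit e (p \<circ> transpose x b \<circ> r) r)"
      by (simp only: sum.insert[OF fin x] transpose_same id_comp)
  qed
  also have "\<dots> = signed_fact U V e - (\<Sum>p | p permutes U. \<Sum>b\<in>V. \<Sum>r | r permutes V. hit e (p \<circ> transpose x b \<circ> r) r)"
    unfolding signed_fact_def sum.distrib sum_negf by simp
  also have "(\<Sum>p | p permutes U. \<Sum>b\<in>V. \<Sum>r | r permutes V. hit e (p \<circ> transpose x b \<circ> r) r)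
    = (\<Sum>b\<in>V. \<Sum>p | p permutes U. \<Sum>r | r permutes V. hit e (p \<circ> transpose x b \<circ> r) r)"
    by (rule sum.swap)
  finally show ?thesis .
qed

text \<open>Here the transposition appears to the left of \<open>p\<close>; conjugating it by \<open>p\<close> puts it in the middle,
because \<open>p\<close> fixes \<open>x\<close>.\<close>

lemma signed_fact_insert_left:
  assumes fin: "finite U" and x: "x \<notin> U"
  shows "signed_fact (insert x U) V e = signed_fact U V e +
    (\<Sum>b\<in>U. \<Sum>p | p permutes U. \<Sum>r | r permutes V. hit e (p \<circ> transpose x b \<circ> r) r)"
proof -
  let ?G = "\<lambda>p. \<Sum>r | r permutes V. hit e (p \<circ> r) r"
  have "signed_fact (insert x U) V e = (\<Sum>b\<in>insert x U. \<Sum>p | p permutes U. ?G (transpose x b \<circ> p))"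
    unfolding signed_fact_def by (rule sum_over_permutations_insert[OF fin x])
  also have "\<dots> = signed_fact U V e + (\<Sum>b\<in>U. \<Sum>p | p permutes U. ?G (transpose x b \<circ> p))"
    by (simp only: sum.insert[OF fin x] transpose_same id_comp signed_fact_def)
  also have "(\<Sum>b\<in>U. \<Sum>p | p permutes U. ?G (transpose x b \<circ> p)) = (\<Sum>p | p permutes U. \<Sum>b\<in>U. ?G (transpose x b \<circ> p))"
    by (rule sum.swap)
  also have "\<dots> = (\<Sum>p | p permutes U. \<Sum>b\<in>U. ?G (p \<circ> transpose x b))"
  proof (rule sum.cong[OF refl])
    fix p assume "p \<in> {p. p permutes U}"
    then have p: "p permutes U" by simp
    have "transpose x (p b) \<circ> p = p \<circ> transpose x b" for b
    proof
      fix y show "(transpose x (p b) \<circ> p) y = (p \<circ> transpose x b) y"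
        using permutes_not_in[OF p x] permutes_inj[OF p]
        by (auto simp: transpose_def inj_eq)
    qed
    then have "(\<Sum>b\<in>U. ?G (p \<circ> transpose x b)) = (\<Sum>b\<in>U. ?G (transpose x (p b) \<circ> p))" by simp
    also have "\<dots> = (\<Sum>b\<in>U. ?G (transpose x b \<circ> p))"
      using sum.permute[OF p, of "\<lambda>b. ?G (transpose x b \<circ> p)"] by (simp add: o_def)
    finally show "(\<Sum>b\<in>U. ?G (transpose x b \<circ> p)) = (\<Sum>b\<in>U. ?G (p \<circ> transpose x b))" ..
  qed
  also have "\<dots> = (\<Sum>b\<in>U. \<Sum>p | p permutes U. ?G (p \<circ> transpose x b))"
    by (rule sum.swap)
  finally show ?thesis .
qed

text \<open>The transposition terms of the two preceding expansions carry opposite signs and cancel.\<close>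

lemma signed_fact_grow:
  assumes fin: "finite U" "finite V" and disj: "U \<inter> V = {}"
  shows "(\<Sum>x\<in>V. signed_fact (insert x U) V e) + (\<Sum>x\<in>U. signed_fact U (insert x V) e)
       = real (card U + card V) * signed_fact U V e"
proof -
  let ?T = "\<lambda>x b. \<Sum>p | p permutes U. \<Sum>r | r permutes V. hit e (p \<circ> transpose x b \<circ> r) r"
  have "(\<Sum>x\<in>V. signed_fact (insert x U) V e) = (\<Sum>x\<in>V. signed_fact U V e + (\<Sum>b\<in>U. ?T x b))"
    using disj fin by (intro sum.cong refl signed_fact_insert_left) auto
  moreover have "(\<Sum>x\<in>U. signed_fact U (insert x V) e) = (\<Sum>x\<in>U. signed_fact U V e - (\<Sum>b\<in>V. ?T x b))"
    using disj fin by (intro sum.cong refl signed_fact_insert_right) auto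
  moreover have "(\<Sum>x\<in>V. \<Sum>b\<in>U. ?T x b) = (\<Sum>x\<in>U. \<Sum>b\<in>V. ?T x b)"
    by (subst sum.swap) (simp add: transpose_commute)
  ultimately show ?thesis
    by (simp add: sum.distrib sum_subtractf algebra_simps)
qed

lemma sum_overlap_left:
  fixes G :: "nat set \<Rightarrow> nat set \<Rightarrow> real"
  assumes M: "finite M"
  shows "(\<Sum>(U, V) | U \<subseteq> M \<and> V \<subseteq> M \<and> card (U \<inter> V) = 1. G U V)
       = (\<Sum>(U, V) | U \<subseteq> M \<and> V \<subseteq> M \<and> U \<inter> V = {}. \<Sum>x\<in>V. G (insert x U) V)"
proof -
  let ?D = "{(U, V). U \<subseteq> M \<and> V \<subseteq> M \<and> U \<inter> V = {}}"
  have finD: "finite ?D"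
    by (rule finite_subset[of _ "Pow M \<times> Pow M"]) (use M in auto)
  have "(\<Sum>(U, V)\<in>?D. \<Sum>x\<in>V. G (insert x U) V) = (\<Sum>d\<in>?D. \<Sum>x\<in>snd d. G (insert x (fst d)) (snd d))"
    by (simp add: case_prod_unfold)
  also have "\<dots> = (\<Sum>(d, x)\<in>(SIGMA d:?D. snd d). G (insert x (fst d)) (snd d))"
    by (rule sum.Sigma) (use finD M in \<open>auto intro: finite_subset\<close>)
  also have "\<dots> = (\<Sum>(U, V) | U \<subseteq> M \<and> V \<subseteq> M \<and> card (U \<inter> V) = 1. G U V)"
  proof (rule sum.reindex_bij_witness[where
        i = "\<lambda>(U, V). ((U - V, V), the_elem (U \<inter> V))" and j = "\<lambda>(d, x). (insert x (fst d), snd d)"], goal_cases)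
    case (1 a)
    then obtain U V x where a: "a = ((U, V), x)" "U \<subseteq> M" "V \<subseteq> M" "U \<inter> V = {}" "x \<in> V" by auto
    then have "insert x U \<inter> V = {x}" "insert x U - V = U" by auto
    then show ?case using a by simp
  next
    case (2 a)
    then obtain U V x where a: "a = ((U, V), x)" "U \<subseteq> M" "V \<subseteq> M" "U \<inter> V = {}" "x \<in> V" by auto
    then have "insert x U \<inter> V = {x}" by auto
    then show ?case using a by auto
  next
    case (3 b)
    then obtain U V where b: "b = (U, V)" "U \<subseteq> M" "V \<subseteq> M" "card (U \<inter> V) = 1" by auto
    then obtain x where x: "U \<inter> V = {x}" by (auto simp: card_1_singleton_iff)
    then have "insert x (U - V) = U" by auto
    then show ?case using b x by simp
  next
    case (4 b)
    then obtain U V where b: "b = (U, V)" "U \<subseteq> M" "V \<subseteq> M" "card (U \<inter> V) = 1" by auto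
    then obtain x where x: "U \<inter> V = {x}" by (auto simp: card_1_singleton_iff)
    then show ?case using b by auto
  next
    case (5 a)
    then show ?case by auto
  qed
  finally show ?thesis by simp
qed

lemma sum_overlap_right:
  fixes G :: "nat set \<Rightarrow> nat set \<Rightarrow> real"
  assumes M: "finite M"
  shows "(\<Sum>(U, V) | U \<subseteq> M \<and> V \<subseteq> M \<and> card (U \<inter> V) = 1. G U V)
       = (\<Sum>(U, V) | U \<subseteq> M \<and> V \<subseteq> M \<and> U \<inter> V = {}. \<Sum>x\<in>U. G U (insert x V))"
proof -
  have sw: "\<And>Q H. (\<Sum>(U, V) | U \<subseteq> M \<and> V \<subseteq> M \<and> Q (U \<inter> V). H U V) = (\<Sum>(V, U) | V \<subseteq> M \<and> U \<subseteq> M \<and> Q (V \<inter> U). (H :: nat set \<Rightarrow> nat set \<Rightarrow> real) U V)"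
    by (rule sum.reindex_bij_witness[where i = prod.swap and j = prod.swap]) (auto simp: Int_commute)
  have "(\<Sum>(U, V) | U \<subseteq> M \<and> V \<subseteq> M \<and> card (U \<inter> V) = 1. G U V)
      = (\<Sum>(V, U) | V \<subseteq> M \<and> U \<subseteq> M \<and> card (V \<inter> U) = 1. G U V)"
    by (rule sw[where Q = "\<lambda>W. card W = 1"])
  also have "\<dots> = (\<Sum>(V, U) | V \<subseteq> M \<and> U \<subseteq> M \<and> V \<inter> U = {}. \<Sum>x\<in>U. G U (insert x V))"
    by (rule sum_overlap_left[OF M, of "\<lambda>V U. G U V"])
  also have "\<dots> = (\<Sum>(U, V) | U \<subseteq> M \<and> V \<subseteq> M \<and> U \<inter> V = {}. \<Sum>x\<in>U. G U (insert x V))"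
    by (rule sw[where Q = "\<lambda>W. W = {}", symmetric])
  finally show ?thesis .
qed

text \<open>Pairs that meet in two points contribute nothing. For pairs that meet in one point \<open>x\<close>,
the recurrence splits the coefficient into a part to be read as "remove \<open>x\<close> from \<open>U\<close>" and a part to
be read as "remove \<open>x\<close> from \<open>V\<close>". By \<open>signed_fact_grow\<close> these parts cancel the contribution of each
disjoint pair except the pair of empty sets.\<close>

lemma sum_signed_fact:
  fixes \<alpha> :: "nat \<Rightarrow> nat \<Rightarrow> real"
  assumes M: "finite M"
    and rec: "\<And>u v. u < card M \<Longrightarrow> v < card M \<Longrightarrow>
      real (u + v + 1) * \<alpha> (Suc u) (Suc v) = - (\<alpha> u (Suc v) + \<alpha> (Suc u) v)"
  shows "(\<Sum>(U, V) | U \<subseteq> M \<and> V \<subseteq> M. \<alpha> (card U) (card V) * signed_fact U V e) = (if e = id then \<alpha> 0 0 else 0)"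
proof -
  let ?A = "{(U, V). U \<subseteq> M \<and> V \<subseteq> M}"
  let ?D = "{(U, V). U \<subseteq> M \<and> V \<subseteq> M \<and> U \<inter> V = {}}"
  let ?O = "{(U, V). U \<subseteq> M \<and> V \<subseteq> M \<and> card (U \<inter> V) = 1}"
  let ?F = "\<lambda>(U, V). \<alpha> (card U) (card V) * signed_fact U V e"
  have finA: "finite ?A"
    by (rule finite_subset[of _ "Pow M \<times> Pow M"]) (use M in auto)
  have finD: "finite ?D" and finO: "finite ?O" by (rule finite_subset[OF _ finA]; auto)+
  have fM: "finite U" if "U \<subseteq> M" for U using that M finite_subset by blast
  have DO: "?D \<inter> ?O = {}" by auto
  have "sum ?F ?A = sum ?F (?D \<union> ?O)"
  proof (rule sum.mono_neutral_right[OF finA])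
    show "\<forall>d\<in>?A - (?D \<union> ?O). ?F d = 0"
    proof
      fix d assume "d \<in> ?A - (?D \<union> ?O)"
      then obtain U V where d: "d = (U, V)" "U \<subseteq> M" "V \<subseteq> M" "U \<inter> V \<noteq> {}" "card (U \<inter> V) \<noteq> 1" by auto
      obtain a where a: "a \<in> U \<inter> V" using d by auto
      then obtain b where b: "b \<in> U \<inter> V" "b \<noteq> a" using d(5)
        by (metis is_singletonI' is_singleton_altdef empty_iff)
      show "?F d = 0" using signed_fact_overlap[of U V a b e] a b d fM by auto
    qed
  qed auto
  also have "\<dots> = sum ?F ?D + sum ?F ?O" by (rule sum.union_disjoint[OF finD finO DO])
  \<comment> \<open>Both coordinates are positive on such pairs, so the recurrence applies to each coefficient.\<close>
  also have "sum ?F ?O = - (\<Sum>(U, V)\<in>?O. \<alpha> (card U - 1) (card V) / real (card U + card V - 1) * signed_fact U V e)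
                         - (\<Sum>(U, V)\<in>?O. \<alpha> (card U) (card V - 1) / real (card U + card V - 1) * signed_fact U V e)"
    unfolding sum_negf[symmetric] sum_subtractf[symmetric]
  proof (rule sum.cong[OF refl])
    fix d assume "d \<in> ?O"
    then obtain U V where d: "d = (U, V)" "U \<subseteq> M" "V \<subseteq> M" "card (U \<inter> V) = 1" by auto
    then have "U \<noteq> {}" "V \<noteq> {}" by auto
    then have c: "card U > 0" "card V > 0" "card U \<le> card M" "card V \<le> card M"
      using d fM by (auto simp: card_gt_0_iff intro: card_mono[OF M])
    then obtain u v where uv: "card U = Suc u" "card V = Suc v" by (metis Suc_pred')
    have hA: "\<alpha> (Suc u) (Suc v) = - (\<alpha> u (Suc v) + \<alpha> (Suc u) v) / real (u + v + 1)"
      using rec[of u v] c uv by (simp add: field_simps)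
    have hB: "real (card U + card V - 1) = real (u + v + 1)" using uv by simp
    show "?F d = - (case d of (U, V) \<Rightarrow> \<alpha> (card U - 1) (card V) / real (card U + card V - 1) * signed_fact U V e)
        - (case d of (U, V) \<Rightarrow> \<alpha> (card U) (card V - 1) / real (card U + card V - 1) * signed_fact U V e)"
      unfolding d(1) prod.case hB unfolding uv hA by (simp add: diff_divide_distrib algebra_simps)
  qed
  also have "(\<Sum>(U, V)\<in>?O. \<alpha> (card U - 1) (card V) / real (card U + card V - 1) * signed_fact U V e)
      = (\<Sum>(U, V)\<in>?D. \<Sum>x\<in>V. \<alpha> (card U) (card V) / real (card U + card V) * signed_fact (insert x U) V e)"
    unfolding sum_overlap_left[OF M]
  proof (intro sum.cong refl, clarify)
    fix U V assume "U \<subseteq> M" "V \<subseteq> M" "U \<inter> V = {}"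
    then have "card (insert x U) = Suc (card U)" if "x \<in> V" for x using that fM by (subst card_insert_disjoint) auto
    then show "(\<Sum>x\<in>V. \<alpha> (card (insert x U) - 1) (card V) / real (card (insert x U) + card V - 1) * signed_fact (insert x U) V e)
      = (\<Sum>x\<in>V. \<alpha> (card U) (card V) / real (card U + card V) * signed_fact (insert x U) V e)" by simp
  qed
  also have "(\<Sum>(U, V)\<in>?O. \<alpha> (card U) (card V - 1) / real (card U + card V - 1) * signed_fact U V e)
      = (\<Sum>(U, V)\<in>?D. \<Sum>x\<in>U. \<alpha> (card U) (card V) / real (card U + card V) * signed_fact U (insert x V) e)"
    unfolding sum_overlap_right[OF M]
  proof (intro sum.cong refl, clarify)
    fix U V assume "U \<subseteq> M" "V \<subseteq> M" "U \<inter> V = {}"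
    then have "card (insert x V) = Suc (card V)" if "x \<in> U" for x using that fM by (subst card_insert_disjoint) auto
    then show "(\<Sum>x\<in>U. \<alpha> (card U) (card (insert x V) - 1) / real (card U + card (insert x V) - 1) * signed_fact U (insert x V) e)
      = (\<Sum>x\<in>U. \<alpha> (card U) (card V) / real (card U + card V) * signed_fact U (insert x V) e)" by simp
  qed
  \<comment> \<open>Now all three sums run over disjoint pairs, and they cancel pair by pair.\<close>
  also have "sum ?F ?D + (- (\<Sum>(U, V)\<in>?D. \<Sum>x\<in>V. \<alpha> (card U) (card V) / real (card U + card V) * signed_fact (insert x U) V e)
      - (\<Sum>(U, V)\<in>?D. \<Sum>x\<in>U. \<alpha> (card U) (card V) / real (card U + card V) * signed_fact U (insert x V) e))
      = (\<Sum>d\<in>?D. if d = ({}, {}) then ?F d else 0)"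
    unfolding sum_negf[symmetric] sum_subtractf[symmetric] sum.distrib[symmetric]
  proof (rule sum.cong[OF refl])
    fix d assume "d \<in> ?D"
    then obtain U V where d: "d = (U, V)" "U \<subseteq> M" "V \<subseteq> M" "U \<inter> V = {}" by auto
    have g: "(\<Sum>x\<in>V. \<alpha> (card U) (card V) / real (card U + card V) * signed_fact (insert x U) V e)
        + (\<Sum>x\<in>U. \<alpha> (card U) (card V) / real (card U + card V) * signed_fact U (insert x V) e)
        = \<alpha> (card U) (card V) / real (card U + card V) * (real (card U + card V) * signed_fact U V e)"
      unfolding signed_fact_grow[OF fM[OF d(2)] fM[OF d(3)] d(4), symmetric] by (simp only: distrib_left sum_distrib_left)
    have cancel: "w \<noteq> 0 \<Longrightarrow> a / w * (w * b) = a * b" for a b w :: real by simp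
    show "?F d + (- (case d of (U, V) \<Rightarrow> \<Sum>x\<in>V. \<alpha> (card U) (card V) / real (card U + card V) * signed_fact (insert x U) V e)
      - (case d of (U, V) \<Rightarrow> \<Sum>x\<in>U. \<alpha> (card U) (card V) / real (card U + card V) * signed_fact U (insert x V) e))
      = (if d = ({}, {}) then ?F d else 0)"
    proof (cases "d = ({}, {})")
      case True
      then show ?thesis using d by simp
    next
      case False
      then have "card U + card V > 0" using d fM by (auto simp: card_gt_0_iff)
      then have "real (card U + card V) \<noteq> 0" by linarith
      then have "\<alpha> (card U) (card V) / real (card U + card V) * (real (card U + card V) * signed_fact U V e)
          = \<alpha> (card U) (card V) * signed_fact U V e" by (rule cancel)
      then show ?thesis using g False unfolding d(1) by simp
    qed
  qed
  also have "\<dots> = ?F ({}, {})" using finD by (subst sum.delta) auto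
  also have "\<dots> = (if e = id then \<alpha> 0 0 else 0)" by (auto simp: signed_fact_def)
  finally show ?thesis by simp
qed

section \<open>Two inverse elements of the group algebra\<close>

definition fix_wt :: "'a set \<Rightarrow> nat \<Rightarrow> nat \<Rightarrow> real" where
  "fix_wt N m j = fact (card N - m - j) / fact (card N - m)"

definition sgn_wt :: "'a set \<Rightarrow> nat \<Rightarrow> nat \<Rightarrow> real" where
  "sgn_wt N m j = (- 1) ^ j * (fact (card N) / fact (card N - m + j))"

text \<open>Summing over the sets \<open>U\<close> that contain all points moved by \<open>p\<close> is the same as summing
over sets of fixed points. This is the convolution kernel that the agreement sums of harmonic
functions produce.\<close>

definition overlap :: "'a set \<Rightarrow> nat \<Rightarrow> (nat \<Rightarrow> nat) \<Rightarrow> real" where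
  "overlap N m p = (\<Sum>U | U \<subseteq> {..<m} \<and> p permutes U. fix_wt N m (card U))"

text \<open>For \<open>2 * m \<le> card N\<close> this is the character by which permutations of the \<open>m\<close> indices act on the
harmonic functions of injections into \<open>N\<close>.\<close>

definition harm_char :: "'a set \<Rightarrow> nat \<Rightarrow> (nat \<Rightarrow> nat) \<Rightarrow> real" where
  "harm_char N m p = (\<Sum>U | U \<subseteq> {..<m} \<and> p permutes U. sgn_wt N m (card U) * of_int (sign p))"

lemma permutes_inv_iff:
  assumes "p permutes M"
  shows "inv p permutes U \<longleftrightarrow> p permutes U"
  using permutes_inv[of p U] permutes_inv[of "inv p" U] permutes_inv_inv[OF assms] by auto

lemma overlap_inv: "p permutes {..<m} \<Longrightarrow> overlap N m (inv p) = overlap N m p"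
  unfolding overlap_def by (simp add: permutes_inv_iff)

lemma harm_char_inv: "p permutes {..<m} \<Longrightarrow> harm_char N m (inv p) = harm_char N m p"
  unfolding harm_char_def by (simp add: permutes_inv_iff sign_inverse permutes_imp_permutation[OF finite_lessThan])

text \<open>The coefficients satisfy the recurrence of \<open>sum_signed_fact\<close> because
\<open>u + v + 1 = (n - m + v + 1) - (n - m - u)\<close>.\<close>

lemma overlap_harm_char:
  assumes m: "2 * m \<le> card N" and e: "e permutes {..<m}"
  shows "(\<Sum>p | p permutes {..<m}. overlap N m p * harm_char N m (inv p \<circ> e))
       = (if e = id then fact (card N) / fact (card N - m) else 0)"
proof -
  let ?M = "{..<m}" and ?c = "fix_wt N m" and ?b = "sgn_wt N m"
  let ?h = "\<lambda>U V p. if p permutes U \<and> inv p \<circ> e permutes V then of_int (sign (inv p \<circ> e)) else (0::real)"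
  have inner: "(\<Sum>p | p permutes ?M. ?h U V p)
      = signed_fact U V e" if U: "U \<subseteq> ?M" and V: "V \<subseteq> ?M" for U V
  proof -
    have finU: "finite {p. p permutes U}" "finite {r. r permutes V}"
      using finite_permutations finite_subset[OF U] finite_subset[OF V] by auto
    have "signed_fact U V e = (\<Sum>p | p permutes U. if inv p \<circ> e permutes V then of_int (sign (inv p \<circ> e)) else 0)"
      unfolding signed_fact_def
    proof (rule sum.cong[OF refl])
      fix p assume "p \<in> {p. p permutes U}"
      then have p: "p permutes U" by simp
      have eq: "p \<circ> r = e \<longleftrightarrow> r = inv p \<circ> e" for r
      proof
        assume "p \<circ> r = e"
        then have "inv p \<circ> e = (inv p \<circ> p) \<circ> r" by (simp add: comp_assoc)
        then show "r = inv p \<circ> e" using permutes_inv_o(2)[OF p] by simp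
      next
        assume "r = inv p \<circ> e"
        then have "p \<circ> r = (p \<circ> inv p) \<circ> e" by (simp add: comp_assoc)
        then show "p \<circ> r = e" using permutes_inv_o(1)[OF p] by simp
      qed
      show "(\<Sum>r | r permutes V. if p \<circ> r = e then of_int (sign r) else 0)
          = (if inv p \<circ> e permutes V then of_int (sign (inv p \<circ> e)) else (0::real))"
        unfolding eq using finU(2) by (subst sum.delta) auto
    qed
    also have "\<dots> = (\<Sum>p | p permutes ?M. ?h U V p)"
      by (rule sum.mono_neutral_cong_left) (use U finite_permutations[of ?M] permutes_subset in auto)
    finally show ?thesis ..
  qed
  have finS: "finite {U. U \<subseteq> ?M}" by simp
  have gs: "overlap N m p = (\<Sum>U | U \<subseteq> ?M. if p permutes U then ?c (card U) else 0)" for p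
    unfolding overlap_def by (rule sum.mono_neutral_cong_left) auto
  have cs: "harm_char N m p = (\<Sum>U | U \<subseteq> ?M. if p permutes U then ?b (card U) * of_int (sign p) else 0)" for p
    unfolding harm_char_def by (rule sum.mono_neutral_cong_left) auto
  have "(\<Sum>p | p permutes ?M. overlap N m p * harm_char N m (inv p \<circ> e))
      = (\<Sum>p | p permutes ?M. \<Sum>U | U \<subseteq> ?M. \<Sum>V | V \<subseteq> ?M.
          ?c (card U) * ?b (card V) * ?h U V p)"
    unfolding gs cs sum_product by (intro sum.cong refl) auto
  also have "\<dots> = (\<Sum>U | U \<subseteq> ?M. \<Sum>p | p permutes ?M. \<Sum>V | V \<subseteq> ?M.
          ?c (card U) * ?b (card V) * ?h U V p)"
    by (rule sum.swap)
  also have "\<dots> = (\<Sum>U | U \<subseteq> ?M. \<Sum>V | V \<subseteq> ?M. ?c (card U) * ?b (card V) * signed_fact U V e)"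
  proof (rule sum.cong[OF refl])
    fix U assume U: "U \<in> {U. U \<subseteq> ?M}"
    show "(\<Sum>p | p permutes ?M. \<Sum>V | V \<subseteq> ?M.
          ?c (card U) * ?b (card V) * ?h U V p)
        = (\<Sum>V | V \<subseteq> ?M. ?c (card U) * ?b (card V) * signed_fact U V e)"
      by (subst sum.swap) (use U inner in \<open>simp add: sum_distrib_left[symmetric]\<close>)
  qed
  also have "\<dots> = (\<Sum>(U, V)\<in>{U. U \<subseteq> ?M} \<times> {V. V \<subseteq> ?M}. ?c (card U) * ?b (card V) * signed_fact U V e)"
    by (rule sum.cartesian_product)
  also have "{U. U \<subseteq> ?M} \<times> {V. V \<subseteq> ?M} = {(U, V). U \<subseteq> ?M \<and> V \<subseteq> ?M}" by auto
  also have "(\<Sum>(U, V)\<in>{(U, V). U \<subseteq> ?M \<and> V \<subseteq> ?M}. ?c (card U) * ?b (card V) * signed_fact U V e)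
      = (if e = id then ?c 0 * ?b 0 else 0)"
  proof (rule sum_signed_fact[where \<alpha> = "\<lambda>u v. ?c u * ?b v"])
    fix u v assume u: "u < card ?M" and v: "v < card ?M"
    obtain q where q: "card N - m - u = Suc q" using u m by (cases "card N - m - u") auto
    have q': "card N - m - Suc u = q" using q by simp
    have q'': "card N - m = Suc (q + u)" using q by simp
    have c: "?c u = real (Suc q) * ?c (Suc u)" unfolding fix_wt_def q q' by simp
    have b: "?b v = - real (Suc (q + u + Suc v)) * ?b (Suc v)"
    proof -
      have "fact (Suc (q + u) + Suc v) = real (Suc (q + u + Suc v)) * fact (Suc (q + u) + v)"
        by (simp add: algebra_simps)
      moreover have "real (Suc (q + u + Suc v)) \<noteq> 0" by linarith
      ultimately show ?thesis
        unfolding sgn_wt_def q'' by (simp del: of_nat_Suc of_nat_add fact_Suc add_Suc add_Suc_right)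
    qed
    show "real (u + v + 1) * (?c (Suc u) * ?b (Suc v)) = - (?c u * ?b (Suc v) + ?c (Suc u) * ?b v)"
      unfolding c b by (simp add: algebra_simps)
  qed simp
  also have "?c 0 * ?b 0 = fact (card N) / fact (card N - m)"
    unfolding fix_wt_def sgn_wt_def by simp
  finally show ?thesis .
qed

text \<open>Both functions are invariant under inversion, so the convolution may be read backwards.\<close>

lemma harm_char_overlap:
  assumes m: "2 * m \<le> card N" and e: "e permutes {..<m}"
  shows "(\<Sum>p | p permutes {..<m}. harm_char N m p * overlap N m (inv p \<circ> e))
       = (if e = id then fact (card N) / fact (card N - m) else 0)"
proof -
  let ?M = "{..<m}"
  have ie: "inv e permutes ?M" by (rule permutes_inv[OF e])
  have "(\<Sum>p | p permutes ?M. harm_char N m p * overlap N m (inv p \<circ> e)) = (\<Sum>p | p permutes ?M. overlap N m p * harm_char N m (inv p \<circ> inv e))"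
  proof (rule sum.reindex_bij_witness[where i = "\<lambda>p. e \<circ> p" and j = "\<lambda>p. inv e \<circ> p"], goal_cases)
    case (1 p)
    then show ?case using permutes_inv_o(1)[OF e] by (simp add: comp_assoc[symmetric])
  next
    case (2 p) then show ?case using permutes_compose[OF _ ie] by simp
  next
    case (3 p)
    then show ?case using permutes_inv_o(2)[OF e] by (simp add: comp_assoc[symmetric])
  next
    case (4 p) then show ?case using permutes_compose[OF _ e] by simp
  next
    case (5 p)
    then have p: "p permutes ?M" by simp
    have ip: "inv p \<circ> e permutes ?M" using permutes_compose[OF e permutes_inv[OF p]] .
    have i1: "inv (inv p \<circ> e) = inv e \<circ> p"
      using o_inv_distrib[OF permutes_bij[OF permutes_inv[OF p]] permutes_bij[OF e]] permutes_inv_inv[OF p] by simp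
    have "overlap N m (inv p \<circ> e) = overlap N m (inv e \<circ> p)" using overlap_inv[OF ip, of N] i1 by simp
    moreover have "inv (inv e \<circ> p) \<circ> inv e = inv p"
    proof -
      have "inv (inv e \<circ> p) = inv p \<circ> e"
        using o_inv_distrib[OF permutes_bij[OF ie] permutes_bij[OF p]] permutes_inv_inv[OF e] by simp
      then show ?thesis using permutes_inv_o(1)[OF e] by (simp add: comp_assoc)
    qed
    ultimately show ?case using harm_char_inv[OF p, of N] by simp
  qed
  also have "\<dots> = (if inv e = id then fact (card N) / fact (card N - m) else 0)"
    by (rule overlap_harm_char[OF m ie])
  also have "inv e = id \<longleftrightarrow> e = id"
    using permutes_inv_inv[OF e] by (metis inv_id)
  finally show ?thesis .
qed

text \<open>Up to a scalar this is the convolution square of \<open>harm_char\<close>. Two factors are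
needed: the operator built from \<open>a\<close> acts on its stratum as \<open>a\<close> convolved twice with \<open>overlap\<close>.\<close>

definition stratum_coeff :: "'a set \<Rightarrow> nat \<Rightarrow> (nat \<Rightarrow> nat) \<Rightarrow> real" where
  "stratum_coeff N m p = fact (card N - m) / (fact (card N) ^ 2 * fact m) *
     (\<Sum>t | t permutes {..<m}. harm_char N m t * harm_char N m (inv t \<circ> p))"

lemma stratum_coeff_inv:
  assumes p: "p permutes {..<m}"
  shows "stratum_coeff N m (inv p) = stratum_coeff N m p"
proof -
  let ?M = "{..<m}"
  have ip: "inv p permutes ?M" by (rule permutes_inv[OF p])
  have "(\<Sum>t | t permutes ?M. harm_char N m t * harm_char N m (inv t \<circ> inv p)) = (\<Sum>t | t permutes ?M. harm_char N m t * harm_char N m (inv t \<circ> p))"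
  proof (rule sum.reindex_bij_witness[where i = "\<lambda>t. inv p \<circ> t" and j = "\<lambda>t. p \<circ> t"], goal_cases)
    case (1 t)
    then show ?case using permutes_inv_o(2)[OF p] by (simp add: comp_assoc[symmetric])
  next
    case (2 t) then show ?case using permutes_compose[OF _ p] by simp
  next
    case (3 t)
    then show ?case using permutes_inv_o(1)[OF p] by (simp add: comp_assoc[symmetric])
  next
    case (4 t) then show ?case using permutes_compose[OF _ ip] by simp
  next
    case (5 t)
    then have t: "t permutes ?M" by simp
    have "inv (p \<circ> t) = inv t \<circ> inv p" by (rule o_inv_distrib[OF permutes_bij[OF p] permutes_bij[OF t]])
    moreover from this have "inv (p \<circ> t) \<circ> p = inv t"
      using permutes_inv_o(2)[OF p] by (simp add: comp_assoc)
    moreover have "harm_char N m (inv t \<circ> inv p) = harm_char N m (p \<circ> t)"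
      using harm_char_inv[OF permutes_compose[OF t p]] calculation(1) by metis
    ultimately show ?case using harm_char_inv[OF t, of N] by simp
  qed
  then show ?thesis unfolding stratum_coeff_def by simp
qed

lemma stratum_coeff_overlap:
  assumes m: "2 * m \<le> card N" and q: "q permutes {..<m}"
  shows "(\<Sum>p | p permutes {..<m}. stratum_coeff N m p * overlap N m (inv p \<circ> q)) = harm_char N m q / (fact (card N) * fact m)"
proof -
  let ?M = "{..<m}" and ?P = "{p. p permutes {..<m}}"
  let ?C = "fact (card N - m) / (fact (card N) ^ 2 * fact m) :: real"
  have inner: "(\<Sum>p\<in>?P. harm_char N m (inv t \<circ> p) * overlap N m (inv p \<circ> q))
      = (if t = q then fact (card N) / fact (card N - m) else 0)" if t: "t permutes ?M" for t
  proof -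
    have it: "inv t permutes ?M" by (rule permutes_inv[OF t])
    have "(\<Sum>p\<in>?P. harm_char N m (inv t \<circ> p) * overlap N m (inv p \<circ> q))
        = (\<Sum>p\<in>?P. harm_char N m (inv t \<circ> (t \<circ> p)) * overlap N m (inv (t \<circ> p) \<circ> q))"
      by (rule setum_permutations_compose_left[OF t])
    also have "\<dots> = (\<Sum>p\<in>?P. harm_char N m p * overlap N m (inv p \<circ> (inv t \<circ> q)))"
    proof (rule sum.cong[OF refl])
      fix p assume "p \<in> ?P"
      then have p: "p permutes ?M" by simp
      have "inv t \<circ> (t \<circ> p) = p" using permutes_inv_o(2)[OF t] by (simp add: comp_assoc[symmetric])
      moreover have "inv (t \<circ> p) = inv p \<circ> inv t" by (rule o_inv_distrib[OF permutes_bij[OF t] permutes_bij[OF p]])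
      ultimately show "harm_char N m (inv t \<circ> (t \<circ> p)) * overlap N m (inv (t \<circ> p) \<circ> q) = harm_char N m p * overlap N m (inv p \<circ> (inv t \<circ> q))"
        by (simp add: comp_assoc)
    qed
    also have "\<dots> = (if inv t \<circ> q = id then fact (card N) / fact (card N - m) else 0)"
      by (rule harm_char_overlap[OF m permutes_compose[OF q it]])
    also have "inv t \<circ> q = id \<longleftrightarrow> t = q"
    proof
      assume "inv t \<circ> q = id"
      then have "t \<circ> (inv t \<circ> q) = t" by simp
      then show "t = q" using permutes_inv_o(1)[OF t] by (simp add: comp_assoc[symmetric])
    qed (use permutes_inv_o(2)[OF t] in auto)
    finally show ?thesis .
  qed
  have "(\<Sum>p\<in>?P. stratum_coeff N m p * overlap N m (inv p \<circ> q))
      = (\<Sum>p\<in>?P. \<Sum>t\<in>?P. ?C * harm_char N m t * (harm_char N m (inv t \<circ> p) * overlap N m (inv p \<circ> q)))"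
    unfolding stratum_coeff_def by (simp add: sum_distrib_left sum_distrib_right mult_ac)
  also have "\<dots> = (\<Sum>t\<in>?P. ?C * harm_char N m t * (\<Sum>p\<in>?P. harm_char N m (inv t \<circ> p) * overlap N m (inv p \<circ> q)))"
    by (subst sum.swap) (simp add: sum_distrib_left)
  also have "\<dots> = (\<Sum>t\<in>?P. if t = q then ?C * harm_char N m q * (fact (card N) / fact (card N - m)) else 0)"
    by (rule sum.cong[OF refl]) (simp add: inner)
  also have "\<dots> = ?C * harm_char N m q * (fact (card N) / fact (card N - m))"
    using q by (subst sum.delta) (auto simp: finite_permutations)
  also have "\<dots> = harm_char N m q / (fact (card N) * fact m)"
    by (simp add: power2_eq_square)
  finally show ?thesis .
qed

section \<open>The kernel operator is the identity on its stratum\<close>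

lemma harmonic_compose_index:
  assumes M: "finite M" and h: "harmonic M N X" and r: "r permutes M"
  shows "harmonic M N (\<lambda>l. X (compose M l r))"
  unfolding harmonic_def
proof (intro ballI)
  fix x f assume x: "x \<in> M" and f: "f \<in> injs (M - {x}) N"
  define y where "y = inv r x"
  have y: "y \<in> M" "r y = x"
    using x permutes_in_image[OF permutes_inv[OF r]] permutes_inverses(1)[OF r] by (auto simp: y_def)
  have rz: "r z \<in> M - {x}" if "z \<in> M - {y}" for z
    using that y permutes_in_image[OF r, of z] permutes_inj[OF r] by (auto dest: injD)
  let ?g = "compose (M - {y}) f r"
  have g: "?g \<in> injs (M - {y}) N"
    unfolding injs_def
  proof (intro CollectI conjI)
    show "?g \<in> M - {y} \<rightarrow>\<^sub>E N" using rz injsD(2)[OF f] by (auto simp: compose_def)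
    show "inj_on ?g (M - {y})"
    proof (rule inj_onI)
      fix a b assume "a \<in> M - {y}" "b \<in> M - {y}" "?g a = ?g b"
      then have "r a = r b" using inj_onD[OF injsD(1)[OF f], of "r a" "r b"] rz by (simp add: compose_def)
      then show "a = b" using permutes_inj[OF r] by (auto dest: injD)
    qed
  qed
  have im: "?g ` (M - {y}) = f ` (M - {x})"
  proof -
    have "r ` (M - {y}) = M - {x}"
      using permutes_image[OF r] permutes_inj[OF r] y(2) by (simp add: image_set_diff)
    moreover have "?g ` (M - {y}) = f ` r ` (M - {y})" by (auto simp: compose_def)
    ultimately show ?thesis by simp
  qed
  have e: "compose M (f(x := v)) r = ?g(y := v)" for v
  proof
    fix z show "compose M (f(x := v)) r z = (?g(y := v)) z"
      using rz[of z] y by (cases "z = y"; cases "z \<in> M") (auto simp: compose_def)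
  qed
  have "(\<Sum>v\<in>N - ?g ` (M - {y}). X (?g(y := v))) = 0"
    using h y(1) g unfolding harmonic_def by blast
  then show "(\<Sum>v\<in>N - f ` (M - {x}). X (compose M (f(x := v)) r)) = 0"
    unfolding e im .
qed

text \<open>Rearrangements \<open>q\<close> of \<open>l\<close> are weighted by the sets on which they agree with \<open>p\<close>, and this weight
depends only on \<open>inv p \<circ> q\<close>.\<close>

lemma sum_agree_overlap:
  assumes N: "finite N" and h: "harmonic {..<m} N \<phi>" and l: "l \<in> injs {..<m} N" and p: "p permutes {..<m}"
  shows "(\<Sum>f | f \<in> injs {..<m} N \<and> (\<forall>x\<in>{..<m}. f x = l (p x) \<or> f x \<notin> l ` {..<m}).
            swap_wt N m (card {x\<in>{..<m}. f x \<notin> l ` {..<m}}) * \<phi> f)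
       = (\<Sum>q | q permutes {..<m}. overlap N m (inv p \<circ> q) * \<phi> (compose {..<m} l q))"
proof -
  let ?M = "{..<m}" and ?P = "{q. q permutes {..<m}}"
  have g: "compose ?M l p \<in> injs ?M (l ` ?M)"
    by (rule compose_in_injs[OF _ p]) (use l in \<open>auto simp: injs_def\<close>)
  have set1: "{f. f \<in> injs ?M N \<and> (\<forall>x\<in>?M. f x = l (p x) \<or> f x \<notin> l ` ?M)}
      = {f. f \<in> injs ?M N \<and> (\<forall>x\<in>?M. f x = compose ?M l p x \<or> f x \<notin> l ` ?M)}"
    by (auto simp: compose_def)
  have K: "(\<forall>x\<in>K. compose ?M l q x = compose ?M l p x) \<longleftrightarrow> (\<forall>x\<in>K. q x = p x)"
    if "K \<subseteq> ?M" and q: "q permutes ?M" for K q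
  proof -
    have "compose ?M l q x = compose ?M l p x \<longleftrightarrow> q x = p x" if "x \<in> ?M" for x
      using that inj_on_eq_iff[OF injsD(1)[OF l], of "q x" "p x"] permutes_in_image[OF p, of x] permutes_in_image[OF q, of x]
      by (simp add: compose_def)
    then show ?thesis using \<open>K \<subseteq> ?M\<close> by (meson subsetD)
  qed
  have gamK: "(\<Sum>K | K \<subseteq> ?M \<and> (\<forall>x\<in>K. q x = p x). fix_wt N m (card (?M - K))) = overlap N m (inv p \<circ> q)"
    if q: "q permutes ?M" for q
    unfolding overlap_def
  proof (rule sum.reindex_bij_witness[where i = "\<lambda>U. ?M - U" and j = "\<lambda>K. ?M - K"], goal_cases)
    case (1 K) then show ?case by auto
  next
    case (2 K)
    have "inv p \<circ> q permutes ?M" by (rule permutes_compose[OF q permutes_inv[OF p]])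
    moreover have "(inv p \<circ> q) x = x" if "x \<in> K" for x
      using 2 that permutes_inverses(2)[OF p] by simp
    ultimately have "inv p \<circ> q permutes ?M - K" by (rule permutes_superset) auto
    then show ?case by auto
  next
    case (3 U) then show ?case by auto
  next
    case (4 U)
    have "q x = p x" if "x \<in> ?M - U" for x
    proof -
      have "inv p (q x) = x" using permutes_not_in[of "inv p \<circ> q" U x] 4 that by simp
      then show ?thesis using permutes_inv_eq[OF p] by metis
    qed
    then show ?case by auto
  next
    case (5 K) then show ?case by simp
  qed
  have "(\<Sum>f | f \<in> injs ?M N \<and> (\<forall>x\<in>?M. f x = l (p x) \<or> f x \<notin> l ` ?M).
            swap_wt N m (card {x\<in>?M. f x \<notin> l ` ?M}) * \<phi> f)
      = (\<Sum>K\<in>Pow ?M. swap_wt N m (card (?M - K)) * ((- 1) ^ card (?M - K) *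
          (\<Sum>f | f \<in> injs ?M (l ` ?M) \<and> (\<forall>x\<in>K. f x = compose ?M l p x). \<phi> f)))"
    unfolding set1 by (rule sum_injs_agree[OF finite_lessThan N h injsD(2)[OF l] g])
  also have "\<dots> = (\<Sum>K\<in>Pow ?M. fix_wt N m (card (?M - K)) * (\<Sum>q | q permutes ?M \<and> (\<forall>x\<in>K. q x = p x). \<phi> (compose ?M l q)))"
  proof (rule sum.cong[OF refl])
    fix K assume "K \<in> Pow ?M"
    then have KM: "K \<subseteq> ?M" by simp
    have "(\<Sum>f | f \<in> injs ?M (l ` ?M) \<and> (\<forall>x\<in>K. f x = compose ?M l p x). \<phi> f)
        = (\<Sum>q | q permutes ?M \<and> (\<forall>x\<in>K. compose ?M l q x = compose ?M l p x). \<phi> (compose ?M l q))"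
      by (rule sum_injs_permutes[OF finite_lessThan l refl])
    also have "\<dots> = (\<Sum>q | q permutes ?M \<and> (\<forall>x\<in>K. q x = p x). \<phi> (compose ?M l q))"
      by (rule sum.cong) (use K[OF KM] in auto)
    finally have e: "(\<Sum>f | f \<in> injs ?M (l ` ?M) \<and> (\<forall>x\<in>K. f x = compose ?M l p x). \<phi> f) = \<dots>" .
    have w: "swap_wt N m j * ((- 1) ^ j * z) = fix_wt N m j * z" for j z
      by (simp add: swap_wt_def fix_wt_def power_mult_distrib[symmetric] mult.assoc[symmetric])
    show "swap_wt N m (card (?M - K)) * ((- 1) ^ card (?M - K) *
          (\<Sum>f | f \<in> injs ?M (l ` ?M) \<and> (\<forall>x\<in>K. f x = compose ?M l p x). \<phi> f))
        = fix_wt N m (card (?M - K)) * (\<Sum>q | q permutes ?M \<and> (\<forall>x\<in>K. q x = p x). \<phi> (compose ?M l q))"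
      unfolding e by (rule w)
  qed
  also have "\<dots> = (\<Sum>K\<in>Pow ?M. \<Sum>q\<in>?P. if \<forall>x\<in>K. q x = p x then fix_wt N m (card (?M - K)) * \<phi> (compose ?M l q) else 0)"
    unfolding sum_distrib_left
    by (intro sum.cong refl sum.mono_neutral_cong_left) (auto simp: finite_permutations)
  also have "\<dots> = (\<Sum>q\<in>?P. \<Sum>K\<in>Pow ?M. if \<forall>x\<in>K. q x = p x then fix_wt N m (card (?M - K)) * \<phi> (compose ?M l q) else 0)"
    by (rule sum.swap)
  also have "\<dots> = (\<Sum>q\<in>?P. (\<Sum>K | K \<subseteq> ?M \<and> (\<forall>x\<in>K. q x = p x). fix_wt N m (card (?M - K))) * \<phi> (compose ?M l q))"
    unfolding sum_distrib_right
    by (intro sum.cong refl sum.mono_neutral_cong_right) auto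
  also have "\<dots> = (\<Sum>q\<in>?P. overlap N m (inv p \<circ> q) * \<phi> (compose ?M l q))"
    using gamK by simp
  finally show ?thesis .
qed

lemma sum_harm_kernel_harmonic:
  assumes N: "finite N" and h: "harmonic {..<m} N \<phi>" and l: "l \<in> injs {..<m} N"
  shows "(\<Sum>l'\<in>injs {..<m} N. harm_kernel N m a l l' * \<phi> l')
       = (\<Sum>q | q permutes {..<m}. (\<Sum>p | p permutes {..<m}. a p * overlap N m (inv p \<circ> q)) * \<phi> (compose {..<m} l q))"
proof -
  let ?M = "{..<m}" and ?P = "{q. q permutes {..<m}}"
  have "(\<Sum>l'\<in>injs ?M N. harm_kernel N m a l l' * \<phi> l')
      = (\<Sum>l'\<in>injs ?M N. \<Sum>p\<in>?P. if \<forall>x\<in>?M. l' x = l (p x) \<or> l' x \<notin> l ` ?M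
          then a p * (swap_wt N m (card {x\<in>?M. l' x \<notin> l ` ?M}) * \<phi> l') else 0)"
    unfolding harm_kernel_def sum_distrib_right
    by (intro sum.cong refl sum.mono_neutral_cong_left) (auto simp: finite_permutations)
  also have "\<dots> = (\<Sum>p\<in>?P. \<Sum>l'\<in>injs ?M N. if \<forall>x\<in>?M. l' x = l (p x) \<or> l' x \<notin> l ` ?M
          then a p * (swap_wt N m (card {x\<in>?M. l' x \<notin> l ` ?M}) * \<phi> l') else 0)"
    by (rule sum.swap)
  also have "\<dots> = (\<Sum>p\<in>?P. a p * (\<Sum>f | f \<in> injs ?M N \<and> (\<forall>x\<in>?M. f x = l (p x) \<or> f x \<notin> l ` ?M).
            swap_wt N m (card {x\<in>?M. f x \<notin> l ` ?M}) * \<phi> f))"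
    unfolding sum_distrib_left
    by (intro sum.cong refl sum.mono_neutral_cong_right) (use N in auto)
  also have "\<dots> = (\<Sum>p\<in>?P. a p * (\<Sum>q\<in>?P. overlap N m (inv p \<circ> q) * \<phi> (compose ?M l q)))"
    using sum_agree_overlap[OF N h l] by simp
  also have "\<dots> = (\<Sum>p\<in>?P. \<Sum>q\<in>?P. a p * overlap N m (inv p \<circ> q) * \<phi> (compose ?M l q))"
    by (simp add: sum_distrib_left mult.assoc)
  also have "\<dots> = (\<Sum>q\<in>?P. \<Sum>p\<in>?P. a p * overlap N m (inv p \<circ> q) * \<phi> (compose ?M l q))"
    by (rule sum.swap)
  finally show ?thesis by (simp add: sum_distrib_right)
qed

lemma coset_sum_compose:
  assumes p: "p permutes I"
  shows "coset_sum N f I (compose I l p) (compose I k p) = coset_sum N f I l k"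
proof -
  have "(\<forall>x\<in>I. s (compose I l p x) = compose I k p x) \<longleftrightarrow> (\<forall>x\<in>I. s (l x) = k x)" for s
  proof -
    have "(\<forall>x\<in>I. s (compose I l p x) = compose I k p x) \<longleftrightarrow> (\<forall>x\<in>I. s (l (p x)) = k (p x))"
      by (simp add: compose_def)
    also have "\<dots> \<longleftrightarrow> (\<forall>y\<in>p ` I. s (l y) = k y)" by blast
    finally show ?thesis unfolding permutes_image[OF p] .
  qed
  then show ?thesis unfolding coset_sum_def by simp
qed

lemma coset_sum_compose_shift:
  assumes p: "p permutes I" and l: "l \<in> extensional I" and r: "r permutes I"
  shows "coset_sum N f I (compose I l r) (compose I k p) = coset_sum N f I (compose I l (r \<circ> inv p)) k"
proof -
  have e: "compose I (compose I l (r \<circ> inv p)) p = compose I l r"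
  proof (rule injs_eqI[where J = I])
    fix x assume x: "x \<in> I"
    then have "p x \<in> I" using permutes_in_image[OF p] by simp
    then show "compose I (compose I l (r \<circ> inv p)) p x = compose I l r x"
      using x permutes_inverses(2)[OF p] by (simp add: compose_def)
  qed (auto simp: compose_def)
  show ?thesis using coset_sum_compose[OF p, of N f "compose I l (r \<circ> inv p)" k] unfolding e by simp
qed

text \<open>The heart of the projection property. Coset sums are harmonic in both arguments, so the swap rule
applies three times: to the points, where it turns the kernel into a convolution with \<open>overlap\<close>; to
the images along the coset; and to the points again, where a second factor \<open>overlap\<close> appears.
The two factors cancel the two factors of \<open>stratum_coeff\<close>.\<close>

lemma coset_sum_stratum_op:
  fixes N :: "'a set"
  assumes N: "finite N" and m: "2 * m \<le> card N" and f: "m = 0 \<or> orth_degree N (m - 1) f"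
    and l: "l \<in> injs {..<m} N" and k: "k \<in> injs {..<m} N"
  shows "coset_sum N (stratum_op N m (stratum_coeff N m) f) {..<m} l k = coset_sum N f {..<m} l k"
proof -
  let ?M = "{..<m}" and ?P = "{q. q permutes {..<m}}" and ?I = "injs {..<m} N"
  let ?F = "\<lambda>l k. coset_sum N f {..<m} l k"
  let ?H = "\<lambda>i r. coset_sum N f {..<m} (compose {..<m} i r) k"
  let ?S = "{s. s permutes N \<and> (\<forall>x\<in>?M. s (l x) = k x)}"
  let ?C = "\<lambda>f t. \<forall>x\<in>?M. f x = l (t x) \<or> f x \<notin> l ` ?M"
  let ?w = "\<lambda>f. swap_wt N m (card {x\<in>?M. f x \<notin> l ` ?M})"
  define h where "h q = harm_char N m q / (fact (card N) * fact m)" for q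
  have finP: "finite ?P" by (simp add: finite_permutations)
  note F1 = harmonic_coset_sum(1)[OF N f] and F2 = harmonic_coset_sum(2)[OF N f]
  \<comment> \<open>The swap in the points turns the kernel into the coefficients \<open>h\<close>.\<close>
  have Af: "stratum_op N m (stratum_coeff N m) f s = (\<Sum>i\<in>?I. \<Sum>q\<in>?P. h q * ?F (compose ?M i q) (compose ?M s i))"
    if s: "s permutes N" for s
    unfolding stratum_op_alt[OF N s]
  proof (rule sum.cong[OF refl])
    fix i assume i: "i \<in> ?I"
    have "(\<Sum>l'\<in>?I. harm_kernel N m (stratum_coeff N m) i l' * ?F l' (compose ?M s i))
        = (\<Sum>q\<in>?P. (\<Sum>p\<in>?P. stratum_coeff N m p * overlap N m (inv p \<circ> q)) * ?F (compose ?M i q) (compose ?M s i))"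
      by (rule sum_harm_kernel_harmonic[OF N F1[OF compose_perm_injs[OF i s]] i])
    also have "\<dots> = (\<Sum>q\<in>?P. h q * ?F (compose ?M i q) (compose ?M s i))"
      by (rule sum.cong) (simp_all add: stratum_coeff_overlap[OF m] h_def)
    finally show "(\<Sum>l'\<in>?I. harm_kernel N m (stratum_coeff N m) i l' * ?F l' (compose ?M s i)) = \<dots>" .
  qed
  have "coset_sum N (stratum_op N m (stratum_coeff N m) f) ?M l k = (\<Sum>s\<in>?S. \<Sum>i\<in>?I. \<Sum>q\<in>?P. h q * ?F (compose ?M i q) (compose ?M s i))"
    unfolding coset_sum_def[of N "stratum_op N m (stratum_coeff N m) f"] using Af by (intro sum.cong) auto
  also have "\<dots> = (\<Sum>i\<in>?I. \<Sum>q\<in>?P. h q * (\<Sum>s\<in>?S. ?F (compose ?M i q) (compose ?M s i)))"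
    by (subst sum.swap, intro sum.cong refl, subst sum.swap) (simp add: sum_distrib_left)
  \<comment> \<open>The swap in the images creates a permutation \<open>t\<close> of the indices, which is carried over to the points.\<close>
  also have "\<dots> = (\<Sum>i\<in>?I. \<Sum>q\<in>?P. h q * (fact (card N - m) *
        (\<Sum>t | t permutes ?M \<and> ?C i t. ?w i * ?H i (q \<circ> inv t))))"
  proof (intro sum.cong refl)
    fix i q assume i: "i \<in> ?I" and "q \<in> ?P"
    then have q: "q permutes ?M" by simp
    let ?j = "card {x\<in>?M. i x \<notin> l ` ?M}"
    have iq: "compose ?M i q \<in> ?I" by (rule compose_in_injs[OF i q])
    have "(\<Sum>s\<in>?S. ?F (compose ?M i q) (compose ?M s i))
        = fact (card N - card ?M - ?j) * ((- 1) ^ ?j *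
           (\<Sum>t | t permutes ?M \<and> ?C i t. ?F (compose ?M i q) (compose ?M k t)))"
      by (rule sum_permutes_coset_equal[OF N finite_lessThan l k i F2[OF iq]])
    also have "\<dots> = fact (card N - m) * (\<Sum>t | t permutes ?M \<and> ?C i t. ?w i * ?F (compose ?M i q) (compose ?M k t))"
      unfolding sum_distrib_left[symmetric] by (simp add: swap_wt_def)
    also have "(\<Sum>t | t permutes ?M \<and> ?C i t. ?w i * ?F (compose ?M i q) (compose ?M k t))
        = (\<Sum>t | t permutes ?M \<and> ?C i t. ?w i * ?H i (q \<circ> inv t))"
      by (rule sum.cong) (auto simp: coset_sum_compose_shift[OF _ injsD(3)[OF i] q])
    finally show "h q * (\<Sum>s\<in>?S. ?F (compose ?M i q) (compose ?M s i))
        = h q * (fact (card N - m) * (\<Sum>t | t permutes ?M \<and> ?C i t. ?w i * ?H i (q \<circ> inv t)))" by simp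
  qed
  also have "\<dots> = fact (card N - m) * (\<Sum>i\<in>?I. \<Sum>q\<in>?P. \<Sum>t\<in>?P.
        h q * (if ?C i t then ?w i * ?H i (q \<circ> inv t) else 0))"
    unfolding sum_distrib_left
    by (intro sum.cong refl sum.mono_neutral_cong_left) (auto simp: finite_permutations)
  also have "(\<Sum>i\<in>?I. \<Sum>q\<in>?P. \<Sum>t\<in>?P. h q * (if ?C i t then ?w i * ?H i (q \<circ> inv t) else 0))
      = (\<Sum>q\<in>?P. \<Sum>t\<in>?P. \<Sum>i\<in>?I. h q * (if ?C i t then ?w i * ?H i (q \<circ> inv t) else 0))"
    by (subst sum.swap, intro sum.cong refl, subst sum.swap) simp
  \<comment> \<open>Read as a sum over \<open>i\<close>, this is again a sum over injections that agree with a rearrangement of \<open>l\<close>.\<close>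
  also have "\<dots> = (\<Sum>q\<in>?P. \<Sum>t\<in>?P. h q * (\<Sum>b\<in>?P. overlap N m b * ?H l (t \<circ> b \<circ> q \<circ> inv t)))"
  proof (intro sum.cong refl)
    fix q t assume "q \<in> ?P" "t \<in> ?P"
    then have q: "q permutes ?M" and t: "t permutes ?M" by auto
    have r: "q \<circ> inv t permutes ?M" by (rule permutes_compose[OF permutes_inv[OF t] q])
    have "(\<Sum>i\<in>?I. h q * (if ?C i t then ?w i * ?H i (q \<circ> inv t) else 0))
        = h q * (\<Sum>i | i \<in> ?I \<and> ?C i t. ?w i * ?H i (q \<circ> inv t))"
      unfolding sum_distrib_left by (rule sum.mono_neutral_cong_right) (use N in auto)
    also have "(\<Sum>i | i \<in> ?I \<and> ?C i t. ?w i * ?H i (q \<circ> inv t))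
        = (\<Sum>b\<in>?P. overlap N m (inv t \<circ> b) * ?F (compose ?M (compose ?M l b) (q \<circ> inv t)) k)"
      by (rule sum_agree_overlap[OF N harmonic_compose_index[OF finite_lessThan F1[OF k] r] l t])
    also have "\<dots> = (\<Sum>b\<in>?P. overlap N m (inv t \<circ> (t \<circ> b)) * ?F (compose ?M (compose ?M l (t \<circ> b)) (q \<circ> inv t)) k)"
      by (rule setum_permutations_compose_left[OF t])
    also have "\<dots> = (\<Sum>b\<in>?P. overlap N m b * ?H l (t \<circ> b \<circ> q \<circ> inv t))"
    proof (rule sum.cong[OF refl])
      fix b assume "b \<in> ?P"
      have "inv t \<circ> (t \<circ> b) = b" using permutes_inv_o(2)[OF t] by (simp add: comp_assoc[symmetric])
      moreover have "compose ?M (compose ?M l (t \<circ> b)) (q \<circ> inv t) = compose ?M l (t \<circ> b \<circ> q \<circ> inv t)"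
        by (rule injs_eqI[where J = ?M]) (use permutes_in_image[OF r] in \<open>auto simp: compose_def\<close>)
      ultimately show "overlap N m (inv t \<circ> (t \<circ> b)) * ?F (compose ?M (compose ?M l (t \<circ> b)) (q \<circ> inv t)) k
          = overlap N m b * ?H l (t \<circ> b \<circ> q \<circ> inv t)" by simp
    qed
    finally show "(\<Sum>i\<in>?I. h q * (if ?C i t then ?w i * ?H i (q \<circ> inv t) else 0))
        = h q * (\<Sum>b\<in>?P. overlap N m b * ?H l (t \<circ> b \<circ> q \<circ> inv t))" .
  qed
  also have "\<dots> = (\<Sum>t\<in>?P. \<Sum>b\<in>?P. \<Sum>q\<in>?P. overlap N m b * h q * ?H l (t \<circ> b \<circ> q \<circ> inv t))"
    unfolding sum_distrib_left
    by (rule trans[OF sum.swap], rule sum.cong[OF refl], rule trans[OF sum.swap]) (simp add: mult_ac)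
  \<comment> \<open>The convolution over \<open>b\<close> leaves \<open>q = id\<close>, where conjugation by \<open>t\<close> has no effect.\<close>
  also have "\<dots> = (\<Sum>t\<in>?P. ?F l k * (fact (card N) / fact (card N - m) / (fact (card N) * fact m)))"
  proof (rule sum.cong[OF refl])
    fix t assume "t \<in> ?P"
    then have t: "t permutes ?M" by simp
    have "(\<Sum>b\<in>?P. \<Sum>q\<in>?P. overlap N m b * h q * ?H l (t \<circ> b \<circ> q \<circ> inv t))
        = (\<Sum>b\<in>?P. \<Sum>q\<in>?P. overlap N m b * h (inv b \<circ> q) * ?H l (t \<circ> q \<circ> inv t))"
    proof (rule sum.cong[OF refl])
      fix b assume "b \<in> ?P"
      then have b: "b permutes ?M" by simp
      have "(\<Sum>q\<in>?P. overlap N m b * h q * ?H l (t \<circ> b \<circ> q \<circ> inv t))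
          = (\<Sum>q\<in>?P. overlap N m b * h (inv b \<circ> q) * ?H l (t \<circ> b \<circ> (inv b \<circ> q) \<circ> inv t))"
        by (rule setum_permutations_compose_left[OF permutes_inv[OF b]])
      moreover have "t \<circ> b \<circ> (inv b \<circ> q) = t \<circ> q" for q :: "nat \<Rightarrow> nat"
        using permutes_inverses(1)[OF b] by (simp add: fun_eq_iff)
      ultimately show "(\<Sum>q\<in>?P. overlap N m b * h q * ?H l (t \<circ> b \<circ> q \<circ> inv t))
          = (\<Sum>q\<in>?P. overlap N m b * h (inv b \<circ> q) * ?H l (t \<circ> q \<circ> inv t))" by (simp only:)
    qed
    also have "\<dots> = (\<Sum>q\<in>?P. (\<Sum>b\<in>?P. overlap N m b * h (inv b \<circ> q)) * ?H l (t \<circ> q \<circ> inv t))"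
      by (subst sum.swap) (simp add: sum_distrib_right)
    also have "\<dots> = (\<Sum>q\<in>?P. if q = id then ?F l k * (fact (card N) / fact (card N - m) / (fact (card N) * fact m)) else 0)"
    proof (rule sum.cong[OF refl])
      fix q assume "q \<in> ?P"
      then have q: "q permutes ?M" by simp
      have "(\<Sum>b\<in>?P. overlap N m b * h (inv b \<circ> q)) = (\<Sum>b\<in>?P. overlap N m b * harm_char N m (inv b \<circ> q)) / (fact (card N) * fact m)"
        unfolding h_def by (simp add: sum_divide_distrib)
      also have "\<dots> = (if q = id then fact (card N) / fact (card N - m) else 0) / (fact (card N) * fact m)"
        unfolding overlap_harm_char[OF m q] ..
      finally have e: "(\<Sum>b\<in>?P. overlap N m b * h (inv b \<circ> q)) = \<dots>" .
      have "compose ?M l (t \<circ> id \<circ> inv t) = l"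
        by (rule injs_eqI[where J = ?M]) (use injsD(3)[OF l] permutes_inverses(1)[OF t] in \<open>auto simp: compose_def\<close>)
      then show "(\<Sum>b\<in>?P. overlap N m b * h (inv b \<circ> q)) * ?H l (t \<circ> q \<circ> inv t)
          = (if q = id then ?F l k * (fact (card N) / fact (card N - m) / (fact (card N) * fact m)) else 0)"
        unfolding e by (cases "q = id") (simp_all only: if_True if_False refl, simp_all)
    qed
    also have "\<dots> = ?F l k * (fact (card N) / fact (card N - m) / (fact (card N) * fact m))"
      using finP permutes_id by (subst sum.delta) auto
    finally show "(\<Sum>b\<in>?P. \<Sum>q\<in>?P. overlap N m b * h q * ?H l (t \<circ> b \<circ> q \<circ> inv t)) = \<dots>" .
  qed
  also have "\<dots> = ?F l k / fact (card N - m)"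
    using card_permutations[OF _ finite_lessThan, of m] by simp
  finally show ?thesis by simp
qed

text \<open>The difference of both sides has degree at most \<open>m\<close> and vanishing coset sums, hence is orthogonal
to itself.\<close>

lemma stratum_op_fixed:
  assumes N: "finite N" and m: "2 * m \<le> card N" and f: "m = 0 \<or> orth_degree N (m - 1) f" and degree_le: "degree_le N m f"
    and s: "s permutes N"
  shows "stratum_op N m (stratum_coeff N m) f s = f s"
proof -
  let ?d = "\<lambda>s. f s - stratum_op N m (stratum_coeff N m) f s"
  have "coset_sum N ?d {..<m} l k = 0" if "l \<in> injs {..<m} N" "k \<in> injs {..<m} N" for l k
    using coset_sum_stratum_op[OF N m f that] unfolding coset_sum_def by (simp add: sum_subtractf)
  then have "(\<Sum>s | s permutes N. ?d s * ?d s) = 0"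
    by (intro inner_degree_le_coset_sum[OF N degree_le_diff[OF degree_le degree_le_stratum_op[OF N]]])
  then have "\<forall>s\<in>{s. s permutes N}. ?d s * ?d s = 0"
    by (subst (asm) sum_nonneg_eq_0_iff) (use finite_permutations[OF N] in auto)
  then show ?thesis using s by simp
qed

section \<open>The projection onto functions of bounded degree and its trace\<close>

definition degree_op :: "'a set \<Rightarrow> nat \<Rightarrow> (('a \<Rightarrow> 'a) \<Rightarrow> real) \<Rightarrow> ('a \<Rightarrow> 'a) \<Rightarrow> real" where
  "degree_op N m f s = (\<Sum>q\<le>m. stratum_op N q (stratum_coeff N q) f s)"

lemma degree_le_coset:
  assumes I: "finite I" "card I = m" and l: "l \<in> injs I N" and k: "k \<in> injs I N" and N: "finite N"
  shows "degree_le N m (\<lambda>s. if \<forall>x\<in>I. s (l x) = k x then 1 else 0)"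
proof -
  obtain b where b: "bij_betw b {..<m} I"
    using ex_bij_betw_nat_finite[OF I(1)] I(2) by (auto simp: lessThan_atLeast0)
  have bI: "b i \<in> I" if "i < m" for i using b that by (auto simp: bij_betw_def)
  have r: "restrict (f \<circ> b) {..<m} \<in> injs {..<m} N" if f: "f \<in> injs I N" for f
    using b bI injsD(2)[OF f] comp_inj_on[of b "{..<m}" f] injsD(1)[OF f]
    by (auto simp: injs_def bij_betw_def)
  let ?l = "restrict (l \<circ> b) {..<m}" and ?k = "restrict (k \<circ> b) {..<m}"
  show ?thesis
  proof (rule degree_leI[where c = "\<lambda>l' k'. if l' = ?l then if k' = ?k then 1 else 0 else 0"])
    fix s assume "s permutes N"
    have "compose {..<m} s ?l = ?k \<longleftrightarrow> (\<forall>i<m. s (l (b i)) = k (b i))"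
      by (auto simp: compose_def fun_eq_iff restrict_def)
    also have "\<dots> \<longleftrightarrow> (\<forall>x\<in>b ` {..<m}. s (l x) = k x)" by auto
    also have "b ` {..<m} = I" using b by (simp add: bij_betw_def)
    finally have e: "compose {..<m} s ?l = ?k \<longleftrightarrow> (\<forall>x\<in>I. s (l x) = k x)" .
    have "(\<Sum>l'\<in>injs {..<m} N. if l' = ?l then if compose {..<m} s l' = ?k then 1 else 0 else (0::real))
        = (if compose {..<m} s ?l = ?k then 1 else 0)"
      using r[OF l] N by (subst sum.delta) auto
    then show "(if \<forall>x\<in>I. s (l x) = k x then 1 else 0)
        = (\<Sum>l'\<in>injs {..<m} N. if l' = ?l then if compose {..<m} s l' = ?k then 1 else 0 else (0::real))"
      unfolding e by simp
  qed
qed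

lemma coset_sum_inner:
  assumes N: "finite N"
  shows "coset_sum N f I l k = (\<Sum>s | s permutes N. (if \<forall>x\<in>I. s (l x) = k x then 1 else 0) * f s)"
  unfolding coset_sum_def by (rule sum.mono_neutral_cong_left) (auto simp: finite_permutations[OF N])

lemma degree_le_degree_op:
  assumes N: "finite N" and m: "m \<le> card N"
  shows "degree_le N m (degree_op N m f)"
  using m
proof (induction m)
  case 0
  show ?case using degree_le_stratum_op[OF N, of 0 "stratum_coeff N 0" f] by (simp add: degree_op_def[abs_def])
next
  case (Suc m)
  have "degree_le N (Suc m) (\<lambda>s. degree_op N m f s + stratum_op N (Suc m) (stratum_coeff N (Suc m)) f s)"
    by (rule degree_le_add[OF degree_le_Suc[OF N] degree_le_stratum_op[OF N]]) (use Suc in auto)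
  then show ?case by (simp add: degree_op_def[abs_def])
qed

lemma stratum_op_diff:
  "stratum_op N m a (\<lambda>s. f s - g s) s = stratum_op N m a f s - stratum_op N m a g s"
  unfolding stratum_op_def by (simp add: algebra_simps sum_subtractf)

lemma degree_op_adjoint:
  "(\<Sum>s | s permutes N. f s * degree_op N m g s) = (\<Sum>s | s permutes N. degree_op N m f s * g s)"
proof -
  have "(\<Sum>s | s permutes N. f s * degree_op N m g s) = (\<Sum>q\<le>m. \<Sum>s | s permutes N. f s * stratum_op N q (stratum_coeff N q) g s)"
    unfolding degree_op_def sum_distrib_left by (rule sum.swap)
  also have "\<dots> = (\<Sum>q\<le>m. \<Sum>s | s permutes N. stratum_op N q (stratum_coeff N q) f s * g s)"
    by (intro sum.cong refl stratum_op_adjoint stratum_coeff_inv)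
  also have "\<dots> = (\<Sum>s | s permutes N. degree_op N m f s * g s)"
    unfolding degree_op_def sum_distrib_right by (rule sum.swap)
  finally show ?thesis .
qed

text \<open>By induction and self-adjointness, \<open>f\<close> minus its projection to degree at most \<open>m\<close> is
orthogonal to that space, so it lies in the next stratum and is fixed by the next summand,
which in turn kills the projection.\<close>

lemma degree_op_degree_le:
  assumes N: "finite N" and m: "2 * m \<le> card N" and f: "degree_le N m f" and s: "s permutes N"
  shows "degree_op N m f s = f s"
  using m f s
proof (induction m arbitrary: f s)
  case 0
  then show ?case unfolding degree_op_def using stratum_op_fixed[OF N, of 0 f s] by simp
next
  case (Suc m)
  let ?g = "\<lambda>s. f s - degree_op N m f s" and ?A = "stratum_op N (Suc m) (stratum_coeff N (Suc m))"
  have m: "2 * m \<le> card N" "m \<le> card N" "m < card N" using Suc.prems(1) by auto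
  have lowZ: "degree_le N m (degree_op N m f)" by (rule degree_le_degree_op[OF N m(2)])
  have orth_degree: "orth_degree N m ?g"
    unfolding orth_degree_def
  proof (intro allI impI)
    fix I :: "nat set" and l k
    assume I: "finite I" "card I = m" and l: "l \<in> injs I N" and k: "k \<in> injs I N"
    let ?d = "\<lambda>s. if \<forall>x\<in>I. s (l x) = k x then 1 else (0::real)"
    have "(\<Sum>s | s permutes N. ?d s * degree_op N m f s) = (\<Sum>s | s permutes N. degree_op N m ?d s * f s)"
      by (rule degree_op_adjoint)
    also have "\<dots> = (\<Sum>s | s permutes N. ?d s * f s)"
      using Suc.IH[OF m(1) degree_le_coset[OF I l k N]] by (intro sum.cong) auto
    finally show "coset_sum N ?g I l k = 0"
      unfolding coset_sum_inner[OF N] by (simp add: right_diff_distrib sum_subtractf)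
  qed
  have lowg: "degree_le N (Suc m) ?g"
    by (rule degree_le_diff[OF Suc.prems(2) degree_le_Suc[OF N m(3) lowZ]])
  have "?A ?g s = ?g s"
    by (rule stratum_op_fixed[OF N Suc.prems(1) _ lowg Suc.prems(3)]) (use orth_degree in simp)
  moreover have "?A (degree_op N m f) s = 0"
    by (rule stratum_op_degree_le_zero[OF N Suc.prems(1) _ lowZ _ Suc.prems(3)]) (auto intro: stratum_coeff_inv)
  ultimately have "?A f s = ?g s"
    using stratum_op_diff[of N "Suc m" "stratum_coeff N (Suc m)" f "degree_op N m f" s] by simp
  then show ?case by (simp add: degree_op_def)
qed

lemma degree_op_orth_degree:
  assumes N: "finite N" and m: "m \<le> card N" and f: "orth_degree N m f" and s: "s permutes N"
  shows "degree_op N m f s = 0"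
  unfolding degree_op_def
proof (rule sum.neutral, rule ballI)
  fix q assume "q \<in> {..m}"
  then have "orth_degree N q f" using orth_degree_mono[OF N f _ m, of q] by simp
  then show "stratum_op N q (stratum_coeff N q) f s = 0" by (rule stratum_op_orth_degree_zero[OF N _ s])
qed

lemma card_injs:
  assumes N: "finite N" and m: "m \<le> card N"
  shows "real (card (injs {..<m} N)) = fact (card N) / fact (card N - m)"
  using m
proof (induction m)
  case 0
  then show ?case by simp
next
  case (Suc m)
  have "real (card (injs {..<Suc m} N)) = (\<Sum>f\<in>injs (insert m {..<m}) N. 1)"
    by (simp add: lessThan_Suc)
  also have "\<dots> = (\<Sum>f\<in>injs {..<m} N. \<Sum>v\<in>N - f ` {..<m}. 1)"
    by (rule sum_injs_insert') (use N in auto)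
  also have "\<dots> = (\<Sum>f\<in>injs {..<m} N. real (card N - m))"
  proof (rule sum.cong[OF refl])
    fix f assume f: "f \<in> injs {..<m} N"
    have "card (N - f ` {..<m}) = card N - m"
      using injsD(1,2)[OF f] N by (simp add: card_Diff_subset card_image)
    then show "(\<Sum>v\<in>N - f ` {..<m}. 1) = real (card N - m)" by simp
  qed
  also have "\<dots> = real (card N - m) * (fact (card N) / fact (card N - m))"
    using Suc by simp
  also have "\<dots> = fact (card N) / fact (card N - Suc m)"
  proof -
    obtain q where q: "card N - m = Suc q" using Suc.prems by (cases "card N - m") auto
    then have q': "card N - Suc m = q" by simp
    show ?thesis unfolding q q' by (simp del: of_nat_Suc)
  qed
  finally show ?case .
qed

definition stratum_dim :: "'a set \<Rightarrow> nat \<Rightarrow> real" where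
  "stratum_dim N m = (\<Sum>t | t permutes {..<m}. harm_char N m t ^ 2) / fact m"

lemma trace_stratum_kernel:
  assumes N: "finite N" and m: "m \<le> card N"
  shows "(\<Sum>s | s permutes N. stratum_kernel N m (stratum_coeff N m) s s) = stratum_dim N m"
proof -
  let ?M = "{..<m}" and ?a = "stratum_coeff N m"
  have hk: "harm_kernel N m ?a l l = ?a id" if l: "l \<in> injs ?M N" for l
  proof -
    have "p = id" if p: "p permutes ?M" "\<forall>x\<in>?M. l x = l (p x) \<or> l x \<notin> l ` ?M" for p
    proof
      fix x show "p x = id x"
      proof (cases "x \<in> ?M")
        case True
        then have "l x = l (p x)" using p(2) by blast
        then show ?thesis using inj_onD[OF injsD(1)[OF l]] True permutes_in_image[OF p(1), of x] by force
      next
        case False then show ?thesis using permutes_not_in[OF p(1)] by simp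
      qed
    qed
    then have "{p. p permutes ?M \<and> (\<forall>x\<in>?M. l x = l (p x) \<or> l x \<notin> l ` ?M)} = {id}"
      using permutes_id by auto
    moreover have "{x\<in>?M. l x \<notin> l ` ?M} = {}" by auto
    then have "swap_wt N m (card {x\<in>?M. l x \<notin> l ` ?M}) = 1" by (simp only: swap_wt_def card.empty) simp
    ultimately show ?thesis unfolding harm_kernel_def by simp
  qed
  have "stratum_kernel N m ?a s s = fact (card N) / fact (card N - m) * ?a id" if s: "s permutes N" for s
  proof -
    have "stratum_kernel N m ?a s s = (\<Sum>l\<in>injs ?M N. harm_kernel N m ?a l (compose ?M id l))"
      unfolding stratum_kernel_def permutes_inv_o(2)[OF s] ..
    also have "\<dots> = (\<Sum>l\<in>injs ?M N. ?a id)"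
    proof (rule sum.cong[OF refl])
      fix l assume l: "l \<in> injs ?M N"
      have "compose ?M id l = l"
        by (rule injs_eqI[where J = ?M]) (use injsD(3)[OF l] in \<open>auto simp: compose_def\<close>)
      then show "harm_kernel N m ?a l (compose ?M id l) = ?a id" using hk[OF l] by simp
    qed
    finally show ?thesis using card_injs[OF N m] by simp
  qed
  then have "(\<Sum>s | s permutes N. stratum_kernel N m ?a s s) = fact (card N) * (fact (card N) / fact (card N - m) * ?a id)"
    using card_permutations[OF refl N] by simp
  moreover have "?a id = fact (card N - m) / (fact (card N) ^ 2 * fact m) * (\<Sum>t | t permutes ?M. harm_char N m t ^ 2)"
    unfolding stratum_coeff_def by (auto simp: harm_char_inv power2_eq_square)
  ultimately show ?thesis unfolding stratum_dim_def by (simp add: power2_eq_square)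
qed

section \<open>Counting a basis by a trace\<close>

text \<open>In the basis \<open>h\<close> the operator is diagonal with an entry 1 for each element of \<open>E\<close>, and the trace
does not depend on the basis.\<close>

lemma trace_of_projection:
  fixes h :: "'x \<Rightarrow> 'x \<Rightarrow> real" and Z :: "'x \<Rightarrow> 'x \<Rightarrow> real"
  assumes X: "finite X" and E: "E \<subseteq> X"
    and indep: "\<And>c. (\<And>x. x \<in> X \<Longrightarrow> (\<Sum>b\<in>X. c b * h b x) = 0) \<Longrightarrow> (\<forall>b\<in>X. c b = 0)"
    and Z: "\<And>b x. b \<in> X \<Longrightarrow> x \<in> X \<Longrightarrow> (\<Sum>y\<in>X. Z y x * h b y) = (if b \<in> E then h b x else 0)"
  shows "(\<Sum>x\<in>X. Z x x) = card E"
proof -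
  define n where "n = card X"
  obtain e where e: "bij_betw e {0..<n} X"
    using ex_bij_betw_nat_finite[OF X] unfolding n_def by blast
  have eX: "e i \<in> X" if "i < n" for i using e that by (auto simp: bij_betw_def)
  have sumX: "(\<Sum>x\<in>X. g x) = (\<Sum>i = 0..<n. g (e i))" for g :: "'x \<Rightarrow> real"
    by (rule sum.reindex_bij_betw[OF e, symmetric])
  define H where "H = mat n n (\<lambda>(i, j). h (e j) (e i))"
  have H: "H \<in> carrier_mat n n" by (simp add: H_def)
  have "det H \<noteq> 0"
  proof
    assume "det H = 0"
    then obtain v where v: "v \<in> carrier_vec n" "v \<noteq> 0\<^sub>v n" "H *\<^sub>v v = 0\<^sub>v n"
      using det_0_iff_vec_prod_zero_field[OF H] by auto
    define c where "c b = v $ (inv_into {0..<n} e b)" for b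
    have ce: "c (e j) = v $ j" if "j < n" for j
      using that e by (simp add: c_def bij_betw_def)
    have "(\<Sum>b\<in>X. c b * h b x) = 0" if x: "x \<in> X" for x
    proof -
      obtain i where i: "i < n" "x = e i" using e x by (auto simp: bij_betw_def)
      have "(\<Sum>b\<in>X. c b * h b x) = (\<Sum>j = 0..<n. h (e j) (e i) * v $ j)"
        unfolding sumX i(2) by (rule sum.cong) (simp_all add: ce)
      also have "\<dots> = (H *\<^sub>v v) $ i"
        using i v(1) by (simp add: H_def scalar_prod_def)
      finally show ?thesis using v(3) i by simp
    qed
    then have c0: "\<forall>b\<in>X. c b = 0" by (rule indep)
    have "v = 0\<^sub>v n"
      by (rule eq_vecI) (use v(1) c0 eX ce in auto)
    then show False using v(2) by simp
  qed
  then have "H \<in> Units (ring_mat TYPE(real) n ())"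
    by (rule det_non_zero_imp_unit[OF H])
  then obtain B where B: "B \<in> carrier_mat n n" "B * H = 1\<^sub>m n" "H * B = 1\<^sub>m n"
    unfolding Units_def ring_mat_def by auto
  have BH: "(\<Sum>i = 0..<n. B $$ (j, i) * h (e k) (e i)) = (if j = k then 1 else 0)" if "j < n" "k < n" for j k
  proof -
    have "(B * H) $$ (j, k) = (\<Sum>i = 0..<n. B $$ (j, i) * h (e k) (e i))"
      using that B(1) by (simp add: H_def scalar_prod_def)
    then show ?thesis using that B(2) by simp
  qed
  have HB: "(\<Sum>k = 0..<n. h (e k) (e i) * B $$ (k, j)) = (if i = j then 1 else 0)" if "i < n" "j < n" for i j
  proof -
    have "(H * B) $$ (i, j) = (\<Sum>k = 0..<n. h (e k) (e i) * B $$ (k, j))"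
      using that B(1) by (simp add: H_def scalar_prod_def)
    then show ?thesis using that B(3) by simp
  qed
  have Zij: "Z (e j) (e i) = (\<Sum>k = 0..<n. (if e k \<in> E then h (e k) (e i) else 0) * B $$ (k, j))"
    if i: "i < n" and j: "j < n" for i j
  proof -
    have "(\<Sum>k = 0..<n. (if e k \<in> E then h (e k) (e i) else 0) * B $$ (k, j))
        = (\<Sum>k = 0..<n. (\<Sum>l = 0..<n. Z (e l) (e i) * h (e k) (e l)) * B $$ (k, j))"
      by (rule sum.cong) (use Z[OF eX eX[OF i]] sumX in auto)
    also have "\<dots> = (\<Sum>l = 0..<n. Z (e l) (e i) * (\<Sum>k = 0..<n. h (e k) (e l) * B $$ (k, j)))"
      by (simp add: sum_distrib_left sum_distrib_right mult.assoc) (rule sum.swap)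
    also have "\<dots> = (\<Sum>l = 0..<n. if l = j then Z (e l) (e i) else 0)"
      by (rule sum.cong) (use HB j in auto)
    finally show ?thesis using j by simp
  qed
  have "(\<Sum>x\<in>X. Z x x) = (\<Sum>i = 0..<n. \<Sum>k = 0..<n. (if e k \<in> E then h (e k) (e i) else 0) * B $$ (k, i))"
    unfolding sumX by (rule sum.cong) (simp_all add: Zij)
  also have "\<dots> = (\<Sum>k = 0..<n. if e k \<in> E then \<Sum>i = 0..<n. B $$ (k, i) * h (e k) (e i) else 0)"
    by (subst sum.swap) (auto intro!: sum.cong simp: mult.commute)
  also have "\<dots> = (\<Sum>k = 0..<n. if e k \<in> E then 1 else 0)"
    by (rule sum.cong) (use BH in auto)
  also have "\<dots> = (\<Sum>x\<in>X. if x \<in> E then 1 else 0)" unfolding sumX ..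
  also have "\<dots> = real (card E)" using X E by (simp add: sum.If_cases Int_absorb1)
  finally show ?thesis .
qed

lemma triangular_indep:
  fixes h :: "'x \<Rightarrow> 'x \<Rightarrow> real" and key :: "'x \<Rightarrow> int"
  assumes X: "finite X" and diag: "\<And>b. b \<in> X \<Longrightarrow> h b b \<noteq> 0"
    and tri: "\<And>b x. b \<in> X \<Longrightarrow> x \<in> X \<Longrightarrow> h b x \<noteq> 0 \<Longrightarrow> x \<noteq> b \<Longrightarrow> key b < key x"
    and zero: "\<And>x. x \<in> X \<Longrightarrow> (\<Sum>b\<in>X. c b * h b x) = 0" and b: "b \<in> X"
  shows "c b = 0"
proof (rule ccontr)
  assume "c b \<noteq> 0"
  define S where "S = {b\<in>X. c b \<noteq> 0}"
  have S: "finite S" "S \<noteq> {}" using X b \<open>c b \<noteq> 0\<close> by (auto simp: S_def)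
  define b0 where "b0 = arg_min_on key S"
  have b0: "b0 \<in> S" "\<And>y. y \<in> S \<Longrightarrow> key b0 \<le> key y"
    using arg_min_if_finite[OF S, of key] unfolding b0_def by force+
  have "(\<Sum>b\<in>X. c b * h b b0) = (\<Sum>b\<in>X. if b = b0 then c b0 * h b0 b0 else 0)"
  proof (rule sum.cong[OF refl])
    fix b assume bX: "b \<in> X"
    show "c b * h b b0 = (if b = b0 then c b0 * h b0 b0 else 0)"
    proof (cases "b = b0 \<or> c b = 0")
      case False
      then have "key b0 \<le> key b" using b0(2)[of b] bX by (simp add: S_def)
      then have "h b b0 = 0" using tri[OF bX, of b0] b0(1) False by (force simp: S_def)
      then show ?thesis using False by simp
    qed auto
  qed
  also have "\<dots> = c b0 * h b0 b0" using X b0(1) by (simp add: S_def)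
  finally have "c b0 * h b0 b0 = 0" using zero[of b0] b0(1) by (simp add: S_def)
  then show False using diag[of b0] b0(1) by (simp add: S_def)
qed

text \<open>A vanishing combination splits into two orthogonal halves, each of which must
vanish; within each half the triangular shape applies.\<close>

lemma triangular_orth_indep:
  fixes h :: "'x \<Rightarrow> 'x \<Rightarrow> real" and key :: "'x \<Rightarrow> int"
  assumes X: "finite X" and E: "E \<subseteq> X" and diag: "\<And>b. b \<in> X \<Longrightarrow> h b b \<noteq> 0"
    and up: "\<And>b x. b \<in> E \<Longrightarrow> x \<in> X \<Longrightarrow> h b x \<noteq> 0 \<Longrightarrow> x \<noteq> b \<Longrightarrow> key b < key x"
    and down: "\<And>b x. b \<in> X - E \<Longrightarrow> x \<in> X \<Longrightarrow> h b x \<noteq> 0 \<Longrightarrow> x \<noteq> b \<Longrightarrow> key x < key b"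
    and orth: "\<And>b b'. b \<in> E \<Longrightarrow> b' \<in> X - E \<Longrightarrow> (\<Sum>x\<in>X. h b x * h b' x) = 0"
    and zero: "\<And>x. x \<in> X \<Longrightarrow> (\<Sum>b\<in>X. c b * h b x) = 0"
  shows "\<forall>b\<in>X. c b = 0"
proof -
  let ?F = "\<lambda>x. \<Sum>b\<in>E. c b * h b x" and ?G = "\<lambda>x. \<Sum>b\<in>X - E. c b * h b x"
  have fin: "finite E" "finite (X - E)" using X E finite_subset by auto
  have FG: "?F x = - ?G x" if "x \<in> X" for x
    using zero[OF that] sum.subset_diff[OF E X, of "\<lambda>b. c b * h b x"] by simp
  have "(\<Sum>x\<in>X. ?F x * ?G x) = (\<Sum>x\<in>X. \<Sum>b\<in>E. \<Sum>b'\<in>X - E. c b * c b' * (h b x * h b' x))"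
    by (simp add: sum_product mult_ac)
  also have "\<dots> = (\<Sum>b\<in>E. \<Sum>b'\<in>X - E. c b * c b' * (\<Sum>x\<in>X. h b x * h b' x))"
    by (rule trans[OF sum.swap], rule sum.cong[OF refl], rule trans[OF sum.swap]) (simp add: sum_distrib_left)
  also have "\<dots> = 0" using orth by simp
  finally have "(\<Sum>x\<in>X. ?F x * ?F x) = 0" using FG by (simp add: sum_negf)
  then have F0: "?F x = 0" if "x \<in> X" for x
    using that X by (subst (asm) sum_nonneg_eq_0_iff) auto
  then have G0: "?G x = 0" if "x \<in> X" for x using FG that by force
  have "c b = 0" if "b \<in> E" for b
    by (rule triangular_indep[of E h key c, OF fin(1)]) (use E diag up F0 that in blast)+
  moreover have "c b = 0" if "b \<in> X - E" for b
    by (rule triangular_indep[of "X - E" h "\<lambda>x. - key x" c, OF fin(2)]) (use diag down G0 that in auto)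
  ultimately show ?thesis by blast
qed

lemma card_eq_stratum_dim:
  fixes key :: "('a \<Rightarrow> 'a) \<Rightarrow> int" and h :: "('a \<Rightarrow> 'a) \<Rightarrow> ('a \<Rightarrow> 'a) \<Rightarrow> real"
  assumes N: "finite N" and m: "2 * m \<le> card N" and E: "E \<subseteq> {s. s permutes N}"
    and degree_le: "\<And>b. b \<in> E \<Longrightarrow> degree_le N m (h b)"
    and orth_degree: "\<And>b. b permutes N \<Longrightarrow> b \<notin> E \<Longrightarrow> orth_degree N m (h b)"
    and diag: "\<And>b. b permutes N \<Longrightarrow> h b b \<noteq> 0"
    and up: "\<And>b x. b \<in> E \<Longrightarrow> x permutes N \<Longrightarrow> h b x \<noteq> 0 \<Longrightarrow> x \<noteq> b \<Longrightarrow> key b < key x"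
    and down: "\<And>b x. b permutes N \<Longrightarrow> b \<notin> E \<Longrightarrow> x permutes N \<Longrightarrow> h b x \<noteq> 0 \<Longrightarrow> x \<noteq> b \<Longrightarrow> key x < key b"
  shows "real (card E) = (\<Sum>q\<le>m. stratum_dim N q)"
proof -
  let ?X = "{s. s permutes N}"
  have finX: "finite ?X" by (rule finite_permutations[OF N])
  have mN: "m \<le> card N" using m by simp
  define Z where "Z t s = (\<Sum>q\<le>m. stratum_kernel N q (stratum_coeff N q) t s)" for t s
  have ZZ: "(\<Sum>t\<in>?X. Z t s * f t) = degree_op N m f s" for f s
    unfolding Z_def degree_op_def stratum_op_def sum_distrib_right by (rule sum.swap)
  have "(\<Sum>s\<in>?X. Z s s) = card E"
  proof (rule trace_of_projection[OF finX E, where h = h and Z = Z])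
    fix c :: "('a \<Rightarrow> 'a) \<Rightarrow> real" assume zero: "\<And>x. x \<in> ?X \<Longrightarrow> (\<Sum>b\<in>?X. c b * h b x) = 0"
    show "\<forall>b\<in>?X. c b = 0"
    proof (rule triangular_orth_indep[OF finX E, where h = h and key = key])
      show "(\<Sum>x\<in>?X. h b x * h b' x) = 0" if "b \<in> E" "b' \<in> ?X - E" for b b'
        using that by (intro inner_degree_le_coset_sum[OF N degree_le[OF that(1)]] orth_degreeD[OF orth_degree[of b']]) auto
    qed (use diag up down zero E in auto)
  next
    fix b x assume "b \<in> ?X" "x \<in> ?X"
    then show "(\<Sum>y\<in>?X. Z y x * h b y) = (if b \<in> E then h b x else 0)"
      unfolding ZZ using degree_op_degree_le[OF N m degree_le] degree_op_orth_degree[OF N mN orth_degree] by auto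
  qed
  moreover have "(\<Sum>s\<in>?X. Z s s) = (\<Sum>q\<le>m. stratum_dim N q)"
    unfolding Z_def using mN by (subst sum.swap) (intro sum.cong refl trace_stratum_kernel[OF N], auto)
  ultimately show ?thesis by simp
qed

section \<open>Increasing subsequences\<close>

text \<open>Reading the values as digits in base \<open>n + 1\<close> turns the lexicographic order into the order of
numbers.\<close>

definition lex_key :: "nat \<Rightarrow> (nat \<Rightarrow> nat) \<Rightarrow> nat" where
  "lex_key n f = (\<Sum>j\<in>{1..n}. f j * (n + 1) ^ (n - j))"

lemma sum_top_digits:
  fixes n :: nat
  assumes "i \<le> n"
  shows "(\<Sum>j\<in>{i<..n}. n * (n + 1) ^ (n - j)) + 1 = (n + 1) ^ (n - i)"
  using assms
proof (induction i rule: inc_induct)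
  case base
  then show ?case by simp
next
  case (step i)
  have e: "{i<..n} = insert (Suc i) {Suc i<..n}" using step.hyps by auto
  have "n - i = Suc (n - Suc i)" using step.hyps by simp
  then have "(n + 1) ^ (n - i) = n * (n + 1) ^ (n - Suc i) + (n + 1) ^ (n - Suc i)" by simp
  then show ?case unfolding e using step.IH by simp
qed

lemma lex_key_less:
  assumes i: "i \<in> {1..n}" and eq: "\<And>j. j \<in> {1..<i} \<Longrightarrow> f j = g j" and less: "f i < g i"
    and bnd: "\<And>j. j \<in> {1..n} \<Longrightarrow> f j \<le> n"
  shows "lex_key n f < lex_key n g"
proof -
  have split: "lex_key n h = (\<Sum>j\<in>{1..<i}. h j * (n + 1) ^ (n - j)) + h i * (n + 1) ^ (n - i)
      + (\<Sum>j\<in>{i<..n}. h j * (n + 1) ^ (n - j))" for h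
  proof -
    have "{1..n} = {1..<i} \<union> insert i {i<..n}" using i by auto
    moreover have "{1..<i} \<inter> insert i {i<..n} = {}" by auto
    ultimately show ?thesis unfolding lex_key_def by (simp add: sum.union_disjoint)
  qed
  have "(\<Sum>j\<in>{i<..n}. f j * (n + 1) ^ (n - j)) \<le> (\<Sum>j\<in>{i<..n}. n * (n + 1) ^ (n - j))"
    using bnd i by (intro sum_mono mult_right_mono) auto
  also have "\<dots> < (n + 1) ^ (n - i)" using sum_top_digits[of i n] i by simp
  finally have tail: "(\<Sum>j\<in>{i<..n}. f j * (n + 1) ^ (n - j)) < (n + 1) ^ (n - i)" .
  have "(f i + 1) * (n + 1) ^ (n - i) \<le> g i * (n + 1) ^ (n - i)"
    using less by (intro mult_right_mono) auto
  moreover have "(\<Sum>j\<in>{1..<i}. f j * (n + 1) ^ (n - j)) = (\<Sum>j\<in>{1..<i}. g j * (n + 1) ^ (n - j))"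
    using eq by simp
  ultimately show ?thesis unfolding split[of f] split[of g] using tail by (simp add: algebra_simps)
qed

text \<open>At the first position where two permutations differ, the value that one of them takes there
occurs in the other one further to the right.\<close>

lemma permutes_first_diff:
  fixes n :: nat
  assumes s: "s permutes {1..n}" and t: "t permutes {1..n}" and ne: "s \<noteq> t"
  obtains i j where "i \<in> {1..n}" "s i \<noteq> t i" "\<And>j. j < i \<Longrightarrow> s j = t j"
    "j \<in> {1..n}" "s j = t i" "i < j" "s j \<noteq> t j"
proof -
  obtain x where x: "s x \<noteq> t x" using ne by blast
  define i where "i = (LEAST x. s x \<noteq> t x)"
  have i: "s i \<noteq> t i" unfolding i_def by (rule LeastI[of _ x]) (rule x)
  have iN: "i \<in> {1..n}" using i permutes_not_in[OF s, of i] permutes_not_in[OF t, of i] by metis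
  have before: "s j = t j" if "j < i" for j using not_less_Least that unfolding i_def by blast
  define j where "j = inv s (t i)"
  have j: "j \<in> {1..n}" "s j = t i"
    using permutes_in_image[OF permutes_inv[OF s], of "t i"] permutes_in_image[OF t, of i] iN
      permutes_inverses(1)[OF s] by (auto simp: j_def)
  have sj: "s j \<noteq> t j"
  proof
    assume "s j = t j"
    then have "j = i" using j(2) permutes_inj[OF t] by (metis injD)
    then show False using i j(2) by simp
  qed
  have "j \<noteq> i" using i j(2) by auto
  moreover have "\<not> j < i" using before[of j] sj by auto
  ultimately have "i < j" by simp
  then show thesis using that i iN before j sj by blast
qed

lemma LIS_ge_iff: "k \<le> LIS n s \<longleftrightarrow> (\<exists>I. I \<subseteq> {1..n} \<and> card I = k \<and> strict_mono_on I s)"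
proof -
  let ?S = "{card I | I. I \<subseteq> {1..n} \<and> strict_mono_on I s}"
  have fin: "finite ?S" by (rule finite_subset[of _ "card ` Pow {1..n}"]) auto
  have "card {} \<in> ?S" by (intro CollectI exI[of _ "{}"]) (auto simp: strict_mono_on_def)
  then have ne: "?S \<noteq> {}" by blast
  show ?thesis
  proof
    assume k: "k \<le> LIS n s"
    have "LIS n s \<in> ?S" unfolding LIS_def by (rule Max_in[OF fin ne])
    then obtain I where I: "I \<subseteq> {1..n}" "strict_mono_on I s" "card I = LIS n s" by auto
    then obtain J where "J \<subseteq> I" "card J = k" using k by (metis obtain_subset_with_card_n)
    then show "\<exists>I. I \<subseteq> {1..n} \<and> card I = k \<and> strict_mono_on I s"
      using I(1,2) unfolding strict_mono_on_def by (intro exI[of _ J]) blast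
  next
    assume "\<exists>I. I \<subseteq> {1..n} \<and> card I = k \<and> strict_mono_on I s"
    then have "k \<in> ?S" by auto
    then show "k \<le> LIS n s" unfolding LIS_def by (rule Max_ge[OF fin])
  qed
qed

text \<open>Positions with the same value of this function carry decreasing values, as in the proof of
Mirsky's theorem (the dual of Dilworth's theorem).\<close>

definition lis_end :: "(nat \<Rightarrow> nat) \<Rightarrow> nat \<Rightarrow> nat" where
  "lis_end s x = Max {card I | I. I \<subseteq> {1..x} \<and> x \<in> I \<and> strict_mono_on I s}"

lemma lis_end_props:
  assumes "1 \<le> x"
  shows "\<exists>I. I \<subseteq> {1..x} \<and> x \<in> I \<and> strict_mono_on I s \<and> card I = lis_end s x"
    and "I \<subseteq> {1..x} \<Longrightarrow> x \<in> I \<Longrightarrow> strict_mono_on I s \<Longrightarrow> card I \<le> lis_end s x"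
proof -
  let ?S = "{card I | I. I \<subseteq> {1..x} \<and> x \<in> I \<and> strict_mono_on I s}"
  have fin: "finite ?S" by (rule finite_subset[of _ "card ` Pow {1..x}"]) auto
  have "card {x} \<in> ?S" by (intro CollectI exI[of _ "{x}"]) (use assms in \<open>auto simp: strict_mono_on_def\<close>)
  then have ne: "?S \<noteq> {}" by blast
  have "lis_end s x \<in> ?S" unfolding lis_end_def by (rule Max_in[OF fin ne])
  then show "\<exists>I. I \<subseteq> {1..x} \<and> x \<in> I \<and> strict_mono_on I s \<and> card I = lis_end s x"
    unfolding mem_Collect_eq by metis
  assume "I \<subseteq> {1..x}" "x \<in> I" "strict_mono_on I s"
  then have "card I \<in> ?S" by blast
  then show "card I \<le> lis_end s x" unfolding lis_end_def by (rule Max_ge[OF fin])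
qed

lemma lis_end_less:
  assumes "1 \<le> x" "x < y" "s x < s y"
  shows "lis_end s x < lis_end s y"
proof -
  obtain I where I: "I \<subseteq> {1..x}" "x \<in> I" "strict_mono_on I s" "card I = lis_end s x"
    using lis_end_props(1)[OF assms(1)] by blast
  have y: "y \<notin> I" using I(1) assms(2) by auto
  have "strict_mono_on (insert y I) s"
    unfolding strict_mono_on_def
  proof (intro allI impI)
    fix a b assume ab: "a \<in> insert y I \<and> b \<in> insert y I \<and> a < b"
    have I': "a < b \<Longrightarrow> a \<in> I \<Longrightarrow> b \<in> I \<Longrightarrow> s a < s b" for a b using I(3) by (auto simp: strict_mono_on_def)
    have le: "s a \<le> s x" if "a \<in> I" for a
    proof -
      have "a \<le> x" using that I(1) by auto
      then show ?thesis using I'[of a x] that I(2) by (cases "a = x") auto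
    qed
    show "s a < s b"
    proof (cases "b = y")
      case True
      then have "a \<in> I" using ab by auto
      then show ?thesis using le[of a] assms(3) True by simp
    next
      case False
      then have "b \<in> I" using ab by auto
      moreover have "a \<noteq> y" using ab I(1) \<open>b \<in> I\<close> assms(2) by force
      ultimately show ?thesis using ab I' by auto
    qed
  qed
  then have "card (insert y I) \<le> lis_end s y"
    by (intro lis_end_props(2)) (use I(1) assms in auto)
  moreover have "finite I" using I(1) finite_subset by blast
  ultimately show ?thesis using y I(4) by simp
qed

lemma lis_end_range:
  assumes x: "x \<in> {1..n}"
  shows "lis_end s x \<in> {1..LIS n s}"
proof -
  have x1: "1 \<le> x" using x by simp
  obtain I where I: "I \<subseteq> {1..x}" "x \<in> I" "strict_mono_on I s" "card I = lis_end s x"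
    using lis_end_props(1)[OF x1] by blast
  have "I \<subseteq> {1..n}" using I(1) x by auto
  then have "lis_end s x \<le> LIS n s" unfolding LIS_ge_iff using I by blast
  moreover have "card {x} \<le> lis_end s x"
    by (rule lis_end_props(2)[OF x1]) (use x1 in \<open>auto simp: strict_mono_on_def\<close>)
  ultimately show ?thesis by simp
qed

text \<open>The support consists of the rearrangements of \<open>s\<close> that keep every value inside the block of
positions given by \<open>lis_end\<close>.\<close>

definition block_sign :: "nat \<Rightarrow> (nat \<Rightarrow> nat) \<Rightarrow> (nat \<Rightarrow> nat) \<Rightarrow> real" where
  "block_sign n s t = (if \<forall>x\<in>{1..n}. lis_end s (inv s (t x)) = lis_end s x then of_int (sign (inv s \<circ> t)) else 0)"

text \<open>Among the \<open>k\<close> positions left free by a coset two lie in the same of the fewer than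
\<open>k\<close> blocks, and exchanging the values there preserves the coset and reverses the sign.\<close>

lemma orth_degree_block_sign:
  assumes s: "s permutes {1..n}" and k: "LIS n s < k" "k \<le> n"
  shows "orth_degree {1..n} (n - k) (block_sign n s)"
  unfolding orth_degree_def
proof (intro allI impI)
  let ?N = "{1..n}"
  fix I :: "nat set" and l g
  assume I: "finite I" "card I = n - k" and l: "l \<in> injs I ?N" and g: "g \<in> injs I ?N"
  let ?S = "{t. t permutes ?N \<and> (\<forall>x\<in>I. t (l x) = g x)}"
  have cB: "card (?N - l ` I) = k"
    using injsD(1,2)[OF l] I k by (simp add: card_Diff_subset card_image)
  have "card (lis_end s ` (?N - l ` I)) \<le> card {1..LIS n s}"
    by (rule card_mono) (use lis_end_range in auto)
  then have "card (lis_end s ` (?N - l ` I)) < card (?N - l ` I)" using cB k by simp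
  then have "\<not> inj_on (lis_end s) (?N - l ` I)" by (rule pigeonhole)
  then obtain a b where ab: "a \<in> ?N" "a \<notin> l ` I" "b \<in> ?N" "b \<notin> l ` I" "a \<noteq> b" "lis_end s a = lis_end s b"
    by (auto simp: inj_on_def)
  let ?t = "transpose a b"
  have tp: "?t permutes ?N" using ab by (intro permutes_swap_id)
  have tl: "?t (l x) = l x" if "x \<in> I" for x using ab that by (auto simp: transpose_def)
  have td: "lis_end s (?t x) = lis_end s x" for x using ab(6) by (simp add: transpose_def)
  have flip: "block_sign n s (u \<circ> ?t) = - block_sign n s u" if u: "u permutes ?N" for u
  proof -
    let ?p = "inv s \<circ> u"
    have p: "?p permutes ?N" using permutes_compose[OF u permutes_inv[OF s]] .
    have "(\<forall>x\<in>?N. lis_end s (?p (?t x)) = lis_end s x) \<longleftrightarrow> (\<forall>x\<in>?N. lis_end s (?p (?t x)) = lis_end s (?t x))"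
      using td by simp
    also have "\<dots> \<longleftrightarrow> (\<forall>y\<in>?t ` ?N. lis_end s (?p y) = lis_end s y)" by blast
    also have "?t ` ?N = ?N" by (rule permutes_image[OF tp])
    finally have c: "(\<forall>x\<in>?N. lis_end s (?p (?t x)) = lis_end s x) \<longleftrightarrow> (\<forall>x\<in>?N. lis_end s (?p x) = lis_end s x)" .
    have "sign (?p \<circ> ?t) = - sign ?p"
      using sign_compose[OF permutes_imp_permutation[OF _ p] permutation_swap_id[of a b]] ab(5)
      by (simp add: sign_swap_id)
    then show ?thesis using c unfolding block_sign_def by (simp add: comp_assoc)
  qed
  have "coset_sum ?N (block_sign n s) I l g = (\<Sum>u\<in>?S. block_sign n s u)" by (simp add: coset_sum_def)
  also have "\<dots> = (\<Sum>u\<in>?S. block_sign n s (u \<circ> ?t))"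
    by (rule sum.reindex_bij_witness[where i = "\<lambda>u. u \<circ> ?t" and j = "\<lambda>u. u \<circ> ?t"])
       (use tp tl permutes_compose[OF tp] in \<open>auto simp: comp_assoc\<close>)
  also have "\<dots> = (\<Sum>u\<in>?S. - block_sign n s u)" by (rule sum.cong) (use flip in auto)
  also have "\<dots> = - coset_sum ?N (block_sign n s) I l g" by (simp add: coset_sum_def sum_negf)
  finally show "coset_sum ?N (block_sign n s) I l g = 0" by simp
qed

lemma restrict_in_injs:
  assumes "inj_on f A" "f ` A \<subseteq> B"
  shows "restrict f A \<in> injs A B"
  using assms by (simp add: injs_def restrict_PiE_iff image_subset_iff)

text \<open>The basis consists of coset indicators for permutations with an increasing
subsequence of length \<open>k\<close>, and of signed block rearrangements for the others.\<close>

lemma card_LIS_ge: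
  assumes k: "k \<le> n" "n \<le> 2 * k"
  shows "real (card {s. s permutes {1..n} \<and> k \<le> LIS n s}) = (\<Sum>q\<le>n - k. stratum_dim {1..n} q)"
proof -
  let ?N = "{1..n}" and ?E = "{s. s permutes {1..n} \<and> k \<le> LIS n s}"
  define J :: "(nat \<Rightarrow> nat) \<Rightarrow> nat set" where "J s = (SOME I. I \<subseteq> {1..n} \<and> card I = k \<and> strict_mono_on I s)" for s
  have J: "J s \<subseteq> ?N" "card (J s) = k" "strict_mono_on (J s) s" if "k \<le> LIS n s" for s
    using someI_ex[of "\<lambda>I. I \<subseteq> {1..n} \<and> card I = k \<and> strict_mono_on I s"] that
    unfolding J_def LIS_ge_iff by blast+
  define h where "h s t = (if k \<le> LIS n s then if \<forall>x\<in>?N - J s. t x = s x then 1 else 0 else block_sign n s t)" for s t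
  show ?thesis
  proof (rule card_eq_stratum_dim[where h = h and key = "\<lambda>s. int (lex_key n s)"])
    show "finite ?N" "2 * (n - k) \<le> card ?N" "?E \<subseteq> {s. s permutes ?N}" using k by auto
  next
    fix b assume b: "b \<in> ?E"
    then have bp: "b permutes ?N" and Jb: "J b \<subseteq> ?N" "card (J b) = k" using J by auto
    have fJ: "finite (?N - J b)" "card (?N - J b) = n - k"
      using Jb by (auto simp: card_Diff_subset finite_subset)
    have "degree_le ?N (n - k) (\<lambda>t. if \<forall>x\<in>?N - J b. t (restrict (\<lambda>x. x) (?N - J b) x) = restrict b (?N - J b) x then 1 else 0)"
    proof (rule degree_le_coset[OF fJ])
      show "restrict (\<lambda>x. x) (?N - J b) \<in> injs (?N - J b) ?N"
        by (rule restrict_in_injs) (auto simp: inj_on_def)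
      show "restrict b (?N - J b) \<in> injs (?N - J b) ?N"
        by (rule restrict_in_injs) (use permutes_in_image[OF bp] permutes_inj_on[OF bp] in auto)
    qed simp
    then show "degree_le ?N (n - k) (h b)" using b by (simp add: h_def[abs_def])
  next
    fix b assume "b permutes ?N" "b \<notin> ?E"
    then show "orth_degree ?N (n - k) (h b)" using orth_degree_block_sign[of b n k] k by (simp add: h_def[abs_def])
  next
    fix b assume "b permutes ?N"
    then show "h b b \<noteq> 0" by (simp add: h_def block_sign_def permutes_inverses permutes_inv_o)
  next
    fix b x assume b: "b \<in> ?E" and x: "x permutes ?N" and hx: "h b x \<noteq> 0" and ne: "x \<noteq> b"
    then have bp: "b permutes ?N" and kb: "k \<le> LIS n b" by auto
    have off: "x y = b y" if "y \<in> ?N - J b" for y using hx kb that by (auto simp: h_def split: if_splits)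
    obtain i j where i: "i \<in> ?N" "b i \<noteq> x i" "\<And>j. j < i \<Longrightarrow> b j = x j"
      and j: "j \<in> ?N" "b j = x i" "i < j" "b j \<noteq> x j"
      using permutes_first_diff[OF bp x] ne by metis
    have "i \<in> J b" "j \<in> J b" using off[OF _] i(1,2) j(1,4) by force+
    then have "b i < b j" using strict_mono_onD[OF J(3)[OF kb]] j(3) by blast
    then have "b i < x i" using j(2) by simp
    then show "int (lex_key n b) < int (lex_key n x)"
      by (intro of_nat_less_iff[THEN iffD2] lex_key_less[where f = b and g = x, OF i(1)]) (use i(3) permutes_in_image[OF bp] in auto)
  next
    fix b x assume bp: "b permutes ?N" and b: "b \<notin> ?E" and x: "x permutes ?N" and hx: "h b x \<noteq> 0" and ne: "x \<noteq> b"
    have eq: "lis_end b (inv b (x y)) = lis_end b y" if "y \<in> ?N" for y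
      using hx b bp that by (auto simp: h_def block_sign_def split: if_splits)
    obtain i j where i: "i \<in> ?N" "b i \<noteq> x i" "\<And>j. j < i \<Longrightarrow> b j = x j"
      and j: "j \<in> ?N" "b j = x i" "i < j" "b j \<noteq> x j"
      using permutes_first_diff[OF bp x] ne by metis
    have ji: "inv b (x i) = j" using j(2) permutes_inv_eq[OF bp] by simp
    have "\<not> b i < b j" using lis_end_less[of i j b] j(3) i(1) eq[OF i(1)] by (auto simp: ji)
    then have "x i < b i" using i(2) j(2) by simp
    then show "int (lex_key n x) < int (lex_key n b)"
      by (intro of_nat_less_iff[THEN iffD2] lex_key_less[where f = x and g = b, OF i(1)]) (use i(3) permutes_in_image[OF x] in auto)
  qed
qed

lemma lis_count_stratum_dim:
  assumes k: "k \<le> n" "n \<le> 2 * k"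
  shows "real (lis_count n k) = stratum_dim {1..n} (n - k)"
proof -
  let ?S = "\<lambda>k. {s. s permutes {1..n} \<and> k \<le> LIS n s}"
  have fin: "finite (?S j)" for j by (rule finite_subset[OF _ finite_permutations[of "{1..n}"]]) auto
  have "?S k = {s. s permutes {1..n} \<and> LIS n s = k} \<union> ?S (Suc k)" by auto
  moreover have "card ({s. s permutes {1..n} \<and> LIS n s = k} \<union> ?S (Suc k)) = lis_count n k + card (?S (Suc k))"
    unfolding lis_count_def
    by (rule card_Un_disjoint) (use fin in \<open>auto intro: finite_subset[OF _ fin[of k]]\<close>)
  ultimately have c: "real (lis_count n k) = real (card (?S k)) - real (card (?S (Suc k)))" by simp
  show ?thesis
  proof (cases "k = n")
    case True
    have "?S (Suc n) = {}"
    proof -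
      have "\<not> Suc n \<le> LIS n s" for s
      proof
        assume "Suc n \<le> LIS n s"
        then obtain I where "I \<subseteq> {1..n}" "card I = Suc n" unfolding LIS_ge_iff by blast
        then show False using card_mono[of "{1..n}" I] by simp
      qed
      then show ?thesis by auto
    qed
    then have "card (?S (Suc n)) = 0" by (simp only: card.empty)
    then show ?thesis using c card_LIS_ge[OF k] unfolding True by simp
  next
    case False
    then have n: "n - k = Suc (n - Suc k)" using k by simp
    have "real (card (?S (Suc k))) = (\<Sum>q\<le>n - Suc k. stratum_dim {1..n} q)"
      by (rule card_LIS_ge) (use False k in auto)
    then show ?thesis using c card_LIS_ge[OF k] unfolding n by simp
  qed
qed

section \<open>Evaluation of the trace\<close>

lemma sum_Pow_card:
  fixes f :: "nat \<Rightarrow> real"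
  assumes A: "finite A"
  shows "(\<Sum>X\<in>Pow A. f (card X)) = (\<Sum>i\<le>card A. real (card A choose i) * f i)"
proof -
  have "(\<Sum>X\<in>Pow A. f (card X)) = (\<Sum>i\<le>card A. \<Sum>X | X \<in> Pow A \<and> card X = i. f (card X))"
    by (rule sum.group[symmetric]) (use A in \<open>auto intro: card_mono\<close>)
  also have "\<dots> = (\<Sum>i\<le>card A. real (card A choose i) * f i)"
  proof (rule sum.cong[OF refl])
    fix i
    have "(\<Sum>X | X \<in> Pow A \<and> card X = i. f (card X)) = (\<Sum>X | X \<subseteq> A \<and> card X = i. f i)"
      by (rule sum.cong) auto
    then show "(\<Sum>X | X \<in> Pow A \<and> card X = i. f (card X)) = real (card A choose i) * f i"
      using n_subsets[OF A, of i] by simp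
  qed
  finally show ?thesis .
qed

lemma sum_Pow_split:
  fixes g :: "'a set \<Rightarrow> 'a set \<Rightarrow> real"
  assumes K: "K \<subseteq> A"
  shows "(\<Sum>L\<in>Pow A. g (L \<inter> K) (L - K)) = (\<Sum>R\<in>Pow K. \<Sum>Q\<in>Pow (A - K). g R Q)"
proof -
  have "(\<Sum>L\<in>Pow A. g (L \<inter> K) (L - K)) = (\<Sum>(R, Q)\<in>Pow K \<times> Pow (A - K). g R Q)"
    by (rule sum.reindex_bij_witness[where i = "\<lambda>(R, Q). R \<union> Q" and j = "\<lambda>L. (L \<inter> K, L - K)"])
       (use K in \<open>auto intro!: arg_cong2[where f = g]\<close>)
  then show ?thesis by (simp add: sum.cartesian_product)
qed

text \<open>The signs square to one, and a permutation preserves \<open>U\<close> and \<open>V\<close> and fixes everything else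
exactly if it permutes their intersection.\<close>

lemma sum_harm_char_sq:
  "(\<Sum>t | t permutes {..<m}. harm_char N m t ^ 2)
   = (\<Sum>U\<in>Pow {..<m}. \<Sum>V\<in>Pow {..<m}. sgn_wt N m (card U) * sgn_wt N m (card V) * fact (card (U \<inter> V)))"
proof -
  let ?M = "{..<m}" and ?P = "{t. t permutes {..<m}}" and ?b = "\<lambda>U. sgn_wt N m (card U)"
  have cs: "harm_char N m p = (\<Sum>U\<in>Pow ?M. if p permutes U then ?b U * of_int (sign p) else 0)" for p
    unfolding harm_char_def by (rule sum.mono_neutral_cong_left) auto
  have ss: "of_int (sign p) * of_int (sign p) = (1::real)" for p :: "nat \<Rightarrow> nat"
    by (metis of_int_1 of_int_mult sign_idempotent)
  have "(\<Sum>t\<in>?P. harm_char N m t ^ 2) = (\<Sum>t\<in>?P. \<Sum>U\<in>Pow ?M. \<Sum>V\<in>Pow ?M. if t permutes U \<and> t permutes V then ?b U * ?b V else 0)"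
    unfolding power2_eq_square cs sum_product
    by (intro sum.cong refl) (auto simp: mult_ac ss)
  also have "\<dots> = (\<Sum>U\<in>Pow ?M. \<Sum>V\<in>Pow ?M. \<Sum>t\<in>?P. if t permutes U \<and> t permutes V then ?b U * ?b V else 0)"
    by (rule trans[OF sum.swap], rule sum.cong[OF refl], rule sum.swap)
  also have "\<dots> = (\<Sum>U\<in>Pow ?M. \<Sum>V\<in>Pow ?M. ?b U * ?b V * fact (card (U \<inter> V)))"
  proof (intro sum.cong refl)
    fix U V assume "U \<in> Pow ?M" "V \<in> Pow ?M"
    then have UV: "U \<subseteq> ?M" "V \<subseteq> ?M" by auto
    have both: "t permutes U \<and> t permutes V \<longleftrightarrow> t permutes U \<inter> V" for t
    proof
      assume t: "t permutes U \<and> t permutes V"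
      then have "t permutes U" by simp
      then show "t permutes U \<inter> V"
        by (rule permutes_superset) (auto intro: permutes_not_in[OF conjunct2[OF t]])
    qed (auto intro: permutes_subset)
    have "(\<Sum>t\<in>?P. if t permutes U \<and> t permutes V then ?b U * ?b V else 0) = (\<Sum>t | t permutes U \<inter> V. ?b U * ?b V)"
      unfolding both
      by (rule sum.mono_neutral_cong_right) (use UV permutes_subset[of _ "U \<inter> V" ?M] in \<open>auto simp: finite_permutations\<close>)
    also have "\<dots> = ?b U * ?b V * fact (card (U \<inter> V))"
      using card_permutations[OF refl, of "U \<inter> V"] UV finite_subset[of U ?M] by simp
    finally show "(\<Sum>t\<in>?P. if t permutes U \<and> t permutes V then ?b U * ?b V else 0) = \<dots>" .
  qed
  finally show ?thesis .
qed

text \<open>Collecting the terms with \<open>p + q = s\<close> gives \<open>(2 * a) choose s\<close> by Vandermonde, and partial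
alternating sums of binomial coefficients telescope.\<close>

lemma sum_alternating_pairs:
  fixes a d :: nat
  assumes a: "a \<ge> 1"
  shows "(\<Sum>p\<le>d. \<Sum>q\<le>d - p. (- 1) ^ (p + q) * (real (a choose p) * real (a choose q)))
       = (- 1) ^ d * real ((2 * a - 1) choose d)"
proof -
  have "(\<Sum>p\<le>d. \<Sum>q\<le>d - p. (- 1) ^ (p + q) * (real (a choose p) * real (a choose q)))
      = (\<Sum>(p, q)\<in>(SIGMA p:{..d}. {..d - p}). (- 1) ^ (p + q) * (real (a choose p) * real (a choose q)))"
    by (rule sum.Sigma) auto
  also have "\<dots> = (\<Sum>(s, p)\<in>(SIGMA s:{..d}. {..s}). (- 1) ^ s * (real (a choose p) * real (a choose (s - p))))"
    by (rule sum.reindex_bij_witness[where i = "\<lambda>(s, p). (p, s - p)" and j = "\<lambda>(p, q). (p + q, p)"]) auto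
  also have "\<dots> = (\<Sum>s\<le>d. \<Sum>p\<le>s. (- 1) ^ s * (real (a choose p) * real (a choose (s - p))))"
    by (rule sum.Sigma[symmetric]) auto
  also have "\<dots> = (\<Sum>s\<le>d. (- 1) ^ s * real (\<Sum>p\<le>s. (a choose p) * (a choose (s - p))))"
    by (simp add: sum_distrib_left)
  also have "\<dots> = (\<Sum>s\<le>d. (real (2 * a) gchoose s) * (- 1) ^ s)"
    unfolding vandermonde by (simp add: binomial_gbinomial mult_2 mult.commute)
  also have "\<dots> = (- 1) ^ d * (real (2 * a) - 1 gchoose d)"
    by (rule gbinomial_sum_lower_neg)
  also have "real (2 * a) - 1 = real (2 * a - 1)" using a by simp
  finally show ?thesis by (simp add: binomial_gbinomial)
qed

text \<open>Passing to complements, the pairs of subsets are counted by the size \<open>r\<close> of the intersection and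
the sizes of the two differences; the set outside both drops out against \<open>fact m\<close>.\<close>

lemma stratum_dim_closed_form:
  assumes N: "finite N" and m: "m < card N"
  defines "n \<equiv> card N"
  shows "stratum_dim N m = (\<Sum>r\<le>m. fact n ^ 2 / (fact r * fact (n - r) ^ 2) *
           ((- 1) ^ (m - r) * real ((2 * (n - r) - 1) choose (m - r))))"
proof -
  let ?M = "{..<m}"
  let ?g = "\<lambda>r. fact n ^ 2 / (fact r * fact (n - r) ^ 2) :: real"
  let ?s = "\<lambda>r p q. (- 1) ^ (p + q) * (real ((n - r) choose p) * real ((n - r) choose q))"
  let ?z = "\<lambda>r. (- 1) ^ (m - r) * real ((2 * (n - r) - 1) choose (m - r))"
  \<comment> \<open>The coefficient of \<open>harm_char\<close> as a function of the size of the complementary set.\<close>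
  define bb :: "nat \<Rightarrow> real" where "bb k = (- 1) ^ (m + k) * (fact n / fact (n - k))" for k
  have bb: "sgn_wt N m (card (?M - K)) = bb (card K)" if "K \<subseteq> ?M" for K
  proof -
    have "card K \<le> m" using card_mono[OF _ that] by simp
    moreover have "card (?M - K) = m - card K" using that by (simp add: card_Diff_subset finite_subset)
    moreover have "(- 1) ^ (m - card K) = ((- 1) ^ (m + card K) :: real)"
      using \<open>card K \<le> m\<close> by (simp add: minus_one_power_iff)
    moreover have "n - m + (m - card K) = n - card K" using \<open>card K \<le> m\<close> m by (simp add: n_def)
    ultimately show ?thesis unfolding sgn_wt_def bb_def n_def by simp
  qed
  have compl: "(\<Sum>U\<in>Pow ?M. g U) = (\<Sum>K\<in>Pow ?M. g (?M - K))" for g :: "nat set \<Rightarrow> real"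
    by (rule sum.reindex_bij_witness[where i = "\<lambda>K. ?M - K" and j = "\<lambda>K. ?M - K"]) (auto simp: double_diff)
  have "(\<Sum>t | t permutes ?M. harm_char N m t ^ 2)
      = (\<Sum>K\<in>Pow ?M. \<Sum>L\<in>Pow ?M. sgn_wt N m (card (?M - K)) * sgn_wt N m (card (?M - L)) * fact (card ((?M - K) \<inter> (?M - L))))"
    unfolding sum_harm_char_sq by (rule trans[OF compl], rule sum.cong[OF refl], rule compl)
  also have "\<dots> = (\<Sum>K\<in>Pow ?M. \<Sum>L\<in>Pow ?M. bb (card K) * bb (card (L \<inter> K) + card (L - K)) * fact (m - card K - card (L - K)))"
  proof (rule sum.cong[OF refl], rule sum.cong[OF refl])
    fix K L assume "K \<in> Pow ?M" "L \<in> Pow ?M"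
    then have KL: "K \<subseteq> ?M" "L \<subseteq> ?M" "finite K" "finite L" using finite_subset by auto
    have "card L = card (L \<inter> K) + card (L - K)"
      using KL by (metis Int_Diff_disjoint Int_Diff_Un card_Un_disjoint finite_Diff finite_Int)
    moreover have "(?M - K) \<inter> (?M - L) = ?M - (K \<union> (L - K))" by auto
    moreover have "card (?M - (K \<union> (L - K))) = m - (card K + card (L - K))"
      using KL card_Un_disjoint[of K "L - K"] by (subst card_Diff_subset) auto
    ultimately show "sgn_wt N m (card (?M - K)) * sgn_wt N m (card (?M - L)) * fact (card ((?M - K) \<inter> (?M - L)))
        = bb (card K) * bb (card (L \<inter> K) + card (L - K)) * fact (m - card K - card (L - K))"
      using bb KL by simp
  qed
  also have "\<dots> = (\<Sum>K\<in>Pow ?M. \<Sum>r\<le>card K. real (card K choose r) * (\<Sum>q\<le>m - card K. real ((m - card K) choose q) *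
      (bb (card K) * bb (r + q) * fact (m - card K - q))))"
  proof (rule sum.cong[OF refl])
    fix K assume "K \<in> Pow ?M"
    then have K: "K \<subseteq> ?M" "finite K" using finite_subset by auto
    have c: "card (?M - K) = m - card K" using K by (simp add: card_Diff_subset)
    have "(\<Sum>L\<in>Pow ?M. bb (card K) * bb (card (L \<inter> K) + card (L - K)) * fact (m - card K - card (L - K)))
        = (\<Sum>R\<in>Pow K. \<Sum>Q\<in>Pow (?M - K). bb (card K) * bb (card R + card Q) * fact (m - card K - card Q))"
      by (rule sum_Pow_split[OF K(1)])
    also have "\<dots> = (\<Sum>R\<in>Pow K. \<Sum>q\<le>m - card K. real ((m - card K) choose q) *
        (bb (card K) * bb (card R + q) * fact (m - card K - q)))"
      by (rule sum.cong[OF refl], subst sum_Pow_card) (simp_all add: c)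
    also have "\<dots> = (\<Sum>r\<le>card K. real (card K choose r) * (\<Sum>q\<le>m - card K. real ((m - card K) choose q) *
        (bb (card K) * bb (r + q) * fact (m - card K - q))))"
      by (rule sum_Pow_card[OF K(2)])
    finally show "(\<Sum>L\<in>Pow ?M. bb (card K) * bb (card (L \<inter> K) + card (L - K)) * fact (m - card K - card (L - K))) = \<dots>" .
  qed
  also have "\<dots> = (\<Sum>k\<le>m. real (m choose k) * (\<Sum>r\<le>k. real (k choose r) * (\<Sum>q\<le>m - k. real ((m - k) choose q) *
      (bb k * bb (r + q) * fact (m - k - q)))))"
    using sum_Pow_card[of ?M "\<lambda>k. \<Sum>r\<le>k. real (k choose r) * (\<Sum>q\<le>m - k. real ((m - k) choose q) *
      (bb k * bb (r + q) * fact (m - k - q)))"] by simp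
  also have "\<dots> = (\<Sum>k\<le>m. \<Sum>r\<le>k. fact m * (\<Sum>q\<le>m - k. ?g r *
      ?s r (k - r) q))"
    unfolding sum_distrib_left
  proof (intro sum.cong refl)
    fix k r q assume "k \<in> {..m}" "r \<in> {..k}" "q \<in> {..m - k}"
    then have le: "k \<le> m" "r \<le> k" "q \<le> m - k" "m < n" using m by (auto simp: n_def)
    have c1: "real (m choose k) = fact m / (fact k * fact (m - k))" using binomial_fact[of k m, where 'a = real] le by simp
    have c2: "real (k choose r) = fact k / (fact r * fact (k - r))" using binomial_fact[of r k, where 'a = real] le by simp
    have c3: "real ((m - k) choose q) = fact (m - k) / (fact q * fact (m - k - q))"
      using binomial_fact[of q "m - k", where 'a = real] le by simp
    have c4: "real ((n - r) choose (k - r)) = fact (n - r) / (fact (k - r) * fact (n - k))"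
      using binomial_fact[of "k - r" "n - r", where 'a = real] le by simp
    have c5: "real ((n - r) choose q) = fact (n - r) / (fact q * fact (n - (r + q)))"
      using binomial_fact[of q "n - r", where 'a = real] le by simp
    have "m + k + (m + (r + q)) = 2 * (m + r) + (k - r + q)" using le by simp
    then have "(- 1) ^ (m + k) * (- 1) ^ (m + (r + q)) = ((- 1) ^ (2 * (m + r) + (k - r + q)) :: real)"
      by (simp only: power_add[symmetric])
    then have s: "(- 1) ^ (m + k) * (- 1) ^ (m + (r + q)) = ((- 1) ^ (k - r + q) :: real)"
      by (simp add: power_add)
    have "real (m choose k) * (real (k choose r) * (real ((m - k) choose q) * (bb k * bb (r + q) * fact (m - k - q))))
        = ((- 1) ^ (m + k) * (- 1) ^ (m + (r + q))) * (fact m * (fact n * fact n) / (fact r * fact (k - r) * fact q * fact (n - k) * fact (n - (r + q))))"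
      unfolding bb_def c1 c2 c3 by (simp add: field_simps)
    also have "\<dots> = fact m * (?g r *
        ?s r (k - r) q)"
      unfolding s c4 c5 by (simp add: field_simps power2_eq_square)
    finally show "real (m choose k) * (real (k choose r) * (real ((m - k) choose q) * (bb k * bb (r + q) * fact (m - k - q)))) = \<dots>" .
  qed
  also have "\<dots> = fact m * (\<Sum>k\<le>m. \<Sum>r\<le>k. \<Sum>q\<le>m - k. ?g r *
      ?s r (k - r) q)"
    by (simp only: sum_distrib_left)
  also have "(\<Sum>k\<le>m. \<Sum>r\<le>k. \<Sum>q\<le>m - k. ?g r *
      ?s r (k - r) q)
      = (\<Sum>r\<le>m. \<Sum>p\<le>m - r. \<Sum>q\<le>m - r - p. ?g r *
      ?s r p q)"
  proof -
    have "(\<Sum>k\<le>m. \<Sum>r\<le>k. G r (k - r)) = (\<Sum>r\<le>m. \<Sum>p\<le>m - r. G r p)" for G :: "nat \<Rightarrow> nat \<Rightarrow> real"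
    proof -
      have "(\<Sum>k\<le>m. \<Sum>r\<le>k. G r (k - r)) = (\<Sum>(k, r)\<in>(SIGMA k:{..m}. {..k}). G r (k - r))"
        by (rule sum.Sigma) auto
      also have "\<dots> = (\<Sum>(r, p)\<in>(SIGMA r:{..m}. {..m - r}). G r p)"
        by (rule sum.reindex_bij_witness[where i = "\<lambda>(r, p). (r + p, r)" and j = "\<lambda>(k, r). (r, k - r)"]) auto
      also have "\<dots> = (\<Sum>r\<le>m. \<Sum>p\<le>m - r. G r p)" by (rule sum.Sigma[symmetric]) auto
      finally show ?thesis .
    qed
    from this[of "\<lambda>r p. \<Sum>q\<le>m - r - p. ?g r *
      ?s r p q"]
    show ?thesis by simp
  qed
  also have "\<dots> = (\<Sum>r\<le>m. ?g r *
           ?z r)"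
  proof (rule sum.cong[OF refl])
    fix r assume "r \<in> {..m}"
    then have "n - r \<ge> 1" using m by (auto simp: n_def)
    from sum_alternating_pairs[OF this, of "m - r"]
    show "(\<Sum>p\<le>m - r. \<Sum>q\<le>m - r - p. ?g r *
      ?s r p q)
      = ?g r * ?z r"
      by (simp only: sum_distrib_left[symmetric])
  qed
  finally show ?thesis unfolding stratum_dim_def by simp
qed

section \<open>The D-finite array\<close>

text \<open>The guard matters: for \<open>k > s\<close> the truncated difference \<open>s - k\<close> would give 1 instead of 0.\<close>

definition alt_binom :: "nat \<Rightarrow> nat \<Rightarrow> 'a::field_char_0" where
  "alt_binom s k = (if k \<le> s then (- 1) ^ (s - k) * of_nat ((2 * s - 1) choose (s - k)) else 0)"

text \<open>The sum starts at \<open>s = 1\<close>, where \<open>2 * s - 1\<close> is a true difference.\<close>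

definition lis_array :: "nat \<Rightarrow> nat \<Rightarrow> 'a::field_char_0" where
  "lis_array n k = (\<Sum>s = 1..n. fact n ^ 2 / (fact s ^ 2 * fact (n - s)) * alt_binom s k)"

lemma Suc_choose_Suc: "Suc d * (N choose Suc d) = (N - d) * (N choose d)"
proof (cases N)
  case (Suc M)
  show ?thesis
    using Suc_times_binomial[of d M] binomial_absorb_comp[of N d] unfolding Suc by simp
qed simp

text \<open>This lets shifts in \<open>k\<close> stand for multiplication by \<open>s\<close>.\<close>

lemma alt_binom_shift_k:
  assumes s: "1 \<le> s"
  shows "of_nat s * (alt_binom s (Suc k) + alt_binom s k) = of_nat k * (alt_binom s k - alt_binom s (Suc k) :: 'a::field_char_0)"
proof -
  consider "k > s" | "k = s" | "k < s" by linarith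
  then show ?thesis
  proof cases
    case 3
    define d where "d = s - Suc k"
    have d: "s - k = Suc d" "s - Suc k = d" "2 * s - 1 - d = s + k" using 3 by (auto simp: d_def)
    let ?x = "of_nat ((2 * s - 1) choose d) :: 'a" and ?y = "of_nat ((2 * s - 1) choose Suc d) :: 'a"
    have "Suc d * ((2 * s - 1) choose Suc d) = (s + k) * ((2 * s - 1) choose d)"
      using Suc_choose_Suc[of d "2 * s - 1"] unfolding d(3) .
    then have e: "of_nat (Suc d) * ?y = of_nat (s + k) * ?x" by (metis of_nat_mult)
    have sk: "of_nat (Suc d) = (of_nat s - of_nat k :: 'a)"
      using 3 d(1) by (metis less_imp_le of_nat_diff)
    have "(of_nat s - of_nat k) * ?y = (of_nat s + of_nat k) * ?x" using e unfolding sk by simp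
    then have "of_nat s * (?x - ?y) = of_nat k * (- ?y - ?x)" by (simp add: algebra_simps)
    then have "(- 1) ^ d * (of_nat s * (?x - ?y)) = (- 1) ^ d * (of_nat k * (- ?y - ?x))" by simp
    then show ?thesis using 3 unfolding alt_binom_def d by (simp add: algebra_simps)
  qed (auto simp: alt_binom_def)
qed

text \<open>Two Pascal steps, with alternating signs.\<close>

lemma alt_binom_Suc:
  assumes s: "1 \<le> s"
  shows "alt_binom (Suc s) (Suc k) = (alt_binom s k - 2 * alt_binom s (Suc k) + alt_binom s (Suc (Suc k)) :: 'a::field_char_0)"
proof -
  obtain t where t: "2 * s - 1 = t" "2 * Suc s - 1 = Suc (Suc t)" using s by (cases s) auto
  consider "k > s" | "k = s" | "Suc k = s" | d where "s - k = Suc (Suc d)" "Suc (Suc k) \<le> s"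
  proof -
    assume a: "s < k \<Longrightarrow> thesis" "k = s \<Longrightarrow> thesis" "Suc k = s \<Longrightarrow> thesis"
      "\<And>d. s - k = Suc (Suc d) \<Longrightarrow> Suc (Suc k) \<le> s \<Longrightarrow> thesis"
    show thesis
    proof (cases "Suc (Suc k) \<le> s")
      case True
      then have "s - k = Suc (Suc (s - k - 2))" by simp
      then show ?thesis using a(4) True by blast
    qed (use a in linarith)
  qed
  then show ?thesis
  proof cases
    case 3
    then have "Suc s - Suc k = 1" "s - k = 1" "s - Suc k = 0" by auto
    then show ?thesis using 3 t unfolding alt_binom_def by simp
  next
    case 4
    then have "Suc s - Suc k = Suc (Suc d)" "s - Suc k = Suc d" "s - Suc (Suc k) = d" by auto
    then show ?thesis using 4 unfolding alt_binom_def t by (simp add: algebra_simps)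
  qed (use t in \<open>auto simp: alt_binom_def\<close>)
qed

lemma alt_binom_shift_s:
  assumes s: "1 \<le> s"
  shows "(of_nat s + 1 - of_nat k) * (of_nat s + of_nat k) * alt_binom (Suc s) k
       = - ((2 * of_nat s + 1) * (2 * of_nat s) * alt_binom s k :: 'a::field_char_0)"
proof -
  consider "k > Suc s" | "k = Suc s" | "k \<le> s" by linarith
  then show ?thesis
  proof cases
    case 3
    define d where "d = s - k"
    have d: "Suc s - k = Suc d" "s - k = d" using 3 by (auto simp: d_def)
    have S: "2 * Suc s - 1 = Suc (2 * s)" by simp
    have "Suc d * (Suc (2 * s) choose Suc d) = Suc (2 * s) * ((2 * s) choose d)"
      by (rule Suc_times_binomial)
    moreover have "(2 * s - d) * ((2 * s) choose d) = 2 * s * ((2 * s - 1) choose d)"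
      by (rule binomial_absorb_comp)
    moreover have "2 * s - d = s + k" using 3 by (simp add: d_def)
    ultimately have "Suc d * (s + k) * (Suc (2 * s) choose Suc d) = Suc (2 * s) * (2 * s) * ((2 * s - 1) choose d)"
      by (metis mult.assoc mult.left_commute)
    then have e: "of_nat (Suc d) * of_nat (s + k) * of_nat (Suc (2 * s) choose Suc d)
        = (of_nat (Suc (2 * s)) * of_nat (2 * s) * of_nat ((2 * s - 1) choose d) :: 'a)"
      by (metis of_nat_mult)
    have sk: "of_nat (Suc d) = (of_nat s + 1 - of_nat k :: 'a)"
      using 3 d(1) by (metis add.commute le_SucI of_nat_Suc of_nat_diff)
    have "(of_nat s + 1 - of_nat k) * (of_nat s + of_nat k) * of_nat (Suc (2 * s) choose Suc d)
        = ((2 * of_nat s + 1) * (2 * of_nat s) * of_nat ((2 * s - 1) choose d) :: 'a)"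
      using e unfolding sk by (simp add: algebra_simps)
    then have "(- 1) ^ Suc d * ((of_nat s + 1 - of_nat k) * (of_nat s + of_nat k) * of_nat (Suc (2 * s) choose Suc d))
        = - ((- 1) ^ d * ((2 * of_nat s + 1) * (2 * of_nat s) * of_nat ((2 * s - 1) choose d)) :: 'a)"
      by simp
    then show ?thesis using 3 unfolding alt_binom_def d S by (simp only: if_True le_SucI mult_ac)
  qed (auto simp: alt_binom_def)
qed

lemma alt_binom_one: "alt_binom (Suc 0) k = (if k = 0 then - 1 else if k = 1 then 1 else (0::'a::field_char_0))"
  by (auto simp: alt_binom_def)

text \<open>Moments in the summation variable \<open>s\<close>. The next lemma expresses a higher moment by shifts in \<open>n\<close>.\<close>

definition power_moment :: "nat \<Rightarrow> nat \<Rightarrow> nat \<Rightarrow> 'a::field_char_0" where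
  "power_moment j k n = (\<Sum>s = 1..n. of_nat s ^ j * (alt_binom s k / fact s ^ 2) / fact (n - s))"

lemma power_moment_Suc: "power_moment (Suc j) k (Suc n) = of_nat (Suc n) * power_moment j k (Suc n) - (power_moment j k n :: 'a::field_char_0)"
proof -
  let ?\<beta> = "\<lambda>s. alt_binom s k / fact s ^ 2 :: 'a"
  have "of_nat (Suc n) * power_moment j k (Suc n) - power_moment (Suc j) k (Suc n)
      = (\<Sum>s = 1..Suc n. of_nat s ^ j * ?\<beta> s * ((of_nat (Suc n) - of_nat s) / fact (Suc n - s)))"
    unfolding power_moment_def sum_distrib_left sum_subtractf[symmetric]
    by (intro sum.cong refl) (simp add: field_simps)
  also have "\<dots> = (\<Sum>s = 1..n. of_nat s ^ j * ?\<beta> s * ((of_nat (Suc n) - of_nat s) / fact (Suc n - s)))"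
    by (simp add: sum.nat_ivl_Suc')
  also have "\<dots> = power_moment j k n"
    unfolding power_moment_def
  proof (rule sum.cong[OF refl])
    fix s assume "s \<in> {1..n}"
    then have "Suc n - s = Suc (n - s)" "of_nat (Suc n) - of_nat s = (of_nat (Suc (n - s)) :: 'a)"
      by (auto simp: Suc_diff_le of_nat_diff)
    then have "(of_nat (Suc n) - of_nat s) / fact (Suc n - s) = 1 / (fact (n - s) :: 'a)"
      by (simp only: fact_Suc) (simp del: of_nat_Suc)
    then show "of_nat s ^ j * ?\<beta> s * ((of_nat (Suc n) - of_nat s) / fact (Suc n - s)) = of_nat s ^ j * ?\<beta> s / fact (n - s)"
      by simp
  qed
  finally show ?thesis by (simp add: algebra_simps)
qed

text \<open>The recurrence of the summand in \<open>s\<close>, summed over \<open>s\<close> and written in moments. At \<open>s = 1\<close> its right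
hand side vanishes because of the factor \<open>2 * s - 2\<close>, so the missing term \<open>s = 0\<close> does no harm.\<close>

lemma power_moment_rec:
  "power_moment 4 k (Suc n) - power_moment 3 k (Suc n) - of_nat k * (of_nat k - 1) * power_moment 2 k (Suc n)
   + 4 * power_moment 2 k n + 2 * power_moment 1 k n = (0::'a::field_char_0)"
proof -
  let ?\<beta> = "\<lambda>s. alt_binom s k / fact s ^ 2 :: 'a"
  let ?K = "of_nat k :: 'a"
  \<comment> \<open>Either \<open>k\<close> is 0 or 1 and a factor vanishes, or the coefficient does.\<close>
  have one: "(of_nat 1 - ?K) * (of_nat 1 + ?K - 1) * of_nat 1 ^ 2 * ?\<beta> 1 = 0"
    by (auto simp: alt_binom_one)
  have step: "(of_nat (Suc s) - ?K) * (of_nat (Suc s) + ?K - 1) * of_nat (Suc s) ^ 2 * ?\<beta> (Suc s)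
      = - ((4 * of_nat s ^ 2 + 2 * of_nat s) * ?\<beta> s)" if "1 \<le> s" for s
  proof -
    have "of_nat (Suc s) ^ 2 * ?\<beta> (Suc s) = alt_binom (Suc s) k / fact s ^ 2"
      by (simp add: power_mult_distrib del: of_nat_Suc)
    then have "(of_nat (Suc s) - ?K) * (of_nat (Suc s) + ?K - 1) * of_nat (Suc s) ^ 2 * ?\<beta> (Suc s)
        = (of_nat (Suc s) - ?K) * (of_nat (Suc s) + ?K - 1) * (alt_binom (Suc s) k / fact s ^ 2)"
      by (simp only: mult.assoc)
    also have "\<dots> = (of_nat s + 1 - ?K) * (of_nat s + ?K) * alt_binom (Suc s) k / fact s ^ 2"
      by (simp add: add.commute)
    also have "\<dots> = - ((2 * of_nat s + 1) * (2 * of_nat s) * alt_binom s k) / fact s ^ 2"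
      unfolding alt_binom_shift_s[OF that] ..
    also have "(2 * of_nat s + 1) * (2 * of_nat s) = (4 * of_nat s ^ 2 + 2 * of_nat s :: 'a)"
      by (simp add: algebra_simps power2_eq_square)
    also have "- ((4 * of_nat s ^ 2 + 2 * of_nat s) * alt_binom s k) / fact s ^ 2 = - ((4 * of_nat s ^ 2 + 2 * of_nat s) * ?\<beta> s)"
      by simp
    finally show ?thesis .
  qed
  have "power_moment 4 k (Suc n) - power_moment 3 k (Suc n) - ?K * (?K - 1) * power_moment 2 k (Suc n)
      = (\<Sum>s = 1..Suc n. (of_nat s - ?K) * (of_nat s + ?K - 1) * of_nat s ^ 2 * ?\<beta> s / fact (Suc n - s))"
    unfolding power_moment_def sum_distrib_left sum_subtractf[symmetric]
    by (intro sum.cong refl) (simp add: field_simps eval_nat_numeral)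
  also have "\<dots> = (\<Sum>s = Suc 1..Suc n. (of_nat s - ?K) * (of_nat s + ?K - 1) * of_nat s ^ 2 * ?\<beta> s / fact (Suc n - s))"
    using one by (simp add: sum.atLeast_Suc_atMost)
  also have "\<dots> = (\<Sum>s = 1..n. (of_nat (Suc s) - ?K) * (of_nat (Suc s) + ?K - 1) * of_nat (Suc s) ^ 2 * ?\<beta> (Suc s) / fact (n - s))"
    by (subst sum.shift_bounds_cl_Suc_ivl) simp
  also have "\<dots> = (\<Sum>s = 1..n. - ((4 * of_nat s ^ 2 + 2 * of_nat s) * ?\<beta> s) / fact (n - s))"
    using step by (intro sum.cong refl) auto
  also have "\<dots> = - (4 * power_moment 2 k n + 2 * power_moment 1 k n)"
    unfolding power_moment_def sum_distrib_left sum.distrib[symmetric] sum_negf[symmetric]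
    by (intro sum.cong refl) (simp add: field_simps)
  finally show ?thesis by (simp add: algebra_simps)
qed

lemma lis_array_power_moment: "lis_array n k = fact n ^ 2 * power_moment 0 k n"
  unfolding lis_array_def power_moment_def sum_distrib_left by (intro sum.cong refl) simp

text \<open>All moments are eliminated in favour of the moment of order 0.\<close>

lemma power_moment_rec':
  fixes n k :: nat
  defines "N \<equiv> of_nat n + 4 :: 'a::field_char_0" and "K \<equiv> of_nat k :: 'a"
  shows "(N^4 - N^3 - K * (K - 1) * N^2) * power_moment 0 k (n + 4)
    + ((1 - 4 * N + 6 * N^2 - 4 * N^3) - (3 * N - 1 - 3 * N^2) - K * (K - 1) * (1 - 2 * N) + 4 * (N - 1)^2 + 2 * (N - 1)) * power_moment 0 k (n + 3)
    + ((7 - 12 * N + 6 * N^2) - (3 * N - 3) - K * (K - 1) + 4 * (3 - 2 * N) - 2) * power_moment 0 k (n + 2)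
    + (11 - 4 * N) * power_moment 0 k (n + 1) + power_moment 0 k n = 0"
proof -
  define x where "x = (of_nat n :: 'a)"
  have N: "N = x + 4" by (simp add: N_def x_def)
  let ?v = "\<lambda>j m. power_moment j k (n + m) :: 'a"
  have e: "?v i c = d * ?v j c - ?v j m" if "c = Suc m" "d = x + of_nat c" "i = Suc j" for i j c m d
    using power_moment_Suc[of j k "n + m", where 'a = 'a] that by (simp add: x_def add.assoc)
  have r1: "?v 1 4 = (x + 4) * ?v 0 4 - ?v 0 3" "?v 1 3 = (x + 3) * ?v 0 3 - ?v 0 2"
    "?v 1 2 = (x + 2) * ?v 0 2 - ?v 0 1" "?v 1 1 = (x + 1) * ?v 0 1 - ?v 0 0"
    by (rule e; simp)+
  have r2: "?v 2 4 = (x + 4) * ?v 1 4 - ?v 1 3" "?v 2 3 = (x + 3) * ?v 1 3 - ?v 1 2"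
    "?v 2 2 = (x + 2) * ?v 1 2 - ?v 1 1"
    by (rule e; simp)+
  have r3: "?v 3 4 = (x + 4) * ?v 2 4 - ?v 2 3" "?v 3 3 = (x + 3) * ?v 2 3 - ?v 2 2"
    by (rule e; simp)+
  have r4: "?v 4 4 = (x + 4) * ?v 3 4 - ?v 3 3"
    by (rule e; simp)
  have "?v 4 4 - ?v 3 4 - K * (K - 1) * ?v 2 4 + 4 * ?v 2 3 + 2 * ?v 1 3 = 0"
    using power_moment_rec[of k "n + 3", where 'a = 'a] unfolding K_def by (simp add: eval_nat_numeral)
  then show ?thesis
    unfolding N r4 r3 r2 r1 by (simp add: algebra_simps power2_eq_square power3_eq_cube power4_eq_xxxx)
qed

text \<open>By \<open>alt_binom_shift_k\<close> a multiplication by \<open>S\<close> can be expressed by shifts only where two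
neighbouring entries are added. The combination \<open>T\<close> of sums of neighbours has coefficients chosen such
that \<open>S * T f\<close> is, up to polynomial factors, again a combination of such sums, so that a second
multiplication by \<open>S\<close> is possible.\<close>

lemma alt_binom_rec:
  fixes n k s :: nat
  assumes s: "1 \<le> s"
  defines "x \<equiv> of_nat n :: 'a::field_char_0" and "y \<equiv> of_nat k :: 'a" and "S \<equiv> of_nat s :: 'a"
  defines "T \<equiv> \<lambda>f :: nat \<Rightarrow> 'a. (y + 1) * (f (k + 3) + f (k + 2)) + (y + 2) * (f (k + 2) + f (k + 1))"
  shows "((y + 2) * y - x * (y + 2)) * alt_binom s k
    + ((y + 2) * (y + 1)^2 + x + (y + 1)^2 - (y + 2) * (3 * y + 2)) * alt_binom s (k + 1)
    + (x * (2 * y + 3) - (y + 2) * (y + 1) * (2 * y + 3) - (y + 1) * (3 * y + 5) + (y + 2) * (3 * y + 4)) * alt_binom s (k + 2)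
    + ((y + 2)^2 * (y + 1) - x + (y + 1) * (3 * y + 7) - (y + 2)^2) * alt_binom s (k + 3)
    + (- x * (y + 1) - (y + 1) * (y + 3)) * alt_binom s (k + 4)
    = S^2 * T (alt_binom s) - (x - S) * T (alt_binom (Suc s))"
proof -
  let ?b = "\<lambda>j. alt_binom s (k + j) :: 'a"
  have e: "S * (?b (Suc j) + ?b j) = (y + of_nat j) * (?b j - ?b (Suc j))" for j
    using alt_binom_shift_k[OF s, of "k + j", where 'a = 'a] by (simp add: S_def y_def)
  have e0: "S * (?b 1 + ?b 0) = y * (?b 0 - ?b 1)" using e[of 0] by simp
  have e1: "S * (?b 2 + ?b 1) = (y + 1) * (?b 1 - ?b 2)" using e[of 1] by (simp add: eval_nat_numeral)
  have e2: "S * (?b 3 + ?b 2) = (y + 2) * (?b 2 - ?b 3)" using e[of 2] by (simp add: eval_nat_numeral)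
  have e3: "S * (?b 4 + ?b 3) = (y + 3) * (?b 3 - ?b 4)" using e[of 3] by (simp add: eval_nat_numeral)
  have b': "alt_binom (Suc s) (k + Suc j) = ?b j - 2 * ?b (Suc j) + ?b (Suc (Suc j))" for j
    using alt_binom_Suc[OF s, of "k + j", where 'a = 'a] by simp
  have c1: "alt_binom (Suc s) (k + 1) = ?b 0 - 2 * ?b 1 + ?b 2" using b'[of 0] by (simp add: eval_nat_numeral)
  have c2: "alt_binom (Suc s) (k + 2) = ?b 1 - 2 * ?b 2 + ?b 3" using b'[of 1] by (simp add: eval_nat_numeral)
  have c3: "alt_binom (Suc s) (k + 3) = ?b 2 - 2 * ?b 3 + ?b 4" using b'[of 2] by (simp add: eval_nat_numeral)
  have T1: "S^2 * T (alt_binom s) = (y + 1) * (y + 2) * ((y + 1) * (?b 1 - ?b 2) - (y + 2) * (?b 2 - ?b 3))"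
  proof -
    have "S * T (alt_binom s) = (y + 1) * (S * (?b 3 + ?b 2)) + (y + 2) * (S * (?b 2 + ?b 1))"
      by (simp add: T_def algebra_simps)
    also have "\<dots> = (y + 1) * (y + 2) * ((?b 2 + ?b 1) - (?b 3 + ?b 2))"
      unfolding e1 e2 by (simp add: algebra_simps)
    finally have ST: "S * T (alt_binom s) = (y + 1) * (y + 2) * ((?b 2 + ?b 1) - (?b 3 + ?b 2))" .
    have "S^2 * T (alt_binom s) = S * (S * T (alt_binom s))" by (simp add: power2_eq_square mult.assoc)
    also have "\<dots> = (y + 1) * (y + 2) * (S * (?b 2 + ?b 1) - S * (?b 3 + ?b 2))"
      unfolding ST by (simp add: algebra_simps)
    finally have "S^2 * T (alt_binom s) = (y + 1) * (y + 2) * (S * (?b 2 + ?b 1) - S * (?b 3 + ?b 2))" .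
    then show ?thesis unfolding e1 e2 .
  qed
  have T2: "T (alt_binom (Suc s)) = (y + 1) * ((?b 4 + ?b 3) - 2 * (?b 3 + ?b 2) + (?b 2 + ?b 1))
      + (y + 2) * ((?b 3 + ?b 2) - 2 * (?b 2 + ?b 1) + (?b 1 + ?b 0))"
    unfolding T_def c1 c2 c3 by (simp add: algebra_simps)
  have "S * T (alt_binom (Suc s)) = (y + 1) * (S * (?b 4 + ?b 3) - 2 * (S * (?b 3 + ?b 2)) + S * (?b 2 + ?b 1))
      + (y + 2) * (S * (?b 3 + ?b 2) - 2 * (S * (?b 2 + ?b 1)) + S * (?b 1 + ?b 0))"
    unfolding T2 by (simp add: algebra_simps)
  then have T3: "S * T (alt_binom (Suc s)) = (y + 1) * ((y + 3) * (?b 3 - ?b 4) - 2 * ((y + 2) * (?b 2 - ?b 3)) + (y + 1) * (?b 1 - ?b 2))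
      + (y + 2) * ((y + 2) * (?b 2 - ?b 3) - 2 * ((y + 1) * (?b 1 - ?b 2)) + y * (?b 0 - ?b 1))"
    unfolding e0 e1 e2 e3 .
  show ?thesis
    unfolding left_diff_distrib T1 T3 unfolding T2
    by (simp add: algebra_simps power2_eq_square)
qed

text \<open>The right hand side of \<open>alt_binom_rec\<close>, weighted by the coefficients of the sum, telescopes in \<open>s\<close>.
The lower boundary term is supported at \<open>k = 0\<close>, which the factor \<open>y\<close> removes.\<close>

lemma lis_array_rec_k:
  fixes n k :: nat
  defines "x \<equiv> of_nat n :: 'a::field_char_0" and "y \<equiv> of_nat k :: 'a"
  shows "y * ((y + 2) * y - x * (y + 2)) * lis_array n k
    + y * ((y + 2) * (y + 1)^2 + x + (y + 1)^2 - (y + 2) * (3 * y + 2)) * lis_array n (k + 1)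
    + y * (x * (2 * y + 3) - (y + 2) * (y + 1) * (2 * y + 3) - (y + 1) * (3 * y + 5) + (y + 2) * (3 * y + 4)) * lis_array n (k + 2)
    + y * ((y + 2)^2 * (y + 1) - x + (y + 1) * (3 * y + 7) - (y + 2)^2) * lis_array n (k + 3)
    + y * (- x * (y + 1) - (y + 1) * (y + 3)) * lis_array n (k + 4) = 0"
    (is "y * ?q0 * _ + y * ?q1 * _ + y * ?q2 * _ + y * ?q3 * _ + y * ?q4 * _ = 0")
proof -
  let ?g = "\<lambda>s. fact n ^ 2 / (fact s ^ 2 * fact (n - s)) :: 'a"
  let ?T = "\<lambda>f :: nat \<Rightarrow> 'a. (y + 1) * (f (k + 3) + f (k + 2)) + (y + 2) * (f (k + 2) + f (k + 1))"
  \<comment> \<open>Since \<open>s ^ 2 * ?g s = (n - s + 1) * ?g (s - 1)\<close>, the two parts of the summand are consecutive values of \<open>G\<close>.\<close>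
  define G where "G s = (x - of_nat s) * ?g s * ?T (alt_binom (Suc s))" for s
  have gs: "of_nat (Suc s) ^ 2 * ?g (Suc s) = (x - of_nat s) * ?g s" if "s < n" for s
  proof -
    have n: "n - s = Suc (n - Suc s)" using that by simp
    have xs: "x - of_nat s = of_nat (Suc (n - Suc s))"
      using that n unfolding x_def by (metis less_imp_le of_nat_diff)
    show ?thesis unfolding xs n by (simp add: power_mult_distrib del: of_nat_Suc)
  qed
  have lin: "a0 * lis_array n k + a1 * lis_array n (k + 1) + a2 * lis_array n (k + 2) + a3 * lis_array n (k + 3) + a4 * lis_array n (k + 4)
      = (\<Sum>s = 1..n. ?g s * (a0 * alt_binom s k + a1 * alt_binom s (k + 1) + a2 * alt_binom s (k + 2) + a3 * alt_binom s (k + 3) + a4 * alt_binom s (k + 4)))"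
    for a0 a1 a2 a3 a4 :: 'a
    unfolding lis_array_def sum_distrib_left sum.distrib[symmetric]
    by (intro sum.cong refl) (simp only: distrib_left distrib_right mult_ac)
  have "?q0 * lis_array n k + ?q1 * lis_array n (k + 1) + ?q2 * lis_array n (k + 2) + ?q3 * lis_array n (k + 3) + ?q4 * lis_array n (k + 4)
      = (\<Sum>s = 1..n. ?g s * (?q0 * alt_binom s k + ?q1 * alt_binom s (k + 1) + ?q2 * alt_binom s (k + 2) + ?q3 * alt_binom s (k + 3) + ?q4 * alt_binom s (k + 4)))"
    by (rule lin)
  also have "\<dots> = (\<Sum>s = 1..n. ?g s * (of_nat s ^ 2 * ?T (alt_binom s) - (x - of_nat s) * ?T (alt_binom (Suc s))))"
    using alt_binom_rec[where n = n and k = k and 'a = 'a] unfolding x_def y_def by (intro sum.cong refl) auto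
  also have "\<dots> = (\<Sum>s = 1..n. G (s - 1) - G s)"
  proof (rule sum.cong[OF refl])
    fix s assume s: "s \<in> {1..n}"
    then obtain t where t: "s = Suc t" "t < n" by (cases s) auto
    show "?g s * (of_nat s ^ 2 * ?T (alt_binom s) - (x - of_nat s) * ?T (alt_binom (Suc s))) = G (s - 1) - G s"
    proof -
      have "?g s * (of_nat s ^ 2 * ?T (alt_binom s)) = G (s - 1)"
        using gs[OF t(2)] unfolding G_def t(1) by (simp only: diff_Suc_1 mult.assoc[symmetric] mult.commute)
      then show ?thesis unfolding G_def by (simp only: right_diff_distrib mult_ac)
    qed
  qed
  also have "\<dots> = G 0 - G n"
    by (induction n) auto
  finally have main: "?q0 * lis_array n k + ?q1 * lis_array n (k + 1) + ?q2 * lis_array n (k + 2) + ?q3 * lis_array n (k + 3) + ?q4 * lis_array n (k + 4) = G 0 - G n" .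
  have "G n = 0" by (simp add: G_def x_def)
  moreover have "y * G 0 = 0"
    by (cases k) (auto simp: G_def y_def alt_binom_one)
  ultimately have "y * (?q0 * lis_array n k + ?q1 * lis_array n (k + 1) + ?q2 * lis_array n (k + 2) + ?q3 * lis_array n (k + 3) + ?q4 * lis_array n (k + 4)) = 0"
    unfolding main by simp
  moreover have "z * a0 * c0 + z * a1 * c1 + z * a2 * c2 + z * a3 * c3 + z * a4 * c4
      = z * (a0 * c0 + a1 * c1 + a2 * c2 + a3 * c3 + a4 * c4)"
    for z a0 a1 a2 a3 a4 c0 c1 c2 c3 c4 :: 'a
    by (simp add: algebra_simps)
  ultimately show ?thesis by (simp only:)
qed

text \<open>Multiplying the recurrence for the moments by \<open>fact (n + 4) ^ 2\<close> replaces them by entries of the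
array.\<close>

lemma lis_array_rec_n:
  fixes n k :: nat
  defines "N \<equiv> of_nat n + 4 :: 'a::field_char_0" and "K \<equiv> of_nat k :: 'a"
  shows "(N * (N - 1) * (N - 2) * (N - 3))^2 * lis_array n k
    + (11 - 4 * N) * (N * (N - 1) * (N - 2))^2 * lis_array (n + 1) k
    + ((7 - 12 * N + 6 * N^2) - (3 * N - 3) - K * (K - 1) + 4 * (3 - 2 * N) - 2) * (N * (N - 1))^2 * lis_array (n + 2) k
    + ((1 - 4 * N + 6 * N^2 - 4 * N^3) - (3 * N - 1 - 3 * N^2) - K * (K - 1) * (1 - 2 * N) + 4 * (N - 1)^2 + 2 * (N - 1)) * N^2 * lis_array (n + 3) k
    + (N^4 - N^3 - K * (K - 1) * N^2) * lis_array (n + 4) k = 0"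
    (is "_ * _ + ?a1 * _ * _ + ?a2 * _ * _ + ?a3 * _ * _ + ?a4 * _ = 0")
proof -
  define F where "F = (fact n :: 'a)"
  have f: "fact (n + 1) = (N - 3) * F" "fact (n + 2) = (N - 2) * (N - 3) * F"
    "fact (n + 3) = (N - 1) * (N - 2) * (N - 3) * F" "fact (n + 4) = N * (N - 1) * (N - 2) * (N - 3) * F"
    by (simp_all add: N_def F_def eval_nat_numeral algebra_simps)
  have "?a4 * power_moment 0 k (n + 4) + ?a3 * power_moment 0 k (n + 3) + ?a2 * power_moment 0 k (n + 2) + ?a1 * power_moment 0 k (n + 1) + power_moment 0 k n = 0"
    unfolding N_def K_def by (rule power_moment_rec')
  then have "(N * (N - 1) * (N - 2) * (N - 3) * F)^2 *
      (?a4 * power_moment 0 k (n + 4) + ?a3 * power_moment 0 k (n + 3) + ?a2 * power_moment 0 k (n + 2) + ?a1 * power_moment 0 k (n + 1) + power_moment 0 k n) = 0"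
    by (simp only: mult_zero_right)
  moreover have "P^2 * (a4 * v4 + a3 * v3 + a2 * v2 + a1 * v1 + v0)
      = P^2 * v0 + a1 * (P^2 * v1) + a2 * (P^2 * v2) + a3 * (P^2 * v3) + a4 * (P^2 * v4)"
    for P a1 a2 a3 a4 v0 v1 v2 v3 v4 :: 'a
    by (simp add: algebra_simps)
  ultimately show ?thesis
    unfolding lis_array_power_moment f F_def[symmetric] by (simp only: power_mult_distrib mult_ac)
qed

definition poly_X :: "'a::field_char_0 poly poly" where "poly_X = [:[:0, 1:]:]"
definition poly_Y :: "'a::field_char_0 poly poly" where "poly_Y = [:0, 1:]"

lemma poly_xy_simps:
  "poly_xy poly_X x y = x" "poly_xy poly_Y x y = y" "poly_xy 1 x y = 1" "poly_xy (numeral w) x y = numeral w"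
  "poly_xy (p + q) x y = poly_xy p x y + poly_xy q x y" "poly_xy (p - q) x y = poly_xy p x y - poly_xy q x y"
  "poly_xy (- p) x y = - poly_xy p x y"
  "poly_xy (p * q) x y = poly_xy p x y * poly_xy q x y" "poly_xy (p ^ i) x y = poly_xy p x y ^ i"
  by (simp_all add: poly_xy_def poly_X_def poly_Y_def)

lemma nonzero_poly_xy: "poly_xy p x y \<noteq> 0 \<Longrightarrow> p \<noteq> 0"
  by (auto simp: poly_xy_def)

lemma sum_atMost_4: "(\<Sum>i\<le>(4::nat). f i) = f 0 + f 1 + f 2 + f 3 + (f 4 :: 'a::comm_monoid_add)"
  by (simp add: eval_nat_numeral add.assoc)

lemma D_finite_lis_array: "D_finite (lis_array :: nat \<Rightarrow> nat \<Rightarrow> 'a::field_char_0)"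
  unfolding D_finite_def
proof (intro conjI)
  let ?N = "poly_X + 4 :: 'a poly poly" and ?K = "poly_Y :: 'a poly poly"
  define ps :: "'a poly poly list" where "ps =
    [(?N * (?N - 1) * (?N - 2) * (?N - 3))^2,
     (11 - 4 * ?N) * (?N * (?N - 1) * (?N - 2))^2,
     ((7 - 12 * ?N + 6 * ?N^2) - (3 * ?N - 3) - ?K * (?K - 1) + 4 * (3 - 2 * ?N) - 2) * (?N * (?N - 1))^2,
     ((1 - 4 * ?N + 6 * ?N^2 - 4 * ?N^3) - (3 * ?N - 1 - 3 * ?N^2) - ?K * (?K - 1) * (1 - 2 * ?N) + 4 * (?N - 1)^2 + 2 * (?N - 1)) * ?N^2,
     ?N^4 - ?N^3 - ?K * (?K - 1) * ?N^2]"
  have nz: "ps ! 0 \<noteq> 0"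
    by (rule nonzero_poly_xy[of _ 0 0]) (simp add: ps_def poly_xy_simps)
  have rec: "(\<Sum>i\<le>4. poly_xy (ps ! i) (of_nat n) (of_nat k) * lis_array (n + i) k) = (0::'a)" for n k
    using lis_array_rec_n[of n k, where 'a = 'a] unfolding sum_atMost_4
    by (simp add: ps_def poly_xy_simps)
  show "\<exists>r p. (\<exists>i\<le>r. p i \<noteq> 0) \<and> (\<forall>n k. (\<Sum>i\<le>r. poly_xy (p i) (of_nat n) (of_nat k) * lis_array (n + i) k) = (0::'a))"
    using nz rec by (intro exI[of _ 4] exI[of _ "\<lambda>i. ps ! i"]) auto
next
  let ?x = "poly_X :: 'a poly poly" and ?y = "poly_Y :: 'a poly poly"
  define qs :: "'a poly poly list" where "qs =
    [?y * ((?y + 2) * ?y - ?x * (?y + 2)),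
     ?y * ((?y + 2) * (?y + 1)^2 + ?x + (?y + 1)^2 - (?y + 2) * (3 * ?y + 2)),
     ?y * (?x * (2 * ?y + 3) - (?y + 2) * (?y + 1) * (2 * ?y + 3) - (?y + 1) * (3 * ?y + 5) + (?y + 2) * (3 * ?y + 4)),
     ?y * ((?y + 2)^2 * (?y + 1) - ?x + (?y + 1) * (3 * ?y + 7) - (?y + 2)^2),
     ?y * (- ?x * (?y + 1) - (?y + 1) * (?y + 3))]"
  \<comment> \<open>At \<open>(0, 0)\<close> all these polynomials vanish because of the factor \<open>y\<close>.\<close>
  have nz: "qs ! 0 \<noteq> 0"
    by (rule nonzero_poly_xy[of _ 0 1]) (simp add: qs_def poly_xy_simps)
  have rec: "(\<Sum>j\<le>4. poly_xy (qs ! j) (of_nat n) (of_nat k) * lis_array n (k + j)) = (0::'a)" for n k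
    using lis_array_rec_k[of k n, where 'a = 'a] unfolding sum_atMost_4
    by (simp add: qs_def poly_xy_simps)
  show "\<exists>s q. (\<exists>j\<le>s. q j \<noteq> 0) \<and> (\<forall>n k. (\<Sum>j\<le>s. poly_xy (q j) (of_nat n) (of_nat k) * lis_array n (k + j)) = (0::'a))"
    using nz rec by (intro exI[of _ 4] exI[of _ "\<lambda>i. qs ! i"]) auto
qed

text \<open>The same array with integer entries, which carries the identity from the reals to any field of
characteristic 0.\<close>

definition lis_array_int :: "nat \<Rightarrow> nat \<Rightarrow> int" where
  "lis_array_int n k = (\<Sum>s = 1..n. int (fact (n - s) * (n choose s) ^ 2) *
     (if k \<le> s then (- 1) ^ (s - k) * int ((2 * s - 1) choose (s - k)) else 0))"

lemma lis_array_of_int: "lis_array n k = (of_int (lis_array_int n k) :: 'a::field_char_0)"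
proof -
  have "fact n ^ 2 / (fact s ^ 2 * fact (n - s)) = (of_nat (fact (n - s) * (n choose s) ^ 2) :: 'a)" if "s \<le> n" for s
    using binomial_fact[OF that, where 'a = 'a] by (simp add: power2_eq_square field_simps)
  then show ?thesis
    unfolding lis_array_def lis_array_int_def of_int_sum by (intro sum.cong refl) (simp add: alt_binom_def)
qed

lemma lis_count_lis_array:
  assumes k: "1 \<le> n" "n \<le> 2 * k" "k \<le> n"
  shows "of_nat (lis_count n k) = (lis_array n k :: 'a::field_char_0)"
proof -
  have m: "n - k < card {1..n}" using k by simp
  have "real (lis_count n k) = stratum_dim {1..n} (n - k)" by (rule lis_count_stratum_dim) (use k in auto)
  also have "\<dots> = (\<Sum>r\<le>n - k. fact n ^ 2 / (fact r * fact (n - r) ^ 2) *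
           ((- 1) ^ (n - k - r) * real ((2 * (n - r) - 1) choose (n - k - r))))"
    using stratum_dim_closed_form[OF _ m] by simp
  also have "\<dots> = (\<Sum>s = k..n. fact n ^ 2 / (fact s ^ 2 * fact (n - s)) * alt_binom s k)"
    by (rule sum.reindex_bij_witness[where i = "\<lambda>s. n - s" and j = "\<lambda>r. n - r"])
       (use k in \<open>auto simp: alt_binom_def mult.commute add.commute\<close>)
  also have "\<dots> = lis_array n k"
    unfolding lis_array_def by (rule sum.mono_neutral_left) (use k in \<open>auto simp: alt_binom_def\<close>)
  finally have "real (lis_count n k) = of_int (lis_array_int n k)" unfolding lis_array_of_int .
  then have "int (lis_count n k) = lis_array_int n k" by linarith
  then show ?thesis unfolding lis_array_of_int by (metis of_int_of_nat_eq)
qed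

theorem mainTheorem2:
  "D_finite_inside {(n, k). 1 \<le> n \<and> real n / 2 \<le> real k \<and> k \<le> n}
     (\<lambda>n k. of_nat (lis_count n k) :: 'a::field_char_0)"
  unfolding D_finite_inside_def
proof (intro exI[of _ lis_array] conjI D_finite_lis_array, clarify)
  fix n k :: nat assume a: "1 \<le> n" "real n / 2 \<le> real k" "k \<le> n"
  then have "n \<le> 2 * k" by linarith
  then show "lis_array n k = (of_nat (lis_count n k) :: 'a)" using lis_count_lis_array[of n k, where 'a = 'a] a by simp
qed

end
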